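(* Let $X$ be a fractional Wiener--Weierstra\ss\ bridge with parameters $\alpha\in(0,1)$, $b\in\{2,3,\dots\}$ and $H\in(0,1)$, and put $K:=1\wedge(-\log_b\alpha)$. Suppose $H\neq K$ and set $p:=1/(H\wedge K)$. Then, $\mathbb P$-almost surely, $\langle X\rangle^{(q)}_1=\infty$ for every $q<p$ and $\langle X\rangle^{(q)}_1=0$ for every $q>p$. More precisely: (a) If $H>K$, there exists a random variable $V$ with $0<V<\infty$ a.s. such that $\mathbb P$-a.s., for all $t\in[0,1]$, $\langle X\rangle^{(1/K)}_t=V\cdot t$. (b) If $H<K$, then $\mathbb P$-a.s., for all $t\in[0,1]$, $$\langle X\rangle^{(1/H)}_t=\frac{2^{1/(2H)}\,\Gamma\big(\frac{H+1}{2H}\big)}{\sqrt\pi\,(1-\alpha^2b^{2H})^{1/(2H)}}\cdot t .$$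
   Context: Let $W=(W(t))_{t\ge0}$ be a fractional Brownian motion with Hurst parameter $H\in(0,1)$. Let $\kappa:[0,1]\to[0,1]$ be a deterministic function with $\kappa(0)=0$, $\kappa(1)=1$ that is H\"older continuous with some exponent $\tau\in(H,1]$. The fractional Brownian bridge is $B(t):=W(t)-\kappa(t)W(1)$, $t\in[0,1]$. For $x\ge0$, $\{x\}$ denotes the fractional part of $x$. For $\alpha\in(0,1)$, $b\in\{2,3,\dots\}$, the fractional Wiener--Weierstra\ss\ bridge is $X(t):=\sum_{n=0}^\infty\alpha^nB(\{b^nt\})$, $0\le t\le1$. For a function $f:[0,1]\to\mathbb R$ and $p>0$, the $p$-th variation along the $b$-adic partitions is $\langle f\rangle^{(p)}_t:=\lim_{n\to\infty}\sum_{k=0}^{\lfloor tb^n\rfloor-1}|f((k+1)b^{-n})-f(kb^{-n})|^p$, $t\in[0,1]$, provided the limit exists (possibly $+\infty$). *)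

theory Defs
  imports "HOL-Probability.Probability"
begin

definition fbm_cov :: "real \<Rightarrow> real \<Rightarrow> real \<Rightarrow> real" where
  "fbm_cov H s t = ((s powr (2*H)) + (t powr (2*H)) - (\<bar>t - s\<bar> powr (2*H))) / 2"

text \<open>W is a fractional Brownian motion with Hurst parameter H on the probability space M:
  each W t (t \<ge> 0) is a real random variable, the process is centred jointly Gaussian with
  covariance fbm_cov H (expressed through the joint characteristic function of all finite
  families), and almost all sample paths are continuous on [0,\<infinity>).\<close>
definition is_fbm :: "'a measure \<Rightarrow> real \<Rightarrow> (real \<Rightarrow> 'a \<Rightarrow> real) \<Rightarrow> bool" where
  "is_fbm M H W \<longleftrightarrow> prob_space M \<and>
     (\<forall>t\<ge>0. W t \<in> borel_measurable M) \<and>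
     (\<forall>(n::nat) (ts::nat \<Rightarrow> real) (c::nat \<Rightarrow> real). (\<forall>i<n. ts i \<ge> 0) \<longrightarrow>
        (\<integral>\<omega>. cis (\<Sum>i<n. c i * W (ts i) \<omega>) \<partial>M)
          = complex_of_real (exp (- (\<Sum>i<n. \<Sum>j<n. c i * c j * fbm_cov H (ts i) (ts j)) / 2))) \<and>
     (AE \<omega> in M. continuous_on {0..} (\<lambda>t. W t \<omega>))"

definition fbb :: "(real \<Rightarrow> real) \<Rightarrow> (real \<Rightarrow> 'a \<Rightarrow> real) \<Rightarrow> real \<Rightarrow> 'a \<Rightarrow> real" where
  "fbb \<kappa> W t \<omega> = W t \<omega> - \<kappa> t * W 1 \<omega>"

definition fwwb :: "real \<Rightarrow> nat \<Rightarrow> (real \<Rightarrow> real) \<Rightarrow> (real \<Rightarrow> 'a \<Rightarrow> real) \<Rightarrow> real \<Rightarrow> 'a \<Rightarrow> real" where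
  "fwwb \<alpha> b \<kappa> W t \<omega> = (\<Sum>n. \<alpha> ^ n * fbb \<kappa> W (frac (real b ^ n * t)) \<omega>)"

definition pvar_sum :: "(real \<Rightarrow> real) \<Rightarrow> nat \<Rightarrow> real \<Rightarrow> real \<Rightarrow> nat \<Rightarrow> real" where
  "pvar_sum f b p t n =
     (\<Sum>k<nat \<lfloor>t * real b ^ n\<rfloor>. \<bar>f (real (k+1) / real b ^ n) - f (real k / real b ^ n)\<bar> powr p)"

definition has_pvar :: "(real \<Rightarrow> real) \<Rightarrow> nat \<Rightarrow> real \<Rightarrow> real \<Rightarrow> ereal \<Rightarrow> bool" where
  "has_pvar f b p t v \<longleftrightarrow> ((\<lambda>n. ereal (pvar_sum f b p t n)) \<longlongrightarrow> v) sequentially"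

end

theory Submission
  imports Defs
begin

text \<open>
  At level \<open>N\<close> the increment of \<open>X\<close> over the \<open>k\<close>-th \<open>b\<close>-adic interval is
  \<open>\<Sum>i<N. \<alpha> ^ i * \<Delta>B (N - i) (k mod b ^ (N - i))\<close>, where \<open>\<Delta>B m j\<close> is the increment of the bridge over the
  \<open>j\<close>-th interval of level \<open>m\<close>, because \<open>B\<close> vanishes at \<open>0\<close> and \<open>1\<close>.

  If \<open>\<alpha> * b powr H > 1\<close>, the coarse levels dominate: after division by \<open>\<alpha> ^ N\<close> the increment is, up to a uniformly
  small error, a periodic function of \<open>k\<close>, so the sums of its powers converge to a multiple \<open>V * t\<close>.
  Here \<open>V = 0\<close> would force \<open>\<Sum>m\<ge>1. B (1 / b ^ m) / \<alpha> ^ m = 0\<close>. This Gaussian variable is nondegenerate, since its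
  covariance with the second difference of \<open>W\<close> at \<open>1 / b\<close> with step \<open>h\<close> is of order \<open>h powr (2 * H)\<close>.

  If \<open>\<alpha> * b powr H < 1\<close>, the increment multiplied by \<open>b powr (N * H)\<close> is close to a Gaussian variable of variance
  \<open>1 / (1 - \<alpha>\<^sup>2 * b powr (2 * H))\<close> for most \<open>k\<close>, and these variables are nearly uncorrelated on average.
  The characteristic functions of their empirical measures therefore converge almost surely; averages of cosh, controlled
  in the same way, give the uniform integrability needed to pass to absolute moments.
  For the remaining exponents it suffices that the largest increment tends to zero.
\<close>

section \<open>Centred normal random variables\<close>

text \<open>The multilevel increments are correlated at all distances and across levels, so no
  independence is available. Its substitute is the sum of absolute covariances over all pairs of
  indices: divided by the number of pairs it decays geometrically for every \<open>H\<close> in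
  (0,1), because the signs of the covariances are known and the sums telescope. A variance bound
  linear in these absolute covariances is therefore summable over the levels and gives almost sure
  convergence directly. This is why fluctuations are measured through cos, sin and cosh: for bounded
  variances their Gaussian covariances are Lipschitz in the underlying covariance. The condition
  \<open>\<tau> > H\<close> makes the increments of \<open>\<kappa>\<close> negligible. In the
  smooth regime they are a uniformly vanishing perturbation; in the rough regime they only add a
  bounded multiple of \<open>W 1\<close> to the leading functional, and \<open>W 1\<close> has
  covariance of order \<open>h\<^sup>2\<close> with the second difference that serves as test
  variable.\<close>

lemma std_normal_cosh:
  "has_bochner_integral lborel (\<lambda>x. std_normal_density x * cosh (s * x)) (exp (s\<^sup>2 / 2))"
proof -
  \<comment> \<open>Completing the square: tilting by \<open>exp (s * x)\<close> moves the mean to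
    \<open>s\<close>, so the integral is read off from the total mass of
    \<open>normal_density s 1\<close>.\<close>
  have e: "std_normal_density x * exp (s * x) = exp (s\<^sup>2/2) * normal_density s 1 x" for x s :: real
    unfolding normal_density_def
    by (simp add: exp_add[symmetric] field_simps power2_eq_square) 
  have h: "has_bochner_integral lborel (normal_density s 1) 1" for s :: real
    by (simp add: has_bochner_integral_iff)
  have "has_bochner_integral lborel (\<lambda>x. exp (s\<^sup>2/2) * normal_density s 1 x) (exp (s\<^sup>2/2) * 1)" for s :: real
    by (intro has_bochner_integral_mult_right h)
  then have f: "has_bochner_integral lborel (\<lambda>x. std_normal_density x * exp (s * x)) (exp (s\<^sup>2/2))" for s :: real
    by (simp add: e)
  have "has_bochner_integral lborel
     (\<lambda>x. (std_normal_density x * exp (s * x) + std_normal_density x * exp ((- s) * x)) * (1/2))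
     ((exp (s\<^sup>2/2) + exp ((-s)\<^sup>2/2)) * (1/2))"
    by (intro has_bochner_integral_mult_left has_bochner_integral_add f)
  then show ?thesis
    by (simp add: cosh_def algebra_simps)
qed

text \<open>Uniqueness of characteristic functions. The law is written as an image of the standard
  normal law and not through a density, so that the degenerate case \<open>v = 0\<close> is
  included.\<close>

lemma (in prob_space) centred_gaussian_distr:
  assumes X[measurable]: "X \<in> borel_measurable M"
    and ch: "\<And>u. (\<integral>\<omega>. cis (u * X \<omega>) \<partial>M) = complex_of_real (exp (- (u\<^sup>2 * v) / 2))"
    and v: "v \<ge> 0"
  shows "distr M borel X = distr std_normal_distribution borel (\<lambda>x. sqrt v * x)"
proof (rule Levy_uniqueness)
  show "real_distribution (distr M borel X)"
    by (rule real_distribution_distr) simp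
  interpret N: real_distribution std_normal_distribution
    by (rule real_dist_normal_dist)
  show "real_distribution (distr std_normal_distribution borel (\<lambda>x. sqrt v * x))"
    by (rule N.real_distribution_distr) simp
  show "char (distr M borel X) = char (distr std_normal_distribution borel ((*) (sqrt v)))"
  proof
    fix u
    have "char (distr M borel X) u = (\<integral>\<omega>. cis (u * X \<omega>) \<partial>M)"
      unfolding char_def by (subst integral_distr) (auto simp: cis_conv_exp)
    moreover have "char (distr std_normal_distribution borel ((*) (sqrt v))) u
        = char std_normal_distribution (u * sqrt v)"
      unfolding char_def by (subst integral_distr) (auto simp: mult.assoc)
    ultimately show "char (distr M borel X) u = char (distr std_normal_distribution borel ((*) (sqrt v))) u"
      using v by (simp add: ch char_std_normal_distribution power_mult_distrib)
  qed
qed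

lemma (in prob_space) centred_gaussian_cosh:
  assumes X[measurable]: "X \<in> borel_measurable M"
    and ch: "\<And>u. (\<integral>\<omega>. cis (u * X \<omega>) \<partial>M) = complex_of_real (exp (- (u\<^sup>2 * v) / 2))"
    and v: "v \<ge> 0"
  shows "has_bochner_integral M (\<lambda>\<omega>. cosh (X \<omega>)) (exp (v / 2))"
proof -
  have [measurable]: "(cosh :: real \<Rightarrow> real) \<in> borel_measurable borel"
    unfolding cosh_def by measurable
  have "has_bochner_integral std_normal_distribution (\<lambda>x. cosh (sqrt v * x)) (exp (v / 2))"
    using std_normal_cosh[of "sqrt v"] v
    by (subst has_bochner_integral_density) auto
  then have "has_bochner_integral (distr std_normal_distribution borel (\<lambda>x. sqrt v * x)) cosh (exp (v / 2))"
    by (subst has_bochner_integral_distr) auto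
  then have "has_bochner_integral (distr M borel X) cosh (exp (v / 2))"
    by (simp add: centred_gaussian_distr[OF assms])
  then show ?thesis
    by (simp add: has_bochner_integral_iff integrable_distr_eq integral_distr)
qed

text \<open>The standard normal density is at most 1, so an interval has at most its length as
  probability. Only the linear order in \<open>e\<close> matters: it is what rules out that Gaussian
  variables with variances bounded below tend to zero.\<close>

lemma (in prob_space) centred_gaussian_small_ball:
  assumes X[measurable]: "X \<in> borel_measurable M"
    and ch: "\<And>u. (\<integral>\<omega>. cis (u * X \<omega>) \<partial>M) = complex_of_real (exp (- (u\<^sup>2 * v) / 2))"
    and v: "v > 0" and e: "e \<ge> 0"
  shows "prob {\<omega>\<in>space M. \<bar>X \<omega>\<bar> \<le> e} \<le> 2 * e / sqrt v"
proof -
  have "emeasure M {\<omega>\<in>space M. \<bar>X \<omega>\<bar> \<le> e} = emeasure (distr M borel X) {-e..e}"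
    by (subst emeasure_distr) (auto intro!: arg_cong[where f = "emeasure M"])
  also have "\<dots> = emeasure (distr std_normal_distribution borel (\<lambda>x. sqrt v * x)) {-e..e}"
    using v by (subst centred_gaussian_distr[OF X ch]) auto
  also have "\<dots> = emeasure std_normal_distribution ((\<lambda>x. sqrt v * x) -` {-e..e})"
    by (subst emeasure_distr) auto
  also have "(\<lambda>x. sqrt v * x) -` {-e..e} = {-e / sqrt v..e / sqrt v}"
    using v by (auto simp: field_simps)
  also have "emeasure std_normal_distribution {-e / sqrt v..e / sqrt v}
      = (\<integral>\<^sup>+x. ennreal (std_normal_density x) * indicator {-e / sqrt v..e / sqrt v} x \<partial>lborel)"
    by (subst emeasure_density) auto
  also have "\<dots> \<le> (\<integral>\<^sup>+x. indicator {-e / sqrt v..e / sqrt v} x \<partial>lborel)"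
  proof (rule nn_integral_mono)
    fix x :: real
    have "1 \<le> sqrt (2 * pi)" using pi_gt3 by simp
    then have "std_normal_density x \<le> 1"
      unfolding std_normal_density_def
      by (intro mult_le_one) (auto simp: field_simps)
    then show "ennreal (std_normal_density x) * indicator {-e / sqrt v..e / sqrt v} x
        \<le> indicator {-e / sqrt v..e / sqrt v} x"
      by (auto simp: indicator_def)
  qed
  also have "\<dots> = ennreal (2 * e / sqrt v)"
    using v e by (simp add: divide_right_mono)
  finally show ?thesis
    using v e by (simp add: emeasure_eq_measure)
qed

text \<open>The substitution \<open>t = x\<^sup>2 / 2\<close> turns Euler's integral for
  \<open>Gamma ((p + 1) / 2)\<close> into the moment over the positive half-line, up to a power of
  2; evenness supplies the other half. At \<open>p = 1 / H\<close> this is the numerical constant of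
  the smooth regime.\<close>

lemma std_normal_abs_powr:
  assumes p: "p > 0"
  shows "has_bochner_integral lborel (\<lambda>x. std_normal_density x * \<bar>x\<bar> powr p)
           (2 powr (p/2) * Gamma ((p + 1) / 2) / sqrt pi)"
proof -
  let ?s = "(p + 1) / 2"
  let ?f = "\<lambda>t::real. t powr (?s - 1) / exp t"
  let ?h = "\<lambda>x::real. 2 powr (- ((p - 1) / 2)) * (\<bar>x\<bar> powr p * exp (- x\<^sup>2 / 2))"
  have img: "(\<lambda>x::real. x\<^sup>2 / 2) ` {0<..} = {0<..}"
  proof (intro equalityI subsetI)
    fix y :: real assume "y \<in> {0<..}"
    then show "y \<in> (\<lambda>x::real. x\<^sup>2 / 2) ` {0<..}"
      by (intro image_eqI[of _ _ "sqrt (2 * y)"]) auto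
  qed auto
  have G: "(?f has_integral Gamma ?s) {0..}"
    using p by (intro Gamma_integral_real) auto
  then have "(?f has_integral Gamma ?s) {0<..}"
    by (subst has_integral_spike_set_eq[of _ "{0..}"]) (auto intro: negligible_subset[of "{0}"])
  then have "?f absolutely_integrable_on {0<..} \<and> integral {0<..} ?f = Gamma ?s"
    by (auto intro!: nonnegative_absolutely_integrable_1 simp: has_integral_iff)
  then have "(\<lambda>x. \<bar>x\<bar> * ?f (x\<^sup>2 / 2)) absolutely_integrable_on {0<..}
      \<and> integral {0<..} (\<lambda>x. \<bar>x\<bar> * ?f (x\<^sup>2 / 2)) = Gamma ?s"
    by (subst has_absolute_integral_change_of_variables_1'[where g = "\<lambda>x. x\<^sup>2 / 2"])
       (auto simp: img inj_on_def power2_eq_iff intro!: derivative_eq_intros)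
  moreover have eq: "\<bar>x\<bar> * ?f (x\<^sup>2 / 2) = ?h x" if "x \<in> {0<..}" for x :: real
  proof -
    have x: "x > 0" using that by simp
    have "x\<^sup>2 = x powr 2" using x by simp
    then have "(x\<^sup>2) powr ((p - 1) / 2) = x powr (2 * ((p - 1) / 2))"
      by (simp only: powr_powr)
    also have "2 * ((p - 1) / 2) = p - 1" by simp
    finally have "(x\<^sup>2) powr ((p - 1) / 2) = x powr (p - 1)" .
    moreover have "?s - 1 = (p - 1) / 2" by (simp add: field_simps)
    ultimately have "(x\<^sup>2 / 2) powr (?s - 1) = x powr (p - 1) * 2 powr (- ((p - 1) / 2))"
      using x by (simp add: powr_divide powr_minus_divide)
    then show ?thesis
      using x by (simp add: powr_diff exp_minus field_simps)
  qed
  ultimately have "(\<lambda>x. \<bar>x\<bar> * ?f (x\<^sup>2 / 2)) absolutely_integrable_on {0<..}"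
      "integral {0<..} (\<lambda>x. \<bar>x\<bar> * ?f (x\<^sup>2 / 2)) = Gamma ?s" by auto
  note * = this
  have h: "?h absolutely_integrable_on {0<..}"
    by (rule set_integrable_cong[THEN iffD1, OF refl refl eq *(1)])
  have "integral {0<..} ?h = Gamma ?s"
    using *(2) integral_cong[OF eq] by (rule trans[OF sym, rotated])
  have "has_bochner_integral lebesgue (\<lambda>x. indicator {0<..} x *\<^sub>R ?h x) (Gamma ?s)"
    using h \<open>integral {0<..} ?h = Gamma ?s\<close> set_lebesgue_integral_eq_integral(2)[OF h]
    unfolding has_bochner_integral_iff set_integrable_def set_lebesgue_integral_def by (simp only:)
  then have "has_bochner_integral lborel (\<lambda>x. indicator {0<..} x *\<^sub>R ?h x) (Gamma ?s)"
    by (simp add: has_bochner_integral_iff integrable_completion integral_completion)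
  \<comment> \<open>The rule for even functions asks for the closed half-line; the integrand
    vanishes at 0, so the two versions agree.\<close>
  moreover have "indicator {0<..} x *\<^sub>R ?h x = indicator {0..} x *\<^sub>R ?h x" for x :: real
    by (cases "x = 0") (auto simp: indicator_def)
  ultimately have "has_bochner_integral lborel (\<lambda>x. indicator {0..} x *\<^sub>R ?h x) (Gamma ?s)"
    by (simp only:)
  then have "has_bochner_integral lborel ?h (2 *\<^sub>R Gamma ?s)"
    by (rule has_bochner_integral_even_function) simp
  from has_bochner_integral_mult_right[OF this, of "2 powr ((p - 1) / 2) / sqrt (2 * pi)"]
  have "has_bochner_integral lborel (\<lambda>x. 2 powr ((p - 1) / 2) / sqrt (2 * pi) * ?h x)
     (2 powr ((p - 1) / 2) / sqrt (2 * pi) * (2 * Gamma ?s))" by simp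
  moreover have "2 powr ((p - 1) / 2) / sqrt (2 * pi) * ?h x = std_normal_density x * \<bar>x\<bar> powr p" for x
  proof -
    have "2 powr ((p - 1) / 2) * 2 powr (- ((p - 1) / 2)) = (1::real)"
      by (simp flip: powr_add add: field_simps)
    then show ?thesis by (simp add: std_normal_density_def algebra_simps)
  qed
  moreover have "2 powr ((p - 1) / 2) / sqrt (2 * pi) * (2 * Gamma ?s)
      = 2 powr (p/2) * Gamma ?s / sqrt pi"
  proof -
    have "2 powr ((p - 1) / 2) = 2 powr (p/2) / (2 powr (1/2) :: real)"
      by (simp flip: powr_diff add: diff_divide_distrib)
    then have "2 powr (p/2) = sqrt 2 * 2 powr ((p - 1) / 2)"
      by (simp add: powr_half_sqrt)
    then have "sqrt 2 * 2 powr (p/2) = 2 * 2 powr ((p - 1) / 2)"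
      by simp
    then show ?thesis
      by (simp add: real_sqrt_mult field_simps)
  qed
  ultimately show ?thesis by simp
qed

section \<open>Gaussian families and increments of fractional Brownian motion\<close>

text \<open>Covariance of \<open>W t - W s\<close> and \<open>W v - W u\<close> for fractional
  Brownian motion: the powers of single times cancel, and only differences of times remain.\<close>

definition fbm_incr_cov :: "real \<Rightarrow> real \<Rightarrow> real \<Rightarrow> real \<Rightarrow> real \<Rightarrow> real" where
  "fbm_incr_cov H s t u v = (\<bar>t - u\<bar> powr (2*H) + \<bar>s - v\<bar> powr (2*H)
     - \<bar>t - v\<bar> powr (2*H) - \<bar>s - u\<bar> powr (2*H)) / 2"

text \<open>Stated through characteristic functions for an arbitrary index type, so that it
  transfers directly from \<open>is_fbm\<close>. Symmetry of \<open>\<Gamma>\<close> is demanded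
  separately, since the quadratic form sees only the symmetric part of a kernel.\<close>

definition gaussian_family :: "'a measure \<Rightarrow> ('i \<Rightarrow> 'a \<Rightarrow> real) \<Rightarrow> ('i \<Rightarrow> 'i \<Rightarrow> real) \<Rightarrow> bool" where
  "gaussian_family M \<xi> \<Gamma> \<longleftrightarrow> prob_space M \<and> (\<forall>i. \<xi> i \<in> borel_measurable M) \<and> (\<forall>i j. \<Gamma> i j = \<Gamma> j i) \<and>
     (\<forall>A c. finite A \<longrightarrow> (\<integral>\<omega>. cis (\<Sum>i\<in>A. c i * \<xi> i \<omega>) \<partial>M)
        = complex_of_real (exp (- (\<Sum>i\<in>A. \<Sum>j\<in>A. c i * c j * \<Gamma> i j) / 2)))"

lemma fbm_incr_cov_sym: "fbm_incr_cov H s t u v = fbm_incr_cov H u v s t"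
  by (simp add: fbm_incr_cov_def abs_minus_commute)

lemma fbm_incr_cov_eq:
  "fbm_incr_cov H s t u v = fbm_cov H t v - fbm_cov H t u - fbm_cov H s v + fbm_cov H s u"
  by (simp add: fbm_incr_cov_def fbm_cov_def abs_minus_commute field_simps)

lemma fbm_finite_char:
  assumes fbm: "is_fbm M H W" and A: "finite A" and t: "\<And>i. i \<in> A \<Longrightarrow> 0 \<le> t i"
  shows "(\<integral>\<omega>. cis (\<Sum>i\<in>A. c i * W (t i) \<omega>) \<partial>M)
     = complex_of_real (exp (- (\<Sum>i\<in>A. \<Sum>j\<in>A. c i * c j * fbm_cov H (t i) (t j)) / 2))"
proof -
  obtain h where h: "bij_betw h {..<card A} A"
    using ex_bij_betw_nat_finite[OF A] by (auto simp: atLeast0LessThan)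
  have r: "(\<Sum>i\<in>A. g i) = (\<Sum>i<card A. g (h i))" for g :: "_ \<Rightarrow> real"
    using sum.reindex_bij_betw[OF h, of g] by simp
  have t': "0 \<le> t (h i)" if "i < card A" for i using that h t by (auto simp: bij_betw_def)
  have "\<forall>(n::nat) (ts::nat \<Rightarrow> real) (c::nat \<Rightarrow> real). (\<forall>i<n. ts i \<ge> 0) \<longrightarrow>
        (\<integral>\<omega>. cis (\<Sum>i<n. c i * W (ts i) \<omega>) \<partial>M)
          = complex_of_real (exp (- (\<Sum>i<n. \<Sum>j<n. c i * c j * fbm_cov H (ts i) (ts j)) / 2))"
    using fbm unfolding is_fbm_def by (elim conjE)
  from this[rule_format, of "card A" "\<lambda>i. t (h i)" "\<lambda>i. c (h i)", OF t'] show ?thesis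
    unfolding r .
qed

lemma fbm_incr_family:
  assumes fbm: "is_fbm M H W" and st: "\<And>i. 0 \<le> s i" "\<And>i. 0 \<le> t i"
  shows "gaussian_family M (\<lambda>i \<omega>. W (t i) \<omega> - W (s i) \<omega>) (\<lambda>i j. fbm_incr_cov H (s i) (t i) (s j) (t j))"
  unfolding gaussian_family_def
proof (intro conjI allI impI)
  have W: "prob_space M" "W r \<in> borel_measurable M" if "r \<ge> 0" for r
    using fbm that unfolding is_fbm_def by blast+
  show "prob_space M" using W(1)[of 0] by simp
  show "(\<lambda>\<omega>. W (t i) \<omega> - W (s i) \<omega>) \<in> borel_measurable M" for i
    using W(2)[OF st(1)] W(2)[OF st(2)] by measurable
  show "fbm_incr_cov H (s i) (t i) (s j) (t j) = fbm_incr_cov H (s j) (t j) (s i) (t i)" for i j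
    by (rule fbm_incr_cov_sym)
  fix A :: "'b set" and c :: "'b \<Rightarrow> real" assume A: "finite A"
  \<comment> \<open>The Boolean selects an end point of the increment, with weight
    \<open>c i\<close> at \<open>t i\<close> and \<open>- c i\<close> at \<open>s i\<close>.
    Coinciding times do no harm because the family is indexed.\<close>
  let ?A = "A \<times> (UNIV :: bool set)"
  let ?t = "\<lambda>(i, e). if e then t i else s i" and ?c = "\<lambda>(i, e). if e then c i else - c i"
  have S: "(\<Sum>x\<in>?A. g x) = (\<Sum>i\<in>A. g (i, True) + g (i, False))" for g :: "_ \<Rightarrow> real"
    by (simp add: sum.cartesian_product' UNIV_bool add.commute)
  have "(\<integral>\<omega>. cis (\<Sum>x\<in>?A. ?c x * W (?t x) \<omega>) \<partial>M)
     = complex_of_real (exp (- (\<Sum>x\<in>?A. \<Sum>y\<in>?A. ?c x * ?c y * fbm_cov H (?t x) (?t y)) / 2))"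
    using A st by (intro fbm_finite_char[OF fbm]) auto
  then show "(\<integral>\<omega>. cis (\<Sum>i\<in>A. c i * (W (t i) \<omega> - W (s i) \<omega>)) \<partial>M)
     = complex_of_real (exp (- (\<Sum>i\<in>A. \<Sum>j\<in>A. c i * c j * fbm_incr_cov H (s i) (t i) (s j) (t j)) / 2))"
    unfolding S fbm_incr_cov_eq by (simp add: algebra_simps sum.distrib[symmetric])
qed

lemma gaussian_familyD:
  assumes "gaussian_family M \<xi> \<Gamma>"
  shows "prob_space M" "\<xi> i \<in> borel_measurable M" "\<Gamma> i j = \<Gamma> j i"
    and "finite A \<Longrightarrow> (\<integral>\<omega>. cis (\<Sum>i\<in>A. c i * \<xi> i \<omega>) \<partial>M)
        = complex_of_real (exp (- (\<Sum>i\<in>A. \<Sum>j\<in>A. c i * c j * \<Gamma> i j) / 2))"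
proof -
  show "prob_space M" "\<xi> i \<in> borel_measurable M" "\<Gamma> i j = \<Gamma> j i"
    using assms unfolding gaussian_family_def by (blast, blast, blast)
  assume A: "finite A"
  have "\<forall>A c. finite A \<longrightarrow> (\<integral>\<omega>. cis (\<Sum>i\<in>A. c i * \<xi> i \<omega>) \<partial>M)
        = complex_of_real (exp (- (\<Sum>i\<in>A. \<Sum>j\<in>A. c i * c j * \<Gamma> i j) / 2))"
    using assms unfolding gaussian_family_def by (elim conjE)
  from this[rule_format, OF A] show "(\<integral>\<omega>. cis (\<Sum>i\<in>A. c i * \<xi> i \<omega>) \<partial>M)
        = complex_of_real (exp (- (\<Sum>i\<in>A. \<Sum>j\<in>A. c i * c j * \<Gamma> i j) / 2))" .
qed

text \<open>The pair index gives every combination \<open>k\<close> its own variables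
  \<open>\<xi> (k, m)\<close>, as needed when the intervals that enter depend on \<open>k\<close>. A
  combination of combinations is then one weighted sum over a product set.\<close>

lemma gaussian_family_lincomb:
  fixes \<xi> :: "'b \<times> 'c \<Rightarrow> 'a \<Rightarrow> real"
  assumes g: "gaussian_family M \<xi> \<Gamma>" and T: "finite T"
  shows "gaussian_family M (\<lambda>k \<omega>. \<Sum>m\<in>T. c k m * \<xi> (k, m) \<omega>)
     (\<lambda>k l. \<Sum>m\<in>T. \<Sum>n\<in>T. c k m * c l n * \<Gamma> (k, m) (l, n))"
  unfolding gaussian_family_def
proof (intro conjI allI impI)
  note [measurable] = gaussian_familyD(2)[OF g] and sym = gaussian_familyD(3)[OF g]
  show "prob_space M" by (rule gaussian_familyD(1)[OF g])
  show "(\<lambda>\<omega>. \<Sum>m\<in>T. c k m * \<xi> (k, m) \<omega>) \<in> borel_measurable M" for k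
    by measurable
  show "(\<Sum>m\<in>T. \<Sum>n\<in>T. c k m * c l n * \<Gamma> (k, m) (l, n)) = (\<Sum>m\<in>T. \<Sum>n\<in>T. c l m * c k n * \<Gamma> (l, m) (k, n))" for k l
    by (subst sum.swap, intro sum.cong refl, subst sym, simp)
  fix A :: "'b set" and d :: "'b \<Rightarrow> real" assume A: "finite A"
  let ?c = "\<lambda>(k, m). d k * c k m"
  have "(\<integral>\<omega>. cis (\<Sum>x\<in>A\<times>T. ?c x * \<xi> x \<omega>) \<partial>M)
     = complex_of_real (exp (- (\<Sum>x\<in>A\<times>T. \<Sum>y\<in>A\<times>T. ?c x * ?c y * \<Gamma> x y) / 2))"
    using A T by (intro gaussian_familyD(4)[OF g]) auto
  moreover have "(\<Sum>x\<in>A\<times>T. ?c x * \<xi> x \<omega>) = (\<Sum>k\<in>A. d k * (\<Sum>m\<in>T. c k m * \<xi> (k, m) \<omega>))" for \<omega>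
    by (simp add: sum.cartesian_product' sum_distrib_left mult.assoc)
  moreover have "(\<Sum>x\<in>A\<times>T. \<Sum>y\<in>A\<times>T. ?c x * ?c y * \<Gamma> x y)
      = (\<Sum>k\<in>A. \<Sum>l\<in>A. d k * d l * (\<Sum>m\<in>T. \<Sum>n\<in>T. c k m * c l n * \<Gamma> (k, m) (l, n)))"
  proof -
    have "(\<Sum>x\<in>A\<times>T. \<Sum>y\<in>A\<times>T. ?c x * ?c y * \<Gamma> x y)
        = (\<Sum>k\<in>A. \<Sum>m\<in>T. \<Sum>l\<in>A. \<Sum>n\<in>T. d k * c k m * (d l * c l n) * \<Gamma> (k, m) (l, n))"
      by (simp add: sum.cartesian_product')
    also have "\<dots> = (\<Sum>k\<in>A. \<Sum>l\<in>A. \<Sum>m\<in>T. \<Sum>n\<in>T. d k * c k m * (d l * c l n) * \<Gamma> (k, m) (l, n))"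
      by (intro sum.cong refl sum.swap)
    finally show ?thesis by (simp add: sum_distrib_left mult_ac)
  qed
  ultimately show "(\<integral>\<omega>. cis (\<Sum>k\<in>A. d k * (\<Sum>m\<in>T. c k m * \<xi> (k, m) \<omega>)) \<partial>M)
     = complex_of_real (exp (- (\<Sum>k\<in>A. \<Sum>l\<in>A. d k * d l * (\<Sum>m\<in>T. \<Sum>n\<in>T. c k m * c l n * \<Gamma> (k, m) (l, n))) / 2))"
    by simp
qed

text \<open>A characteristic function has modulus at most 1, so its exponent cannot be positive.
  Positivity of the covariance is thus obtained without computing second moments.\<close>

lemma gaussian_family_quad_nonneg:
  assumes g: "gaussian_family M \<xi> \<Gamma>" and A: "finite A"
  shows "0 \<le> (\<Sum>i\<in>A. \<Sum>j\<in>A. c i * c j * \<Gamma> i j)"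
proof -
  interpret prob_space M by (rule gaussian_familyD(1)[OF g])
  let ?q = "\<Sum>i\<in>A. \<Sum>j\<in>A. c i * c j * \<Gamma> i j"
  have "exp (- ?q / 2) = norm (\<integral>\<omega>. cis (\<Sum>i\<in>A. c i * \<xi> i \<omega>) \<partial>M)"
    unfolding gaussian_familyD(4)[OF g A] norm_of_real by simp
  also have "\<dots> \<le> (\<integral>\<omega>. norm (cis (\<Sum>i\<in>A. c i * \<xi> i \<omega>)) \<partial>M)"
    by (rule integral_norm_bound)
  also have "\<dots> = 1" by (simp add: prob_space)
  finally show ?thesis by simp
qed

lemma gaussian_family_pair:
  assumes g: "gaussian_family M \<xi> \<Gamma>"
  shows "(\<integral>\<omega>. cis (u * (x * \<xi> k \<omega> + y * \<xi> l \<omega>)) \<partial>M)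
      = complex_of_real (exp (- (u\<^sup>2 * (x\<^sup>2 * \<Gamma> k k + 2 * x * y * \<Gamma> k l + y\<^sup>2 * \<Gamma> l l)) / 2))"
    and "0 \<le> x\<^sup>2 * \<Gamma> k k + 2 * x * y * \<Gamma> k l + y\<^sup>2 * \<Gamma> l l"
proof -
  note sym = gaussian_familyD(3)[OF g, of l k]
  note F = gaussian_familyD(4)[OF g] and Q = gaussian_family_quad_nonneg[OF g]
  have "(\<integral>\<omega>. cis (u * (x * \<xi> k \<omega> + y * \<xi> l \<omega>)) \<partial>M)
      = complex_of_real (exp (- (u\<^sup>2 * (x\<^sup>2 * \<Gamma> k k + 2 * x * y * \<Gamma> k l + y\<^sup>2 * \<Gamma> l l)) / 2))
     \<and> 0 \<le> x\<^sup>2 * \<Gamma> k k + 2 * x * y * \<Gamma> k l + y\<^sup>2 * \<Gamma> l l"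
  \<comment> \<open>For \<open>k = l\<close> the set \<open>{k, l}\<close> has a single element, and
    the two weights have to be added up beforehand.\<close>
  proof (cases "k = l")
    case True
    then show ?thesis using F[of "{k}" "\<lambda>_. u * (x + y)"] Q[of "{k}" "\<lambda>_. x + y"]
      by (simp add: algebra_simps power2_eq_square)
  next
    case False
    then show ?thesis using F[of "{k, l}" "\<lambda>i. if i = k then u * x else u * y"]
        Q[of "{k, l}" "\<lambda>i. if i = k then x else y"]
      by (simp add: algebra_simps power2_eq_square sym)
  qed
  then show "(\<integral>\<omega>. cis (u * (x * \<xi> k \<omega> + y * \<xi> l \<omega>)) \<partial>M)
      = complex_of_real (exp (- (u\<^sup>2 * (x\<^sup>2 * \<Gamma> k k + 2 * x * y * \<Gamma> k l + y\<^sup>2 * \<Gamma> l l)) / 2))"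
    and "0 \<le> x\<^sup>2 * \<Gamma> k k + 2 * x * y * \<Gamma> k l + y\<^sup>2 * \<Gamma> l l" by auto
qed

lemma gaussian_family_single:
  assumes g: "gaussian_family M \<xi> \<Gamma>"
  shows "(\<integral>\<omega>. cis (u * \<xi> k \<omega>) \<partial>M) = complex_of_real (exp (- (u\<^sup>2 * \<Gamma> k k) / 2))"
    and "0 \<le> \<Gamma> k k"
  using gaussian_family_pair(1)[OF g, of u 1 k 0 k] gaussian_family_pair(2)[OF g, of 1 k 0 k] by auto

text \<open>Positivity of the quadratic form at the weights \<open>(1, 1)\<close> and
  \<open>(1, -1)\<close>.\<close>

lemma gaussian_family_cov_le:
  assumes g: "gaussian_family M \<xi> \<Gamma>"
  shows "\<bar>\<Gamma> k l\<bar> \<le> (\<Gamma> k k + \<Gamma> l l) / 2"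
  using gaussian_family_pair(2)[OF g, of 1 k 1 l] gaussian_family_pair(2)[OF g, of 1 k "-1" l] by (simp add: abs_le_iff)

section \<open>Covariances of b-adic increments\<close>

text \<open>Convexity of the power for \<open>a \<ge> 1\<close> and concavity for
  \<open>a \<le> 1\<close>, expressed through increments of fixed length. With
  \<open>a = 2*H\<close> these are the two sides of \<open>H = 1/2\<close>. The derivative is taken
  on the open interval only, since it may be infinite at 0.\<close>

lemma powr_diff_incr_mono:
  fixes a x y d :: real
  assumes a: "0 < a" and x: "0 \<le> x" "x \<le> y" and d: "0 \<le> d"
  shows "1 \<le> a \<Longrightarrow> (x + d) powr a - x powr a \<le> (y + d) powr a - y powr a"
    and "a \<le> 1 \<Longrightarrow> (y + d) powr a - y powr a \<le> (x + d) powr a - x powr a"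
proof -
  let ?f = "\<lambda>z. (z + d) powr a - z powr a" and ?f' = "\<lambda>z. a * ((z + d) powr (a - 1) - z powr (a - 1))"
  have D: "(?f has_real_derivative ?f' z) (at z)" if "x < z" for z
    using that x d by (auto intro!: derivative_eq_intros simp: algebra_simps)
  have C: "continuous_on {x..y} ?f"
    using x d a by (intro continuous_on_diff continuous_on_powr' continuous_intros) auto
  show "?f x \<le> ?f y" if "1 \<le> a"
  proof (rule DERIV_nonneg_imp_increasing_open[OF x(2) _ C])
    fix z assume z: "x < z" "z < y"
    have "z powr (a - 1) \<le> (z + d) powr (a - 1)"
      using z x d that by (intro powr_mono2) auto
    then show "\<exists>w. (?f has_real_derivative w) (at z) \<and> 0 \<le> w"
      using D[OF z(1)] a by (intro exI[of _ "?f' z"]) auto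
  qed
  show "?f y \<le> ?f x" if "a \<le> 1"
  proof (rule DERIV_nonpos_imp_decreasing_open[OF x(2) _ C])
    fix z assume z: "x < z" "z < y"
    have "(z + d) powr (a - 1) \<le> z powr (a - 1)"
      using z x d that by (intro powr_mono2') auto
    then have "?f' z \<le> 0" using a by (intro mult_nonneg_nonpos) auto
    then show "\<exists>w. (?f has_real_derivative w) (at z) \<and> w \<le> 0"
      using D[OF z(1)] by (intro exI[of _ "?f' z"]) auto
  qed
qed

text \<open>Nonnegativity is monotonicity of the power. For \<open>H \<le> 1/2\<close>
  subadditivity, which is concavity with base point 0, bounds the covariance by the variance of the
  inner increment.\<close>

lemma fbm_incr_cov_nested:
  assumes H: "0 < H" and o: "u \<le> s" "s \<le> t" "t \<le> v"
  shows "0 \<le> fbm_incr_cov H s t u v"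
    and "H \<le> 1/2 \<Longrightarrow> fbm_incr_cov H s t u v \<le> (t - s) powr (2*H)"
proof -
  have cov: "fbm_incr_cov H s t u v = ((t - u) powr (2*H) + (v - s) powr (2*H)
     - (v - t) powr (2*H) - (s - u) powr (2*H)) / 2"
    using o by (simp add: fbm_incr_cov_def abs_minus_commute[of s v] abs_minus_commute[of t v])
  have "(s - u) powr (2*H) \<le> (t - u) powr (2*H)" "(v - t) powr (2*H) \<le> (v - s) powr (2*H)"
    using assms by (auto intro!: powr_mono2)
  then show "0 \<le> fbm_incr_cov H s t u v"
    by (simp add: cov)
  assume h: "H \<le> 1/2"
  have "(t - u) powr (2*H) - (s - u) powr (2*H) \<le> (t - s) powr (2*H)"
    using powr_diff_incr_mono(2)[of "2*H" 0 "s - u" "t - s"] H h o by simp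
  moreover have "(v - s) powr (2*H) - (v - t) powr (2*H) \<le> (t - s) powr (2*H)"
    using powr_diff_incr_mono(2)[of "2*H" 0 "v - t" "t - s"] H h o by simp
  ultimately show "fbm_incr_cov H s t u v \<le> (t - s) powr (2*H)"
    by (simp add: cov)
qed

text \<open>The covariance is half the difference of two increments of the power \<open>2*H\<close>
  of equal length \<open>v - u\<close>, so its sign is decided by convexity or concavity.\<close>

lemma fbm_incr_cov_disjoint:
  assumes H: "0 < H" and o: "s \<le> t" "t \<le> u" "u \<le> v"
  shows "1/2 \<le> H \<Longrightarrow> 0 \<le> fbm_incr_cov H s t u v"
    and "H \<le> 1/2 \<Longrightarrow> fbm_incr_cov H s t u v \<le> 0"
  using powr_diff_incr_mono[of "2*H" "u - t" "u - s" "v - u"] H o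
  by (auto simp: fbm_incr_cov_def abs_minus_commute[of s] abs_minus_commute[of t])

text \<open>Telescoping: the increments over the partition add up to
  \<open>W 1 - W 0\<close>.\<close>

lemma sum_fbm_incr_cov:
  assumes "B > 0"
  shows "(\<Sum>a<B. fbm_incr_cov H u v (real a / real B) (real (a + 1) / real B)) = fbm_incr_cov H u v 0 1"
proof -
  let ?F = "\<lambda>a. (\<bar>u - real a / real B\<bar> powr (2*H) - \<bar>v - real a / real B\<bar> powr (2*H)) / 2"
  have "(\<Sum>a<B. fbm_incr_cov H u v (real a / real B) (real (a + 1) / real B)) = (\<Sum>a<B. ?F (Suc a) - ?F a)"
    by (intro sum.cong refl) (simp add: fbm_incr_cov_def field_simps)
  also have "\<dots> = ?F B - ?F 0" by (rule sum_lessThan_telescope)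
  finally show ?thesis using assms by (simp add: fbm_incr_cov_def field_simps)
qed

definition badic_cov :: "real \<Rightarrow> nat \<Rightarrow> nat \<Rightarrow> nat \<Rightarrow> nat \<Rightarrow> nat \<Rightarrow> real" where
  "badic_cov H b m a n c = fbm_incr_cov H (real a / real b ^ m) (real (a + 1) / real b ^ m)
     (real c / real b ^ n) (real (c + 1) / real b ^ n)"

lemma badic_cov_sym: "badic_cov H b m a n c = badic_cov H b n c m a"
  unfolding badic_cov_def by (rule fbm_incr_cov_sym)

text \<open>Two b-adic intervals are nested or do not overlap; \<open>c div q\<close> is the index
  of the coarse interval that contains the fine one with index \<open>c\<close>.\<close>

lemma badic_interval_cases:
  fixes b m n a c :: nat
  assumes b: "b \<ge> 2" and mn: "m \<le> n"
  defines "q \<equiv> b ^ (n - m)"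
  shows "c div q = a \<Longrightarrow> real a / real b ^ m \<le> real c / real b ^ n \<and> real (c + 1) / real b ^ n \<le> real (a + 1) / real b ^ m"
    and "a < c div q \<Longrightarrow> real (a + 1) / real b ^ m \<le> real c / real b ^ n"
    and "c div q < a \<Longrightarrow> real (c + 1) / real b ^ n \<le> real a / real b ^ m"
proof -
  have q: "q > 0" using b by (simp add: q_def)
  have e: "real x / real b ^ m = real (x * q) / real b ^ n" for x
  proof -
    have "b ^ n = b ^ m * q" using mn by (simp add: q_def flip: power_add)
    then have "real b ^ n = real b ^ m * real q" by (metis of_nat_mult of_nat_power)
    then show ?thesis using b q by simp
  qed
  have le: "real x / real b ^ m \<le> real y / real b ^ n \<longleftrightarrow> x * q \<le> y"
    "real y / real b ^ n \<le> real x / real b ^ m \<longleftrightarrow> y \<le> x * q" for x y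
    using b unfolding e by (simp_all add: divide_le_cancel del: of_nat_mult)
  have 1: "(c div q) * q \<le> c" "c < (c div q + 1) * q"
    using q by (auto simp: div_mult_mod_eq) (metis add.commute dividend_less_div_times mult_Suc_right mult.commute)
  show "c div q = a \<Longrightarrow> real a / real b ^ m \<le> real c / real b ^ n \<and> real (c + 1) / real b ^ n \<le> real (a + 1) / real b ^ m"
    using 1 unfolding le by auto
  show "a < c div q \<Longrightarrow> real (a + 1) / real b ^ m \<le> real c / real b ^ n"
    unfolding le using 1(1) mult_le_mono1[of "a + 1" "c div q" q] by linarith
  show "c div q < a \<Longrightarrow> real (c + 1) / real b ^ n \<le> real a / real b ^ m"
    unfolding le using 1(2) mult_le_mono1[of "c div q + 1" a q] by linarith
qed

lemma badic_incr_le: "b \<ge> (2::nat) \<Longrightarrow> real a / real b ^ m \<le> real (a + 1) / real b ^ m"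
  by (simp add: divide_right_mono)

text \<open>For \<open>H \<ge> 1/2\<close> no covariance is negative, so the absolute values drop
  and the double sum telescopes to the variance of \<open>W 1 - W 0\<close>, which is 1. For
  \<open>H \<le> 1/2\<close> and a fixed fine increment, only the coarse interval containing it
  contributes nonnegatively; as the signed sum is nonnegative, the absolute sum is at most twice
  that one term, which is bounded by the variance of the fine increment.\<close>

lemma sum_abs_badic_cov_le:
  assumes H: "0 < H" "H < 1" and b: "b \<ge> 2" and mn: "m \<le> n"
  shows "1/2 \<le> H \<Longrightarrow> (\<Sum>a<b^m. \<Sum>c<b^n. \<bar>badic_cov H b m a n c\<bar>) \<le> 1"
    and "H \<le> 1/2 \<Longrightarrow> (\<Sum>a<b^m. \<Sum>c<b^n. \<bar>badic_cov H b m a n c\<bar>) \<le> 2 * real b powr (real n * (1 - 2*H))"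
proof -
  let ?G = "\<lambda>a c. badic_cov H b m a n c"
  note le = badic_incr_le[OF b]
  have bp: "0 < b ^ m" "0 < b ^ n" using b by auto
  have nested: "0 \<le> ?G a c" "H \<le> 1/2 \<Longrightarrow> ?G a c \<le> (1 / real b ^ n) powr (2*H)" if "c div b^(n-m) = a" for a c
    using badic_interval_cases(1)[OF b mn that] fbm_incr_cov_nested[OF H(1) _ le[of c n]]
    unfolding badic_cov_def fbm_incr_cov_sym[of H "real a / real b ^ m"]
    by (auto simp: add_divide_distrib)
  have disj: "1/2 \<le> H \<Longrightarrow> 0 \<le> ?G a c" "H \<le> 1/2 \<Longrightarrow> ?G a c \<le> 0" if ne: "c div b^(n-m) \<noteq> a" for a c
  proof -
    have "(1/2 \<le> H \<longrightarrow> 0 \<le> ?G a c) \<and> (H \<le> 1/2 \<longrightarrow> ?G a c \<le> 0)"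
    proof (cases "a < c div b^(n-m)")
      case True
      show ?thesis using fbm_incr_cov_disjoint[OF H(1) le badic_interval_cases(2)[OF b mn True] le]
        by (auto simp: badic_cov_def)
    next
      case False
      then have "c div b^(n-m) < a" using ne by simp
      from fbm_incr_cov_disjoint[OF H(1) le badic_interval_cases(3)[OF b mn this] le]
      show ?thesis
        by (auto simp: badic_cov_def fbm_incr_cov_sym[of H "real a / real b ^ m"])
    qed
    then show "1/2 \<le> H \<Longrightarrow> 0 \<le> ?G a c" "H \<le> 1/2 \<Longrightarrow> ?G a c \<le> 0" by auto
  qed
  have tel: "(\<Sum>a<b^m. ?G a c) = fbm_incr_cov H (real c / real b ^ n) (real (c + 1) / real b ^ n) 0 1" for c
    using sum_fbm_incr_cov[OF bp(1), of H "real c / real b ^ n" "real (c + 1) / real b ^ n"]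
    unfolding badic_cov_def fbm_incr_cov_sym[of H "real c / real b ^ n"] by simp
  {
    assume h: "1/2 \<le> H"
    have "\<bar>?G a c\<bar> = ?G a c" for a c
      using nested(1)[of c a] disj(1)[OF _ h, of c a] by (cases "c div b^(n-m) = a") auto
    then have "(\<Sum>a<b^m. \<Sum>c<b^n. \<bar>?G a c\<bar>) = (\<Sum>c<b^n. \<Sum>a<b^m. ?G a c)"
      by (subst sum.swap) simp
    also have "\<dots> = (\<Sum>c<b^n. fbm_incr_cov H 0 1 (real c / real b ^ n) (real (c + 1) / real b ^ n))"
      unfolding tel by (intro sum.cong refl fbm_incr_cov_sym)
    also have "\<dots> = 1"
      using sum_fbm_incr_cov[OF bp(2), of H 0 1] by (simp add: fbm_incr_cov_def)
    finally show "(\<Sum>a<b^m. \<Sum>c<b^n. \<bar>?G a c\<bar>) \<le> 1" by simp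
  next
    assume h: "H \<le> 1/2"
    have "(\<Sum>a<b^m. \<bar>?G a c\<bar>) \<le> 2 * (1 / real b ^ n) powr (2*H)" if c: "c < b^n" for c
    proof -
      let ?a = "c div b^(n-m)"
      have "b ^ n = b^m * b^(n-m)" using mn by (simp flip: power_add)
      then have a: "?a < b^m" using c by (simp add: less_mult_imp_div_less)
      \<comment> \<open>Flipping the sign of every term and adding back twice the single nonnegative
        one.\<close>
      have "\<bar>?G a c\<bar> = (if a = ?a then 2 * ?G ?a c else 0) - ?G a c" for a
        using nested(1)[of c a] disj(2)[OF _ h, of c a] by auto
      then have "(\<Sum>a<b^m. \<bar>?G a c\<bar>) = 2 * ?G ?a c - (\<Sum>a<b^m. ?G a c)"
        using a by (simp add: sum_subtractf)
      also have "\<dots> \<le> 2 * (1 / real b ^ n) powr (2*H)"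
      proof -
        have "real (c + 1) / real b ^ n \<le> 1"
          using c bp(2) by (simp add: Suc_le_eq del: of_nat_power flip: of_nat_power)
        then have "0 \<le> fbm_incr_cov H (real c / real b ^ n) (real (c + 1) / real b ^ n) 0 1"
          by (intro fbm_incr_cov_nested[OF H(1) _ le]) auto
        then show ?thesis unfolding tel using nested(2)[of c ?a] h by simp
      qed
      finally show ?thesis .
    qed
    then have "(\<Sum>c<b^n. \<Sum>a<b^m. \<bar>?G a c\<bar>) \<le> (\<Sum>c<b^n. 2 * (1 / real b ^ n) powr (2*H))"
      by (intro sum_mono) auto
    also have "\<dots> = 2 * (real b ^ n * (1 / real b ^ n) powr (2*H))" by simp
    also have "real b ^ n * (1 / real b ^ n) powr (2*H) = real b powr (real n * (1 - 2*H))"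
      using b by (simp add: powr_divide powr_powr powr_diff right_diff_distrib flip: powr_realpow)
    finally show "(\<Sum>a<b^m. \<Sum>c<b^n. \<bar>?G a c\<bar>) \<le> 2 * real b powr (real n * (1 - 2*H))"
      by (subst sum.swap)
  }
qed

text \<open>The factor combines the normalisation \<open>b powr ((m + n) * H)\<close> to unit
  variances with division by the \<open>b ^ (m + n)\<close> pairs, so this bounds an average
  absolute correlation. The rate \<open>min H (1 - H)\<close> is positive for every \<open>H\<close>
  in (0,1), which is where geometric decay comes from.\<close>

lemma sum_abs_badic_cov_normalized_le:
  assumes H: "0 < H" "H < 1" and b: "b \<ge> 2"
  shows "real b powr (- real (m + n) * (1 - H)) * (\<Sum>a<b^m. \<Sum>c<b^n. \<bar>badic_cov H b m a n c\<bar>)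
      \<le> 2 * real b powr (- real (m + n) * min H (1 - H))"
proof (induction m n rule: linorder_wlog)
  case (le m n)
  have b1: "real b > 1" using b by simp
  show ?case
  proof (cases "1/2 \<le> H")
    case True
    then have "min H (1 - H) = 1 - H" by simp
    then show ?thesis
      using mult_left_mono[OF sum_abs_badic_cov_le(1)[OF H b le True], of "real b powr (- real (m + n) * (1 - H))"]
      by (smt (verit) powr_ge_zero)
  next
    case False
    have e: "real m * H \<le> real m * (1 - H)" using False by (intro mult_left_mono) auto
    have "real b powr (- real (m + n) * (1 - H)) * (\<Sum>a<b^m. \<Sum>c<b^n. \<bar>badic_cov H b m a n c\<bar>)
      \<le> real b powr (- real (m + n) * (1 - H)) * (2 * real b powr (real n * (1 - 2*H)))"
      using sum_abs_badic_cov_le(2)[OF H b le] False by (intro mult_left_mono) auto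
    also have "\<dots> = 2 * real b powr (- real (m + n) * (1 - H) + real n * (1 - 2*H))"
      by (simp add: powr_add)
    also have "\<dots> \<le> 2 * real b powr (- real (m + n) * H)"
      using b1 e by (intro mult_left_mono powr_mono) (auto simp: algebra_simps)
    finally show ?thesis using False by (simp add: min_def)
  qed
next
  case (sym m n)
  then show ?case
    by (subst (asm) sum.swap) (simp add: badic_cov_sym[of H b m] add.commute)
qed

section \<open>Decay of fractional noise correlations and averaged correlations between
  levels\<close>

lemma second_difference_powr:
  fixes y h a :: real
  assumes h: "0 < h" "h < y"
  shows "\<exists>z\<in>{y-h<..<y+h}. \<bar>(y + h) powr a + (y - h) powr a - 2 * y powr a\<bar> \<le> 2 * h\<^sup>2 * \<bar>a * (a - 1)\<bar> * z powr (a - 2)"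
proof -
  \<comment> \<open>The mean value theorem for \<open>(y + w) powr a + (y - w) powr a\<close> as a
    function of \<open>w\<close>, and then for the power \<open>a - 1\<close> between
    \<open>y - w\<close> and \<open>y + w\<close>.\<close>
  have "\<exists>w>0. w < h \<and> ((y + h) powr a + (y - h) powr a) - ((y + 0) powr a + (y - 0) powr a)
      = (h - 0) * (a * (y + w) powr (a - 1) - a * (y - w) powr (a - 1))"
    using h by (intro MVT2) (auto intro!: derivative_eq_intros)
  then obtain w where w: "0 < w" "w < h" and
    1: "(y + h) powr a + (y - h) powr a - 2 * y powr a = h * a * ((y + w) powr (a - 1) - (y - w) powr (a - 1))"
    by (auto simp: algebra_simps)
  have "\<exists>z>y-w. z < y + w \<and> (y + w) powr (a - 1) - (y - w) powr (a - 1)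
      = ((y + w) - (y - w)) * ((a - 1) * z powr (a - 1 - 1))"
    using h w by (intro MVT2) (auto intro!: derivative_eq_intros)
  then obtain z where z: "y - w < z" "z < y + w" and
    2: "(y + w) powr (a - 1) - (y - w) powr (a - 1) = (2 * w) * ((a - 1) * z powr (a - 2))"
    by (auto simp: algebra_simps)
  have "\<bar>(y + h) powr a + (y - h) powr a - 2 * y powr a\<bar> = (2 * h * w) * (\<bar>a * (a - 1)\<bar> * z powr (a - 2))"
    unfolding 1 2 using h w by (simp add: abs_mult)
  also have "\<dots> \<le> (2 * h * h) * (\<bar>a * (a - 1)\<bar> * z powr (a - 2))"
    using h w by (intro mult_right_mono mult_left_mono) auto
  finally show ?thesis
    using z w by (intro bexI[of _ z]) (auto simp: power2_eq_square mult_ac)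
qed

text \<open>Autocovariance at integer lag \<open>x\<close> of fractional Gaussian noise, the
  sequence of unit-step increments.\<close>

definition fgn_cov :: "real \<Rightarrow> int \<Rightarrow> real" where
  "fgn_cov H x = (\<bar>real_of_int x + 1\<bar> powr (2*H) + \<bar>real_of_int x - 1\<bar> powr (2*H)
     - 2 * \<bar>real_of_int x\<bar> powr (2*H)) / 2"

lemma fgn_cov_minus: "fgn_cov H (- x) = fgn_cov H x"
proof -
  have "\<bar>- real_of_int x + 1\<bar> = \<bar>real_of_int x - 1\<bar>" "\<bar>- real_of_int x - 1\<bar> = \<bar>real_of_int x + 1\<bar>"
    by linarith+
  then show ?thesis unfolding fgn_cov_def by simp
qed

text \<open>A second difference of order \<open>x powr (2*H - 2)\<close>, whose exponent is negative
  because \<open>H < 1\<close>. For \<open>H > 1/2\<close> these values need not be summable; only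
  their vanishing is used.\<close>

lemma fgn_cov_vanishes:
  assumes H: "0 < H" "H < 1" and e: "e > 0"
  shows "\<exists>D. \<forall>x. D < \<bar>x\<bar> \<longrightarrow> \<bar>fgn_cov H x\<bar> \<le> e"
proof -
  define C where "C = \<bar>2*H * (2*H - 1)\<bar>"
  have "((\<lambda>x::real. x powr (2*H - 2)) \<longlongrightarrow> 0) at_top"
    using H by (intro tendsto_neg_powr filterlim_ident) auto
  then have "((\<lambda>x::real. C * x powr (2*H - 2)) \<longlongrightarrow> C * 0) at_top"
    by (intro tendsto_intros)
  then have "eventually (\<lambda>x::real. C * x powr (2*H - 2) < e) at_top"
    using e by (intro order_tendstoD) auto
  then obtain R where R: "\<And>x. x \<ge> R \<Longrightarrow> C * x powr (2*H - 2) < e"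
    by (auto simp: eventually_at_top_linorder)
  define D where "D = max 2 (\<lceil>R\<rceil> + 1)"
  have pos: "\<bar>fgn_cov H x\<bar> \<le> e" if x: "D < x" for x
  proof -
    have x1: "real_of_int x > 1" "real_of_int x - 1 \<ge> R" using x unfolding D_def by linarith+
    obtain z where z: "z > real_of_int x - 1" and
      *: "\<bar>(real_of_int x + 1) powr (2*H) + (real_of_int x - 1) powr (2*H) - 2 * real_of_int x powr (2*H)\<bar>
       \<le> 2 * 1\<^sup>2 * \<bar>2*H * (2*H - 1)\<bar> * z powr (2*H - 2)"
      using second_difference_powr[of 1 "real_of_int x" "2*H"] x1 by auto
    have "\<bar>fgn_cov H x\<bar> \<le> C * z powr (2*H - 2)"
      using * x1 unfolding fgn_cov_def C_def by auto
    also have "\<dots> < e" using z x1 by (intro R) auto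
    finally show ?thesis by simp
  qed
  have "\<bar>fgn_cov H x\<bar> \<le> e" if x: "D < \<bar>x\<bar>" for x
    using pos[of x] pos[of "- x"] that by (cases "x \<ge> 0") (auto simp: fgn_cov_minus)
  then show ?thesis by blast
qed

text \<open>An injective enumeration meets each of the finitely many small lags at most once, so
  these contribute a bounded amount, and every other term is at most \<open>e\<close>. The constant
  \<open>D\<close> serves all \<open>n\<close> and all enumerations.\<close>

lemma sum_fgn_cov_inj:
  assumes H: "0 < H" "H < 1" and e: "e > 0"
  shows "\<exists>D. \<forall>n (\<iota> :: nat \<Rightarrow> int). inj_on \<iota> {..<n} \<longrightarrow> (\<Sum>a<n. \<bar>fgn_cov H (\<iota> a)\<bar>) \<le> real n * e + D"
proof -
  obtain D where D: "\<And>x. D < \<bar>x\<bar> \<Longrightarrow> \<bar>fgn_cov H x\<bar> \<le> e" using fgn_cov_vanishes[OF assms] by blast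
  let ?D = "\<Sum>x\<in>{-D..D}. \<bar>fgn_cov H x\<bar>"
  have "(\<Sum>a<n. \<bar>fgn_cov H (\<iota> a)\<bar>) \<le> real n * e + ?D" if inj: "inj_on \<iota> {..<n}" for n and \<iota> :: "nat \<Rightarrow> int"
  proof -
    let ?S = "{a\<in>{..<n}. \<bar>\<iota> a\<bar> \<le> D}"
    have "(\<Sum>a<n. \<bar>fgn_cov H (\<iota> a)\<bar>) \<le> (\<Sum>a<n. e + (if \<bar>\<iota> a\<bar> \<le> D then \<bar>fgn_cov H (\<iota> a)\<bar> else 0))"
      using e D by (intro sum_mono) (auto simp: not_le)
    also have "\<dots> = real n * e + (\<Sum>a\<in>?S. \<bar>fgn_cov H (\<iota> a)\<bar>)"
      by (subst sum.inter_filter) (auto simp: sum.distrib)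
    also have "(\<Sum>a\<in>?S. \<bar>fgn_cov H (\<iota> a)\<bar>) = (\<Sum>x\<in>\<iota> ` ?S. \<bar>fgn_cov H x\<bar>)"
      using inj by (subst sum.reindex) (auto simp: inj_on_def)
    also have "\<dots> \<le> ?D" by (intro sum_mono2) auto
    finally show ?thesis by simp
  qed
  then show ?thesis by blast
qed

lemma sum_lessThan_mult:
  fixes F :: "nat \<Rightarrow> 'a::comm_monoid_add"
  shows "(\<Sum>k<n * B. F k) = (\<Sum>c<n. \<Sum>a<B. F (c * B + a))"
proof -
  have "sum F {c * B..<c * B + B} = (\<Sum>a<B. F (c * B + a))" for c
    using sum.shift_bounds_nat_ivl[of F 0 "c * B" B] by (simp add: add.commute lessThan_atLeast0)
  then show ?thesis by (simp add: sum.nat_group[symmetric])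
qed

lemma fbm_incr_cov_scale:
  assumes "c \<ge> 0"
  shows "fbm_incr_cov H (c * s) (c * t) (c * u) (c * v) = c powr (2*H) * fbm_incr_cov H s t u v"
proof -
  have "\<bar>c * x - c * y\<bar> powr (2*H) = c powr (2*H) * \<bar>x - y\<bar> powr (2*H)" for x y
    using assms by (simp add: abs_mult powr_mult flip: right_diff_distrib)
  note * = this
  show ?thesis unfolding fbm_incr_cov_def * by (simp add: field_simps)
qed

text \<open>Self-similarity rescales the fine interval to unit length; the coarse one then consists
  of \<open>b^d\<close> unit steps starting at \<open>b^d * a\<close>.\<close>

lemma badic_cov_eq_sum_fgn_cov:
  assumes b: "b \<ge> 2"
  shows "badic_cov H b (m + d) k m a
    = (1 / real b ^ (m + d)) powr (2*H) * (\<Sum>e<b^d. fgn_cov H (int k - int (b^d * a) - int e))"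
proof -
  let ?c = "1 / real b ^ (m + d)"
  have "badic_cov H b (m + d) k m a = fbm_incr_cov H (?c * real k) (?c * real (k + 1)) (?c * real (b^d * a)) (?c * real (b^d * a + b^d))"
  proof -
    have "?c * real (b^d * a) = real a / real b ^ m" "?c * real (b^d * a + b^d) = real (a + 1) / real b ^ m"
      using b by (simp_all add: power_add field_simps)
    then show ?thesis by (simp add: badic_cov_def)
  qed
  also have "\<dots> = ?c powr (2*H) * fbm_incr_cov H (real k) (real (k + 1)) (real (b^d * a)) (real (b^d * a + b^d))"
    by (rule fbm_incr_cov_scale) auto
  also have "fbm_incr_cov H (real k) (real (k + 1)) (real x) (real (x + B))
      = (\<Sum>e<B. fgn_cov H (int k - int x - int e))" for x B
  proof (induction B)
    case 0 show ?case by (simp add: fbm_incr_cov_def)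
  next
    case (Suc B)
    define y where "y = real k - real (x + B)"
    have e: "real (k + 1) - real (x + Suc B) = y" "real_of_int (int k - int x - int B) = y"
      "real (k + 1) - real (x + B) = y + 1" "real k - real (x + Suc B) = y - 1"
      "real k - real (x + B) = y" by (simp_all add: y_def)
    have "fbm_incr_cov H (real k) (real (k + 1)) (real x) (real (x + Suc B))
      = fbm_incr_cov H (real k) (real (k + 1)) (real x) (real (x + B)) + fgn_cov H (int k - int x - int B)"
      unfolding fbm_incr_cov_def fgn_cov_def e by (simp add: field_simps)
    with Suc show ?case by simp
  qed
  finally show ?thesis .
qed

text \<open>Intervals \<open>k\<close> at level \<open>m + d\<close> and \<open>k mod b^m\<close> at
  level \<open>m\<close> are usually far apart. With \<open>k = c * b^m + a\<close> and a fixed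
  offset \<open>e\<close>, the lag is an injective function of \<open>a\<close>, so each small lag
  occurs boundedly often and the average tends to zero.\<close>

lemma offdiagonal_cov_vanishes:
  assumes H: "0 < H" "H < 1" and b: "b \<ge> 2" and d: "d \<ge> 1"
  shows "(\<lambda>m. (\<Sum>k<b^(m+d). real b powr (real (m + d + m) * H) * \<bar>badic_cov H b (m + d) k m (k mod b^m)\<bar>) / real b ^ (m + d))
     \<longlonglongrightarrow> 0" (is "?f \<longlonglongrightarrow> 0")
proof (rule LIMSEQ_I)
  fix r :: real assume r: "r > 0"
  \<comment> \<open>There are \<open>b ^ d\<close> blocks and \<open>b ^ d\<close> offsets against a
    denominator \<open>b ^ (m + d)\<close>; the surplus factor \<open>b ^ d\<close> is absorbed here
    and leaves \<open>r / 2\<close>.\<close>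
  define e where "e = r / (2 * real b ^ d)"
  have e: "e > 0" using r b by (simp add: e_def)
  obtain D where D: "\<And>n (\<iota> :: nat \<Rightarrow> int). inj_on \<iota> {..<n} \<Longrightarrow> (\<Sum>a<n. \<bar>fgn_cov H (\<iota> a)\<bar>) \<le> real n * e + D"
    using sum_fgn_cov_inj[OF H e] by blast
  have b1: "real b > 1" using b by simp
  have bound: "?f m \<le> r / 2 + real b ^ d * D / real b ^ m" for m
  proof -
    let ?g = "\<lambda>k e. \<bar>fgn_cov H (int k - int (b^d * (k mod b^m)) - int e)\<bar>"
    have "real b powr (real (m + d + m) * H) * \<bar>badic_cov H b (m + d) k m (k mod b^m)\<bar>
        \<le> (\<Sum>e<b^d. ?g k e)" for k
    proof -
      have "real b powr (real (m + d + m) * H) * (1 / real b ^ (m + d)) powr (2*H)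
        = real b powr (- (real d * H))"
        using b1 by (simp add: powr_divide powr_powr flip: powr_realpow powr_diff) (simp add: algebra_simps)
      also have "\<dots> \<le> real b powr 0" using b1 H by (intro powr_mono) auto
      finally have "real b powr (real (m + d + m) * H) * (1 / real b ^ (m + d)) powr (2*H) \<le> 1" using b1 by simp
      then have "real b powr (real (m + d + m) * H) * (1 / real b ^ (m + d)) powr (2*H) * 
          \<bar>\<Sum>e<b^d. fgn_cov H (int k - int (b^d * (k mod b^m)) - int e)\<bar>
          \<le> 1 * \<bar>\<Sum>e<b^d. fgn_cov H (int k - int (b^d * (k mod b^m)) - int e)\<bar>"
        by (intro mult_right_mono) auto
      also have "\<dots> \<le> (\<Sum>e<b^d. ?g k e)" by (simp add: sum_abs)
      finally show ?thesis unfolding badic_cov_eq_sum_fgn_cov[OF b] by (simp add: abs_mult mult_ac)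
    qed
    then have 1: "?f m \<le> (\<Sum>k<b^(m+d). \<Sum>e<b^d. ?g k e) / real b ^ (m + d)"
      by (intro divide_right_mono sum_mono) auto
    have "(\<Sum>k<b^(m+d). \<Sum>e<b^d. ?g k e) = (\<Sum>c<b^d. \<Sum>a<b^m. \<Sum>e<b^d. ?g (c * b^m + a) e)"
      unfolding power_add mult.commute[of "b^m"] by (rule sum_lessThan_mult)
    also have "\<dots> = (\<Sum>c<b^d. \<Sum>e<b^d. \<Sum>a<b^m. ?g (c * b^m + a) e)"
      by (intro sum.cong refl sum.swap)
    also have "\<dots> \<le> (\<Sum>c<b^d. \<Sum>e'<b^d. real (b^m) * e + D)"
    proof (intro sum_mono)
      fix c e'
      \<comment> \<open>The lag is affine in \<open>a\<close> with slope \<open>1 - b ^ d\<close>,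
        which is nonzero because \<open>d \<ge> 1\<close>.\<close>
      have bd: "int (b^d) \<noteq> 1" using self_le_power[of b d] b d by linarith
      let ?\<iota> = "\<lambda>a. int (c * b^m + a) - int (b^d * a) - int e'"
      have "(\<Sum>a<b^m. ?g (c * b^m + a) e') = (\<Sum>a<b^m. \<bar>fgn_cov H (?\<iota> a)\<bar>)"
        by (intro sum.cong refl) simp
      also have "\<dots> \<le> real (b^m) * e + D"
      proof (rule D)
        show "inj_on ?\<iota> {..<b^m}"
        proof (rule inj_onI)
          fix x y assume "?\<iota> x = ?\<iota> y"
          then have "(int (b^d) - 1) * (int x - int y) = 0" by (simp add: algebra_simps)
          then show "x = y" using bd by simp
        qed
      qed
      finally show "(\<Sum>a<b^m. ?g (c * b^m + a) e') \<le> real (b^m) * e + D" .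
    qed
    finally have "(\<Sum>k<b^(m+d). \<Sum>e<b^d. ?g k e) / real b ^ (m + d) \<le> (\<Sum>c<b^d. \<Sum>e'<b^d. real (b^m) * e + D) / real b ^ (m + d)"
      by (intro divide_right_mono) auto
    also have "\<dots> = real b ^ d * (real b ^ m * e + D) / real b ^ m"
      using b by (simp add: power_add field_simps)
    also have "\<dots> = r / 2 + real b ^ d * D / real b ^ m"
      using b by (simp add: e_def field_simps)
    finally show ?thesis using 1 by simp
  qed
  have "(\<lambda>m. real b ^ d * D / real b ^ m) \<longlonglongrightarrow> 0"
    using b1 by (intro LIMSEQ_divide_realpow_zero)
  then have "eventually (\<lambda>m. real b ^ d * D / real b ^ m < r / 2) sequentially"
    using r by (intro order_tendstoD) auto
  then obtain m0 where m0: "\<And>m. m \<ge> m0 \<Longrightarrow> real b ^ d * D / real b ^ m < r / 2"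
    by (auto simp: eventually_sequentially)
  have "?f m < r" if "m \<ge> m0" for m using bound[of m] m0[OF that] by linarith
  moreover have "0 \<le> ?f m" for m by (intro divide_nonneg_nonneg sum_nonneg) auto
  ultimately have "norm (?f m - 0) < r" if "m \<ge> m0" for m
    using that by (simp only: real_norm_def diff_0_right abs_of_nonneg)
  then show "\<exists>no. \<forall>m\<ge>no. norm (?f m - 0) < r" by blast
qed

section \<open>Absolute moments of empirical measures\<close>

text \<open>Comparison with a single term of order \<open>n \<ge> p\<close> of the exponential
  series. One bound on averages of \<open>cosh\<close> therefore controls all exponents.\<close>

lemma cosh_ge_abs_powr:
  fixes p :: real
  assumes "p > 0"
  shows "\<exists>C>0. \<forall>x::real. \<bar>x\<bar> powr p \<le> C * cosh x"
proof -
  define n where "n = nat \<lceil>p\<rceil>"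
  have n: "p \<le> real n" unfolding n_def by linarith
  have "\<bar>x\<bar> powr p \<le> (2 * (1 + fact n)) * cosh x" for x :: real
  proof -
    have c: "exp \<bar>x\<bar> \<le> 2 * cosh x" by (cases "x \<ge> 0") (auto simp: cosh_def field_simps)
    have "\<bar>x\<bar> powr p \<le> 1 + \<bar>x\<bar> ^ n"
    proof (cases "\<bar>x\<bar> \<le> 1")
      case True
      then have "\<bar>x\<bar> powr p \<le> 1" using assms by (intro powr_le1) auto
      then show ?thesis by (smt (verit) zero_le_power abs_ge_zero)
    next
      case False
      then have "\<bar>x\<bar> powr p \<le> \<bar>x\<bar> powr real n" using n by (intro powr_mono) auto
      then show ?thesis using False by (simp add: powr_realpow)
    qed
    also have "\<bar>x\<bar> ^ n \<le> fact n * exp \<bar>x\<bar>"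
    proof -
      have "\<bar>x\<bar> ^ n / fact n \<le> (\<Sum>k. \<bar>x\<bar> ^ k /\<^sub>R fact k)"
        using sum_le_suminf[OF summable_exp_generic[of "\<bar>x\<bar>"], of "{n}"] by (simp add: divide_inverse mult_ac)
      then show ?thesis by (simp add: exp_def field_simps)
    qed
    also have "1 + fact n * exp \<bar>x\<bar> \<le> (1 + fact n) * exp \<bar>x\<bar>" by (simp add: distrib_right)
    also have "\<dots> \<le> (1 + fact n) * (2 * cosh x)" using c by (intro mult_left_mono) auto
    finally show ?thesis by (simp add: mult_ac)
  qed
  moreover have "2 * (1 + fact n) > (0::real)" by (simp add: add_pos_nonneg)
  ultimately show ?thesis by blast
qed

text \<open>Averages along one fixed path become integrals against a probability measure, so that
  Levy's continuity theorem applies path by path.\<close>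

definition empirical :: "(nat \<Rightarrow> real) \<Rightarrow> nat \<Rightarrow> real measure" where
  "empirical x L = distr (uniform_count_measure {..<L}) borel x"

lemma integral_empirical:
  fixes f :: "real \<Rightarrow> 'b::{banach, second_countable_topology}"
  assumes "L > 0" and [measurable]: "f \<in> borel_measurable borel"
  shows "integral\<^sup>L (empirical x L) f = (\<Sum>k<L. f (x k)) /\<^sub>R real L"
proof -
  have [measurable]: "x \<in> borel_measurable (uniform_count_measure {..<L})"
    by (auto simp: measurable_def uniform_count_measure_def space_point_measure sets_point_measure)
  have "integral\<^sup>L (empirical x L) f = integral\<^sup>L (uniform_count_measure {..<L}) (\<lambda>k. f (x k))"
    unfolding empirical_def by (rule integral_distr) measurable
  also have "\<dots> = (\<Sum>k<L. f (x k)) /\<^sub>R real L"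
    unfolding uniform_count_measure_def
    by (subst lebesgue_integral_point_measure_finite) (auto simp: scaleR_sum_right divide_inverse)
  finally show ?thesis .
qed

lemma real_distribution_empirical:
  assumes "L > 0"
  shows "real_distribution (empirical x L)"
proof -
  interpret prob_space "uniform_count_measure {..<L}"
    using assms by (intro prob_space_uniform_count_measure) auto
  show ?thesis unfolding empirical_def
    by (rule real_distribution_distr) (auto simp: measurable_def uniform_count_measure_def space_point_measure sets_point_measure)
qed

text \<open>Levy's continuity theorem gives weak convergence of the empirical measures; the bound on the
  averages of cosh makes every power uniformly integrable.\<close>
lemma empirical_abs_moment:
  fixes x :: "nat \<Rightarrow> nat \<Rightarrow> real" and L :: "nat \<Rightarrow> nat"
  assumes L: "\<And>n. L n > 0" and p: "p > 0" and s: "s \<ge> 0"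
    and ch: "\<And>u. (\<lambda>n. (\<Sum>k<L n. cis (u * x n k)) /\<^sub>R real (L n)) \<longlonglongrightarrow> complex_of_real (exp (- (u\<^sup>2 * s\<^sup>2) / 2))"
    and co: "\<And>n. (\<Sum>k<L n. cosh (x n k)) / real (L n) \<le> K"
  shows "(\<lambda>n. (\<Sum>k<L n. \<bar>x n k\<bar> powr p) / real (L n))
     \<longlonglongrightarrow> s powr p * (2 powr (p/2) * Gamma ((p + 1) / 2) / sqrt pi)"
proof -
  interpret N: real_distribution std_normal_distribution by (rule real_dist_normal_dist)
  let ?N = "distr std_normal_distribution borel (\<lambda>x. s * x)"
  interpret S: real_distribution ?N by (rule N.real_distribution_distr) simp
  have char_N: "char ?N u = complex_of_real (exp (- (u\<^sup>2 * s\<^sup>2) / 2))" for u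
  proof -
    have "char ?N u = char std_normal_distribution (u * s)"
      unfolding char_def by (subst integral_distr) (auto simp: mult.assoc)
    then show ?thesis by (simp add: char_std_normal_distribution power_mult_distrib)
  qed
  have w: "weak_conv_m (\<lambda>n. empirical (x n) (L n)) ?N"
  proof (rule levy_continuity)
    show "real_distribution (empirical (x n) (L n))" for n by (rule real_distribution_empirical[OF L])
    show "real_distribution ?N" by (rule S.real_distribution_axioms)
    fix u
    have "char (empirical (x n) (L n)) u = (\<Sum>k<L n. cis (u * x n k)) /\<^sub>R real (L n)" for n
      unfolding char_def by (subst integral_empirical[OF L]) (auto simp: cis_conv_exp)
    then show "(\<lambda>n. char (empirical (x n) (L n)) u) \<longlonglongrightarrow> char ?N u"
      unfolding char_N using ch[of u] by simp
  qed
  let ?I = "s powr p * (2 powr (p/2) * Gamma ((p + 1) / 2) / sqrt pi)"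
  have moment: "has_bochner_integral ?N (\<lambda>x. \<bar>x\<bar> powr p) ?I"
  proof -
    have "has_bochner_integral lborel (\<lambda>x. s powr p * (std_normal_density x * \<bar>x\<bar> powr p)) ?I"
      by (intro has_bochner_integral_mult_right std_normal_abs_powr p)
    then have "has_bochner_integral std_normal_distribution (\<lambda>x. \<bar>s * x\<bar> powr p) ?I"
      using s by (subst has_bochner_integral_density) (auto simp: abs_mult powr_mult mult_ac)
    then show ?thesis by (subst has_bochner_integral_distr) auto
  qed
  \<comment> \<open>The exponent is doubled because where \<open>\<bar>x\<bar> powr p\<close>
    exceeds \<open>A\<close>, the excess is at most
    \<open>\<bar>x\<bar> powr (2*p) / A\<close>.\<close>
  obtain C where C: "C > 0" "\<And>x::real. \<bar>x\<bar> powr (2*p) \<le> C * cosh x"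
    using cosh_ge_abs_powr[of "2*p"] p by auto
  have tail: "\<bar>x\<bar> powr p - min (\<bar>x\<bar> powr p) A \<le> C * cosh x / A" if A: "A > 0" for x A :: real
  proof (cases "\<bar>x\<bar> powr p \<le> A")
    case True then show ?thesis using C(1) A by (simp add: min_def cosh_real_pos less_imp_le)
  next
    case False
    have "A * \<bar>x\<bar> powr p \<le> \<bar>x\<bar> powr p * \<bar>x\<bar> powr p" using False by (intro mult_right_mono) auto
    also have "\<dots> = \<bar>x\<bar> powr (2*p)" by (simp flip: powr_add)
    also note C(2)[of x]
    finally have "A * \<bar>x\<bar> powr p \<le> A * A + C * cosh x" using A by (simp add: add_increasing)
    then show ?thesis using False A by (simp add: min_def field_simps)
  qed
  let ?m = "\<lambda>A x. min (\<bar>x\<bar> powr p) A :: real"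
  have m1: "(\<lambda>n. (\<Sum>k<L n. ?m A (x n k)) / real (L n)) \<longlonglongrightarrow> integral\<^sup>L ?N (?m A)" if A: "A > 0" for A
  proof -
    have "continuous_on UNIV (?m A)"
      using p by (intro continuous_on_min continuous_on_powr' continuous_intros) auto
    then have c: "isCont (?m A) y" for y
      by (simp add: continuous_on_eq_continuous_at)
    have "(\<lambda>n. integral\<^sup>L (empirical (x n) (L n)) (?m A)) \<longlonglongrightarrow> integral\<^sup>L ?N (?m A)"
      by (rule weak_conv_imp_integral_bdd_continuous_conv[OF _ _ w, where B = A])
         (use A c in \<open>auto intro: real_distribution_empirical[OF L] S.real_distribution_axioms\<close>)
    then show ?thesis by (subst (asm) integral_empirical[OF L]) (auto simp: divide_inverse_commute)
  qed
  have m2: "(\<lambda>A::nat. integral\<^sup>L ?N (?m (real A))) \<longlonglongrightarrow> ?I"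
  proof -
    have "(\<lambda>A::nat. integral\<^sup>L ?N (?m (real A))) \<longlonglongrightarrow> integral\<^sup>L ?N (\<lambda>x. \<bar>x\<bar> powr p)"
    proof (rule integral_dominated_convergence[where w = "\<lambda>x. \<bar>x\<bar> powr p"])
      show "integrable ?N (\<lambda>x. \<bar>x\<bar> powr p)" using moment by (simp add: has_bochner_integral_iff)
      have "(\<lambda>A::nat. ?m (real A) x) \<longlonglongrightarrow> \<bar>x\<bar> powr p" for x
      proof (rule tendsto_eventually)
        show "eventually (\<lambda>A::nat. ?m (real A) x = \<bar>x\<bar> powr p) sequentially"
          using eventually_ge_at_top[of "nat \<lceil>\<bar>x\<bar> powr p\<rceil>"]
          by eventually_elim (auto simp: nat_le_iff ceiling_le_iff)
      qed
      then show "AE x in ?N. (\<lambda>A::nat. ?m (real A) x) \<longlonglongrightarrow> \<bar>x\<bar> powr p" by simp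
    qed auto
    then show ?thesis using moment by (simp add: has_bochner_integral_iff)
  qed
  show ?thesis
  proof (rule LIMSEQ_I)
    fix e :: real assume e: "e > 0"
    have "(\<lambda>A::nat. C * K / real A) \<longlonglongrightarrow> 0" by (rule lim_const_over_n)
    then have "eventually (\<lambda>A::nat. C * K / real A < e / 3) sequentially"
      using e by (intro order_tendstoD) auto
    moreover have "eventually (\<lambda>A::nat. \<bar>integral\<^sup>L ?N (?m (real A)) - ?I\<bar> < e / 3) sequentially"
      using tendstoD[OF m2, of "e/3"] e by (simp add: dist_real_def)
    ultimately have "eventually (\<lambda>A::nat. C * K / real A < e / 3 \<and> \<bar>integral\<^sup>L ?N (?m (real A)) - ?I\<bar> < e / 3 \<and> A > 0) sequentially"
      using eventually_gt_at_top[of 0] by eventually_elim auto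
    \<comment> \<open>The truncation level is fixed before \<open>n\<close>, with an error uniform
      in \<open>n\<close>; weak convergence is then applied to one bounded continuous
      function.\<close>
    then obtain A :: nat where A: "C * K / real A < e / 3" "\<bar>integral\<^sup>L ?N (?m (real A)) - ?I\<bar> < e / 3" "A > 0"
      by (auto dest: eventually_happens)
    have ev: "eventually (\<lambda>n. \<bar>(\<Sum>k<L n. ?m (real A) (x n k)) / real (L n) - integral\<^sup>L ?N (?m (real A))\<bar> < e / 3) sequentially"
      using tendstoD[OF m1, of "real A" "e/3"] e A by (simp add: dist_real_def)
    have near: "\<bar>(\<Sum>k<L n. \<bar>x n k\<bar> powr p) / real (L n) - (\<Sum>k<L n. ?m (real A) (x n k)) / real (L n)\<bar> < e / 3" for n
    proof -
      let ?d = "(\<Sum>k<L n. \<bar>x n k\<bar> powr p - ?m (real A) (x n k))"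
      have "?d \<le> (\<Sum>k<L n. C * cosh (x n k) / real A)"
        using A by (intro sum_mono tail) auto
      then have "?d / real (L n) \<le> (\<Sum>k<L n. C * cosh (x n k) / real A) / real (L n)"
        by (rule divide_right_mono) auto
      also have "\<dots> = C / real A * ((\<Sum>k<L n. cosh (x n k)) / real (L n))"
        by (simp add: sum_distrib_left sum_divide_distrib mult_ac)
      also have "\<dots> \<le> C / real A * K" using co[of n] C(1) by (intro mult_left_mono) auto
      also have "\<dots> < e / 3" using A by simp
      finally have "?d / real (L n) < e / 3" .
      moreover have "0 \<le> ?d / real (L n)" by (intro divide_nonneg_nonneg sum_nonneg) auto
      ultimately show ?thesis by (simp add: sum_subtractf diff_divide_distrib)
    qed
    from ev have "eventually (\<lambda>n. \<bar>(\<Sum>k<L n. \<bar>x n k\<bar> powr p) / real (L n) - ?I\<bar> < e) sequentially"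
    proof eventually_elim
      case (elim n)
      then show ?case using near[of n] A(2) by linarith
    qed
    then show "\<exists>no. \<forall>n\<ge>no. norm ((\<Sum>k<L n. \<bar>x n k\<bar> powr p) / real (L n) - ?I) < e"
      by (simp add: eventually_sequentially)
  qed
qed

section \<open>Quadratic mean bounds for empirical averages\<close>

text \<open>The series of the nonnegative \<open>f n\<close> has finite integral, hence is almost
  surely finite, and its terms tend to zero.\<close>

lemma AE_tendsto_zero_of_summable_integrals:
  fixes f :: "nat \<Rightarrow> 'a \<Rightarrow> real"
  assumes f: "\<And>n. integrable M (f n)" "\<And>n \<omega>. 0 \<le> f n \<omega>"
    and a: "\<And>n. integral\<^sup>L M (f n) \<le> a n" "summable a"
  shows "AE \<omega> in M. (\<lambda>n. f n \<omega>) \<longlonglongrightarrow> 0"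
proof -
  note [measurable] = borel_measurable_integrable[OF f(1)]
  have a0: "0 \<le> a n" for n
    by (rule order_trans[OF Bochner_Integration.integral_nonneg a(1)]) (rule f(2))
  have "(\<integral>\<^sup>+\<omega>. (\<Sum>n. ennreal (f n \<omega>)) \<partial>M) = (\<Sum>n. \<integral>\<^sup>+\<omega>. ennreal (f n \<omega>) \<partial>M)"
    by (rule nn_integral_suminf) measurable
  also have "\<dots> = (\<Sum>n. ennreal (integral\<^sup>L M (f n)))"
    using f by (simp add: nn_integral_eq_integral)
  also have "\<dots> \<le> (\<Sum>n. ennreal (a n))"
    by (intro suminf_le ennreal_leI a) auto
  also have "\<dots> = ennreal (\<Sum>n. a n)"
    using a a0 by (intro suminf_ennreal_eq) (auto simp: summable_sums)
  also have "\<dots> < \<infinity>" by simp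
  finally have "AE \<omega> in M. (\<Sum>n. ennreal (f n \<omega>)) \<noteq> \<infinity>"
    by (intro nn_integral_noteq_infinite) auto
  then show ?thesis
  proof eventually_elim
    case (elim \<omega>)
    then have "summable (\<lambda>n. f n \<omega>)"
      using f(2) by (intro summable_suminf_not_top) auto
    then show ?case by (rule summable_LIMSEQ_zero)
  qed
qed

lemma (in prob_space) has_bochner_integral_cos:
  assumes [measurable]: "X \<in> borel_measurable M" and "(\<integral>\<omega>. cis (X \<omega>) \<partial>M) = complex_of_real r"
  shows "has_bochner_integral M (\<lambda>\<omega>. cos (X \<omega>)) r"
proof -
  have i: "integrable M (\<lambda>\<omega>. cis (X \<omega>))"
    by (rule integrable_const_bound[where B = 1]) (auto simp: cis_conv_exp)
  have "(\<integral>\<omega>. Re (cis (X \<omega>)) \<partial>M) = r"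
    using assms(2) by (subst integral_Re[OF i]) simp
  moreover have "integrable M (\<lambda>\<omega>. Re (cis (X \<omega>)))" using i by (rule integrable_Re)
  ultimately show ?thesis by (simp add: has_bochner_integral_iff)
qed

lemma one_minus_exp_neg_le: "1 - exp (- x) \<le> (x::real)"
proof -
  have "1 - E \<le> x" if "1 + - x \<le> E" for E using that by simp
  then show ?thesis using exp_ge_add_one_self by blast
qed

lemma abs_exp_neg_diff_le:
  fixes x y :: real
  assumes "x \<ge> 0" "y \<ge> 0"
  shows "\<bar>exp (- x) - exp (- y)\<bar> \<le> \<bar>x - y\<bar>"
proof -
  have *: "exp (- x) - exp (- y) \<le> y - x" if "0 \<le> x" "x \<le> y" for x y :: real
  proof -
    have "exp (- x) - exp (- y) = exp (- x) * (1 - exp (- (y - x)))"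
      by (simp add: algebra_simps flip: exp_add)
    also have "\<dots> \<le> 1 * (1 - exp (- (y - x)))" using that by (intro mult_right_mono) auto
    also have "\<dots> \<le> y - x" using one_minus_exp_neg_le[of "y - x"] by (simp only: mult_1)
    finally show ?thesis .
  qed
  show ?thesis using *[of x y] *[of y x] assms by (cases "x \<le> y") auto
qed

text \<open>The mean square is a double sum of covariances of \<open>cis (u * U k)\<close>. Each is
  a difference of two exponentials whose exponents differ by
  \<open>u\<^sup>2 * \<Gamma> k l\<close>, so \<open>exp (- x)\<close> being 1-Lipschitz on
  nonnegative arguments leaves the first power of the covariance. \<open>B\<close> is kept apart
  from \<open>L\<close> because partial ranges of indices will be divided by the full
  number.\<close>

lemma gaussian_family_empirical_char:
  fixes U :: "nat \<Rightarrow> 'a \<Rightarrow> real" and L :: nat and u B :: real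
  assumes g: "gaussian_family M U \<Gamma>" and B: "B > 0"
  defines "D \<equiv> \<lambda>\<omega>. (cmod ((\<Sum>k<L. cis (u * U k \<omega>) - complex_of_real (exp (- (u\<^sup>2 * \<Gamma> k k) / 2))) / complex_of_real B))\<^sup>2"
  shows "integrable M D" and "integral\<^sup>L M D \<le> u\<^sup>2 * (\<Sum>k<L. \<Sum>l<L. \<bar>\<Gamma> k l\<bar>) / B\<^sup>2"
proof -
  interpret prob_space M by (rule gaussian_familyD(1)[OF g])
  note [measurable] = gaussian_familyD(2)[OF g]
  define m where "m k = exp (- (u\<^sup>2 * \<Gamma> k k) / 2)" for k
  define v where "v k l = exp (- (u\<^sup>2 * (\<Gamma> k k - 2 * \<Gamma> k l + \<Gamma> l l)) / 2)" for k l
  have c1: "has_bochner_integral M (\<lambda>\<omega>. cos (u * U k \<omega>)) (m k)" for k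
    unfolding m_def by (rule has_bochner_integral_cos) (use gaussian_family_single(1)[OF g, of u k] in auto)
  have c2: "has_bochner_integral M (\<lambda>\<omega>. cos (u * (U k \<omega> - U l \<omega>))) (v k l)" for k l
    unfolding v_def by (rule has_bochner_integral_cos) (use gaussian_family_pair(1)[OF g, of u 1 k "-1" l] in auto)
  have D: "D \<omega> = (\<Sum>k<L. \<Sum>l<L. cos (u * (U k \<omega> - U l \<omega>)) - m k * cos (u * U l \<omega>) - m l * cos (u * U k \<omega>) + m k * m l) / B\<^sup>2" for \<omega>
  proof -
    let ?c = "\<lambda>k. cos (u * U k \<omega>)" and ?s = "\<lambda>k. sin (u * U k \<omega>)"
    have "(cmod (\<Sum>k<L. cis (u * U k \<omega>) - complex_of_real (m k)))\<^sup>2 = (\<Sum>k<L. ?c k - m k)\<^sup>2 + (\<Sum>k<L. ?s k)\<^sup>2"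
      by (subst cmod_power2) simp
    also have "\<dots> = (\<Sum>k<L. \<Sum>l<L. (?c k - m k) * (?c l - m l) + ?s k * ?s l)"
      by (simp add: power2_eq_square sum_product sum.distrib)
    also have "\<dots> = (\<Sum>k<L. \<Sum>l<L. cos (u * (U k \<omega> - U l \<omega>)) - m k * ?c l - m l * ?c k + m k * m l)"
      by (intro sum.cong refl) (simp add: right_diff_distrib cos_diff algebra_simps)
    finally show ?thesis
      unfolding D_def m_def[symmetric] using B by (simp add: norm_divide power_divide)
  qed
  have "has_bochner_integral M D ((\<Sum>k<L. \<Sum>l<L. v k l - m k * m l - m l * m k + m k * m l) / B\<^sup>2)"
    unfolding D[abs_def]
    by (intro has_bochner_integral_divide_zero has_bochner_integral_sum has_bochner_integral_add
        has_bochner_integral_diff has_bochner_integral_mult_right c1 c2) (simp add: has_bochner_integral_iff prob_space)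
  then have *: "has_bochner_integral M D ((\<Sum>k<L. \<Sum>l<L. v k l - m k * m l) / B\<^sup>2)"
    by (simp add: mult.commute)
  then show "integrable M D" by (simp add: has_bochner_integral_iff)
  have "v k l - m k * m l \<le> u\<^sup>2 * \<bar>\<Gamma> k l\<bar>" for k l
  proof -
    have "0 \<le> u\<^sup>2 * (\<Gamma> k k - 2 * \<Gamma> k l + \<Gamma> l l) / 2" "0 \<le> u\<^sup>2 * (\<Gamma> k k + \<Gamma> l l) / 2"
      using gaussian_family_pair(2)[OF g, of 1 k "-1" l] gaussian_family_single(2)[OF g] by auto
    note a = abs_exp_neg_diff_le[OF this]
    have "v k l = exp (- (u\<^sup>2 * (\<Gamma> k k - 2 * \<Gamma> k l + \<Gamma> l l) / 2))"
      "m k * m l = exp (- (u\<^sup>2 * (\<Gamma> k k + \<Gamma> l l) / 2))"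
      by (simp_all add: v_def m_def field_simps flip: exp_add)
    then have "\<bar>v k l - m k * m l\<bar> \<le> \<bar>u\<^sup>2 * (\<Gamma> k k - 2 * \<Gamma> k l + \<Gamma> l l) / 2 - u\<^sup>2 * (\<Gamma> k k + \<Gamma> l l) / 2\<bar>"
      using a by (simp only:)
    also have "\<dots> = \<bar>u\<^sup>2 * \<Gamma> k l\<bar>" by (simp add: field_simps)
    finally show ?thesis by (simp add: abs_mult)
  qed
  then have "(\<Sum>k<L. \<Sum>l<L. v k l - m k * m l) \<le> (\<Sum>k<L. \<Sum>l<L. u\<^sup>2 * \<bar>\<Gamma> k l\<bar>)"
    by (intro sum_mono)
  then show "integral\<^sup>L M D \<le> u\<^sup>2 * (\<Sum>k<L. \<Sum>l<L. \<bar>\<Gamma> k l\<bar>) / B\<^sup>2"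
    using * by (simp add: has_bochner_integral_iff divide_right_mono sum_distrib_left)
qed

lemma exp_diff_le_exp_max:
  fixes x y :: real
  assumes "x \<le> c" "y \<le> c"
  shows "exp x - exp y \<le> exp c * \<bar>x - y\<bar>"
proof (cases "y \<le> x")
  case True
  have "exp x - exp y = exp x * (1 - exp (- (x - y)))" by (simp add: algebra_simps flip: exp_add)
  also have "\<dots> \<le> exp x * (x - y)" by (intro mult_left_mono one_minus_exp_neg_le) simp
  also have "\<dots> \<le> exp c * (x - y)" using assms True by (intro mult_right_mono) auto
  finally show ?thesis using True by simp
next
  case False
  then have "exp x - exp y \<le> 0" by simp
  then show ?thesis by (smt (verit) mult_nonneg_nonneg abs_ge_zero exp_ge_zero)
qed

text \<open>The same computation with products of \<open>cosh\<close> written as averages of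
  \<open>cosh\<close> of sum and difference. As \<open>exp\<close> is only locally Lipschitz, a
  common bound \<open>w\<close> on the variances is required.\<close>

lemma gaussian_family_empirical_cosh:
  fixes U :: "nat \<Rightarrow> 'a \<Rightarrow> real" and L :: nat and u B :: real
  assumes g: "gaussian_family M U \<Gamma>" and B: "B > 0" and w: "\<And>k. \<Gamma> k k \<le> w"
  defines "D \<equiv> \<lambda>\<omega>. ((\<Sum>k<L. cosh (U k \<omega>) - exp (\<Gamma> k k / 2)) / B)\<^sup>2"
  shows "integrable M D" and "integral\<^sup>L M D \<le> exp (2 * w) * (\<Sum>k<L. \<Sum>l<L. \<bar>\<Gamma> k l\<bar>) / B\<^sup>2"
proof -
  interpret prob_space M by (rule gaussian_familyD(1)[OF g])
  note [measurable] = gaussian_familyD(2)[OF g]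
  define m where "m k = exp (\<Gamma> k k / 2)" for k
  define v where "v k l x = exp ((\<Gamma> k k + 2 * x * \<Gamma> k l + x\<^sup>2 * \<Gamma> l l) / 2)" for k l x
  have c1: "has_bochner_integral M (\<lambda>\<omega>. cosh (U k \<omega>)) (m k)" for k
    unfolding m_def
    by (rule centred_gaussian_cosh) (use gaussian_family_single[OF g] in auto)
  have c2: "has_bochner_integral M (\<lambda>\<omega>. cosh (1 * U k \<omega> + x * U l \<omega>)) (v k l x)" for k l x
  proof -
    have "has_bochner_integral M (\<lambda>\<omega>. cosh (1 * U k \<omega> + x * U l \<omega>)) (exp ((1\<^sup>2 * \<Gamma> k k + 2 * 1 * x * \<Gamma> k l + x\<^sup>2 * \<Gamma> l l) / 2))"
      by (rule centred_gaussian_cosh[OF _ gaussian_family_pair(1)[OF g] gaussian_family_pair(2)[OF g]]) measurable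
    then show ?thesis by (simp add: v_def)
  qed
  have D: "D \<omega> = (\<Sum>k<L. \<Sum>l<L. (cosh (1 * U k \<omega> + 1 * U l \<omega>) + cosh (1 * U k \<omega> + (-1) * U l \<omega>)) / 2
     - m k * cosh (U l \<omega>) - m l * cosh (U k \<omega>) + m k * m l) / B\<^sup>2" for \<omega>
  proof -
    let ?c = "\<lambda>k. cosh (U k \<omega>)"
    have "(\<Sum>k<L. ?c k - m k)\<^sup>2 = (\<Sum>k<L. \<Sum>l<L. (?c k - m k) * (?c l - m l))"
      by (simp add: power2_eq_square sum_product)
    also have "\<dots> = (\<Sum>k<L. \<Sum>l<L. (cosh (1 * U k \<omega> + 1 * U l \<omega>) + cosh (1 * U k \<omega> + (-1) * U l \<omega>)) / 2
       - m k * ?c l - m l * ?c k + m k * m l)"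
      by (intro sum.cong refl) (simp add: cosh_add cosh_diff algebra_simps)
    finally show ?thesis
      unfolding D_def m_def[symmetric] by (simp add: power_divide)
  qed
  have "has_bochner_integral M D ((\<Sum>k<L. \<Sum>l<L. (v k l 1 + v k l (-1)) / 2 - m k * m l - m l * m k + m k * m l) / B\<^sup>2)"
    unfolding D[abs_def]
    by (intro has_bochner_integral_divide_zero has_bochner_integral_sum has_bochner_integral_add
        has_bochner_integral_diff has_bochner_integral_mult_right c1 c2) (simp add: has_bochner_integral_iff prob_space)
  then have *: "has_bochner_integral M D ((\<Sum>k<L. \<Sum>l<L. (v k l 1 + v k l (-1)) / 2 - m k * m l) / B\<^sup>2)"
    by (simp add: mult.commute)
  then show "integrable M D" by (simp add: has_bochner_integral_iff)
  have "(v k l 1 + v k l (-1)) / 2 - m k * m l \<le> exp (2 * w) * \<bar>\<Gamma> k l\<bar>" for k l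
  proof -
    let ?A = "(\<Gamma> k k + \<Gamma> l l) / 2"
    have w0: "0 \<le> w" using gaussian_family_single(2)[OF g, of k] w[of k] by simp
    have r: "\<bar>\<Gamma> k l\<bar> \<le> ?A" by (rule gaussian_family_cov_le[OF g])
    have A: "?A \<le> w" using w[of k] w[of l] by simp
    \<comment> \<open>A covariance is at most the mean of the two variances, so all exponents stay
      below \<open>2 * w\<close> and \<open>exp (2 * w)\<close> is an admissible Lipschitz
      constant.\<close>
    have "?A + \<Gamma> k l \<le> 2*w" "?A - \<Gamma> k l \<le> 2*w" "?A \<le> 2*w" using r A w0 by linarith+
    then have "exp (?A + \<Gamma> k l) - exp ?A \<le> exp (2*w) * \<bar>\<Gamma> k l\<bar>" "exp (?A - \<Gamma> k l) - exp ?A \<le> exp (2*w) * \<bar>\<Gamma> k l\<bar>"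
      using exp_diff_le_exp_max[of "?A + \<Gamma> k l" "2*w" ?A] exp_diff_le_exp_max[of "?A - \<Gamma> k l" "2*w" ?A] by simp_all
    moreover have "v k l 1 = exp (?A + \<Gamma> k l)" "v k l (-1) = exp (?A - \<Gamma> k l)" "m k * m l = exp ?A"
      by (simp_all add: v_def m_def field_simps flip: exp_add)
    ultimately show ?thesis by (simp add: field_simps)
  qed
  then have "(\<Sum>k<L. \<Sum>l<L. (v k l 1 + v k l (-1)) / 2 - m k * m l) \<le> (\<Sum>k<L. \<Sum>l<L. exp (2 * w) * \<bar>\<Gamma> k l\<bar>)"
    by (intro sum_mono)
  then show "integral\<^sup>L M D \<le> exp (2 * w) * (\<Sum>k<L. \<Sum>l<L. \<bar>\<Gamma> k l\<bar>) / B\<^sup>2"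
    using * by (simp add: has_bochner_integral_iff divide_right_mono sum_distrib_left)
qed

text \<open>Almost sure convergence can be had simultaneously for countably many frequencies only;
  the common Lipschitz constant extends it to all of them on the same path.\<close>

lemma LIMSEQ_equi_Lipschitz_dense:
  fixes f :: "nat \<Rightarrow> real \<Rightarrow> 'a::real_normed_vector"
  assumes lip: "\<And>n u v. norm (f n u - f n v) \<le> K * \<bar>u - v\<bar>"
    and g: "continuous_on UNIV g" and q: "\<And>u. u \<in> \<rat> \<Longrightarrow> (\<lambda>n. f n u) \<longlonglongrightarrow> g u"
  shows "(\<lambda>n. f n u) \<longlonglongrightarrow> g u"
proof (rule LIMSEQ_I)
  fix e :: real assume e: "e > 0"
  have K: "K \<ge> 0" using order_trans[OF norm_ge_zero lip[of 0 0 1]] by simp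
  have "isCont g u" using g by (simp add: continuous_on_eq_continuous_at)
  then obtain d where d: "d > 0" "\<And>v. dist v u < d \<Longrightarrow> dist (g v) (g u) < e / 3"
    using e unfolding continuous_at_eps_delta by (metis divide_pos_pos zero_less_numeral)
  define d' where "d' = min d (e / (3 * (K + 1)))"
  have d': "d' > 0" using d e K by (simp add: d'_def)
  obtain v where v: "v \<in> \<rat>" "u < v" "v < u + d'" using Rats_dense_in_real[of u "u + d'"] d' by auto
  have "K * \<bar>u - v\<bar> \<le> (K + 1) * (e / (3 * (K + 1)))"
    using v K e by (intro mult_mono) (auto simp: d'_def)
  also have "\<dots> = e / 3" using K by (simp add: field_simps)
  finally have Kv: "K * \<bar>u - v\<bar> \<le> e / 3" .
  have gv: "norm (g v - g u) < e / 3" using d(2)[of v] v by (simp add: d'_def dist_norm)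
  obtain N where N: "\<And>n. n \<ge> N \<Longrightarrow> norm (f n v - g v) < e / 3"
    using LIMSEQ_D[OF q[OF v(1)], of "e/3"] e by auto
  have "norm (f n u - g u) < e" if "n \<ge> N" for n
  proof -
    have "f n u - g u = (f n u - f n v) + ((f n v - g v) + (g v - g u))" by simp
    then have "norm (f n u - g u) \<le> norm (f n u - f n v) + (norm (f n v - g v) + norm (g v - g u))"
      by (metis norm_triangle_ineq add_left_mono order_trans)
    then show ?thesis using lip[of n u v] Kv N[OF that] gv by linarith
  qed
  then show "\<exists>no. \<forall>n\<ge>no. norm (f n u - g u) < e" by blast
qed

section \<open>Stability of empirical moments under uniformly small perturbations\<close>

lemma cmod_cis_diff_le: "cmod (cis x - cis y) \<le> \<bar>x - y\<bar>"
proof -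
  have "cis x - cis y = cis y * (cis (x - y) - 1)" by (simp add: algebra_simps cis_mult)
  then have "cmod (cis x - cis y) = cmod (cis (x - y) - 1)" by (simp add: norm_mult)
  also have "\<dots> \<le> \<bar>x - y\<bar>"
    using iexp_approx1[of "x - y" 0] by (simp add: cis_conv_exp)
  finally show ?thesis .
qed

lemma cosh_add_le: "cosh (x + d) \<le> exp \<bar>d\<bar> * cosh (x::real)"
proof -
  have "exp (x + d) \<le> exp \<bar>d\<bar> * exp x" "exp (- (x + d)) \<le> exp \<bar>d\<bar> * exp (- x)"
    by (simp_all flip: exp_add)
  then have "(exp (x + d) + exp (- (x + d))) / 2 \<le> exp \<bar>d\<bar> * ((exp x + exp (- x)) / 2)"
    by (simp add: distrib_left)
  then show ?thesis by (simp add: cosh_def)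
qed

lemma abs_le_cosh: "\<bar>x\<bar> \<le> cosh (x::real)"
proof -
  have "1 + \<bar>x\<bar> + x\<^sup>2 / 2 \<le> exp \<bar>x\<bar>" using exp_lower_Taylor_quadratic[of "\<bar>x\<bar>"] by simp
  moreover have "0 \<le> (\<bar>x\<bar> - 1)\<^sup>2" by simp
  then have "2 * \<bar>x\<bar> \<le> 1 + x\<^sup>2" by (simp add: power2_diff)
  moreover have "exp \<bar>x\<bar> \<le> 2 * cosh x" by (cases "x \<ge> 0") (auto simp: cosh_def field_simps)
  moreover have "x\<^sup>2 \<ge> 0" by simp
  ultimately have "1 + \<bar>x\<bar> + \<bar>x\<bar> - 1/2 \<le> 2 * cosh x" by linarith
  then show ?thesis by linarith
qed

text \<open>The form in which a sample path uses the moment limit: only the fraction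
  \<open>t\<close> of the indices is summed, characteristic functions are known at rational
  \<open>u\<close>, and the array \<open>y\<close> of interest differs from the Gaussian array
  \<open>x\<close> by a uniformly vanishing amount, later the contribution of
  \<open>\<kappa>\<close>.\<close>

lemma empirical_abs_moment_perturbed:
  fixes x y :: "nat \<Rightarrow> nat \<Rightarrow> real" and L :: "nat \<Rightarrow> nat" and B \<epsilon> :: "nat \<Rightarrow> real"
  assumes B: "\<And>n. B n > 0" and t: "t > 0" "(\<lambda>n. real (L n) / B n) \<longlonglongrightarrow> t"
    and p: "p > 0" and s: "s \<ge> 0"
    and ch: "\<And>u. u \<in> \<rat> \<Longrightarrow> (\<lambda>n. (\<Sum>k<L n. cis (u * x n k)) /\<^sub>R B n) \<longlonglongrightarrow> complex_of_real (t * exp (- (u\<^sup>2 * s\<^sup>2) / 2))"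
    and co: "\<And>n. (\<Sum>k<L n. cosh (x n k)) / B n \<le> K"
    and e: "\<epsilon> \<longlonglongrightarrow> 0" "\<And>n k. k < L n \<Longrightarrow> \<bar>y n k - x n k\<bar> \<le> \<epsilon> n"
  shows "(\<lambda>n. (\<Sum>k<L n. \<bar>y n k\<bar> powr p) / B n)
     \<longlonglongrightarrow> s powr p * (2 powr (p/2) * Gamma ((p + 1) / 2) / sqrt pi) * t"
proof -
  let ?I = "s powr p * (2 powr (p/2) * Gamma ((p + 1) / 2) / sqrt pi)"
  let ?g = "\<lambda>u. complex_of_real (exp (- (u\<^sup>2 * s\<^sup>2) / 2))"
  have "eventually (\<lambda>n. t / 2 < real (L n) / B n) sequentially"
    using t by (intro order_tendstoD) auto
  moreover have "eventually (\<lambda>n. \<bar>\<epsilon> n\<bar> < 1) sequentially"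
    using tendstoD[OF e(1), of 1] by simp
  ultimately obtain N where N: "\<And>n. n \<ge> N \<Longrightarrow> t / 2 < real (L n) / B n \<and> \<bar>\<epsilon> n\<bar> < 1"
    by (metis (mono_tags, lifting) eventually_conj eventually_sequentially)
  \<comment> \<open>Dropping the first \<open>N\<close> terms makes the range nonempty and the
    perturbation smaller than 1 for every index.\<close>
  define n' where "n' n = n + N" for n
  have n': "filterlim n' sequentially sequentially"
    unfolding n'_def by (rule filterlim_add_const_nat_at_top)
  have ratio: "t / 2 < real (L (n' n)) / B (n' n)" and e1: "\<bar>\<epsilon> (n' n)\<bar> < 1" for n
    using N[of "n' n"] by (auto simp: n'_def)
  have L: "L (n' n) > 0" for n
    using ratio[of n] t by (cases "L (n' n) = 0") auto
  have inv: "(\<lambda>n. B (n' n) / real (L (n' n))) \<longlonglongrightarrow> inverse t"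
    using tendsto_inverse[OF filterlim_compose[OF t(2) n']] t(1) by (simp add: inverse_divide)
  have K: "0 \<le> K"
    using co[of 0] B[of 0] by (smt (verit) divide_nonneg_pos sum_nonneg cosh_real_pos)
  \<comment> \<open>The factor \<open>exp 1\<close> pays for a perturbation of size at most 1, and
    \<open>2 / t\<close> for replacing the divisor \<open>B\<close> by the number of
    summands.\<close>
  have co': "(\<Sum>k<L (n' n). cosh (y (n' n) k)) / real (L (n' n)) \<le> exp 1 * K * (2 / t)" for n
  proof -
    have "(\<Sum>k<L (n' n). cosh (y (n' n) k)) \<le> (\<Sum>k<L (n' n). exp 1 * cosh (x (n' n) k))"
    proof (rule sum_mono)
      fix k assume "k \<in> {..<L (n' n)}"
      then have d: "\<bar>y (n' n) k - x (n' n) k\<bar> \<le> 1" using e(2)[of k "n' n"] e1[of n] by auto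
      have "cosh (y (n' n) k) \<le> exp \<bar>y (n' n) k - x (n' n) k\<bar> * cosh (x (n' n) k)"
        using cosh_add_le[of "x (n' n) k" "y (n' n) k - x (n' n) k"] by simp
      also have "\<dots> \<le> exp 1 * cosh (x (n' n) k)"
        using d by (intro mult_right_mono) (auto simp: less_imp_le[OF cosh_real_pos])
      finally show "cosh (y (n' n) k) \<le> exp 1 * cosh (x (n' n) k)" .
    qed
    also have "\<dots> = exp 1 * (\<Sum>k<L (n' n). cosh (x (n' n) k))" by (simp add: sum_distrib_left)
    also have "\<dots> \<le> exp 1 * (K * B (n' n))"
      using co[of "n' n"] B[of "n' n"] by (intro mult_left_mono) (auto simp: field_simps)
    also have "\<dots> \<le> exp 1 * (K * (2 / t * real (L (n' n))))"
      using ratio[of n] B[of "n' n"] t(1) K by (intro mult_left_mono) (auto simp: field_simps)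
    finally show ?thesis using L[of n] by (simp add: field_simps)
  qed
  \<comment> \<open>Since \<open>\<bar>y\<bar> \<le> cosh y\<close>, the bound on averages of
    \<open>cosh\<close> is also a Lipschitz constant in \<open>u\<close>.\<close>
  have lim: "(\<lambda>n. (\<Sum>k<L (n' n). cis (u * y (n' n) k)) /\<^sub>R real (L (n' n))) \<longlonglongrightarrow> ?g u" for u
  proof (rule LIMSEQ_equi_Lipschitz_dense[where K = "exp 1 * K * (2 / t)" and g = ?g
        and f = "\<lambda>n u. (\<Sum>k<L (n' n). cis (u * y (n' n) k)) /\<^sub>R real (L (n' n))"])
    show "continuous_on UNIV ?g" by (intro continuous_intros) auto
    show "norm ((\<Sum>k<L (n' n). cis (u * y (n' n) k)) /\<^sub>R real (L (n' n)) - (\<Sum>k<L (n' n). cis (v * y (n' n) k)) /\<^sub>R real (L (n' n)))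
      \<le> exp 1 * K * (2 / t) * \<bar>u - v\<bar>" for n u v
    proof -
      have "norm (\<Sum>k<L (n' n). cis (u * y (n' n) k) - cis (v * y (n' n) k)) \<le> (\<Sum>k<L (n' n). \<bar>u - v\<bar> * cosh (y (n' n) k))"
      proof (rule sum_norm_le)
        fix k
        have "norm (cis (u * y (n' n) k) - cis (v * y (n' n) k)) \<le> \<bar>u - v\<bar> * \<bar>y (n' n) k\<bar>"
          using cmod_cis_diff_le[of "u * y (n' n) k" "v * y (n' n) k"] by (simp add: abs_mult flip: left_diff_distrib)
        also have "\<dots> \<le> \<bar>u - v\<bar> * cosh (y (n' n) k)" by (intro mult_left_mono abs_le_cosh) auto
        finally show "norm (cis (u * y (n' n) k) - cis (v * y (n' n) k)) \<le> \<bar>u - v\<bar> * cosh (y (n' n) k)" .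
      qed
      also have "\<dots> \<le> \<bar>u - v\<bar> * (exp 1 * K * (2 / t) * real (L (n' n)))"
        using co'[of n] L[of n] unfolding sum_distrib_left[symmetric] by (intro mult_left_mono) (auto simp: field_simps)
      finally have "norm (\<Sum>k<L (n' n). cis (u * y (n' n) k) - cis (v * y (n' n) k)) / real (L (n' n)) \<le> exp 1 * K * (2 / t) * \<bar>u - v\<bar>"
        using L[of n] by (simp add: divide_le_eq mult_ac)
      then show ?thesis using L[of n]
        by (simp add: sum_subtractf divide_inverse_commute flip: scaleR_diff_right)
    qed
    fix u :: real assume u: "u \<in> \<rat>"
    have x: "(\<lambda>n. (B (n' n) / real (L (n' n))) *\<^sub>R ((\<Sum>k<L (n' n). cis (u * x (n' n) k)) /\<^sub>R B (n' n)))
       \<longlonglongrightarrow> inverse t *\<^sub>R complex_of_real (t * exp (- (u\<^sup>2 * s\<^sup>2) / 2))"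
      by (intro tendsto_scaleR inv filterlim_compose[OF ch[OF u] n'])
    have "(\<lambda>n. (\<Sum>k<L (n' n). cis (u * x (n' n) k)) /\<^sub>R real (L (n' n))) \<longlonglongrightarrow> ?g u"
    proof -
      have "B (n' n) / real (L (n' n)) * inverse (B (n' n)) = inverse (real (L (n' n)))" for n
        using B[of "n' n"] by (simp add: field_simps)
      moreover have "inverse t *\<^sub>R complex_of_real (t * exp (- (u\<^sup>2 * s\<^sup>2) / 2)) = ?g u"
        using t(1) by (simp add: scaleR_conv_of_real)
      ultimately show ?thesis using x by (simp only: scaleR_scaleR)
    qed
    moreover have "(\<lambda>n. (\<Sum>k<L (n' n). cis (u * y (n' n) k)) /\<^sub>R real (L (n' n)) - (\<Sum>k<L (n' n). cis (u * x (n' n) k)) /\<^sub>R real (L (n' n))) \<longlonglongrightarrow> 0"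
    proof (rule Lim_null_comparison)
      show "(\<lambda>n. \<bar>u\<bar> * \<epsilon> (n' n)) \<longlonglongrightarrow> 0"
        using tendsto_mult_right_zero[OF filterlim_compose[OF e(1) n']] .
      have "norm ((\<Sum>k<L (n' n). cis (u * y (n' n) k)) /\<^sub>R real (L (n' n)) - (\<Sum>k<L (n' n). cis (u * x (n' n) k)) /\<^sub>R real (L (n' n))) \<le> \<bar>u\<bar> * \<epsilon> (n' n)" for n
      proof -
        have "norm (\<Sum>k<L (n' n). cis (u * y (n' n) k) - cis (u * x (n' n) k)) \<le> (\<Sum>k<L (n' n). \<bar>u\<bar> * \<epsilon> (n' n))"
        proof (rule sum_norm_le)
          fix k assume "k \<in> {..<L (n' n)}"
          then have "\<bar>u\<bar> * \<bar>y (n' n) k - x (n' n) k\<bar> \<le> \<bar>u\<bar> * \<epsilon> (n' n)"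
            using e(2)[of k "n' n"] by (intro mult_left_mono) auto
          then show "norm (cis (u * y (n' n) k) - cis (u * x (n' n) k)) \<le> \<bar>u\<bar> * \<epsilon> (n' n)"
            using cmod_cis_diff_le[of "u * y (n' n) k" "u * x (n' n) k"] by (simp add: abs_mult flip: right_diff_distrib)
        qed
        then have "norm (\<Sum>k<L (n' n). cis (u * y (n' n) k) - cis (u * x (n' n) k)) / real (L (n' n)) \<le> \<bar>u\<bar> * \<epsilon> (n' n)"
          using L[of n] by (simp add: divide_le_eq mult_ac)
        then show ?thesis using L[of n]
          by (simp add: sum_subtractf divide_inverse_commute flip: scaleR_diff_right)
      qed
      then show "\<forall>\<^sub>F n in sequentially. norm ((\<Sum>k<L (n' n). cis (u * y (n' n) k)) /\<^sub>R real (L (n' n)) - (\<Sum>k<L (n' n). cis (u * x (n' n) k)) /\<^sub>R real (L (n' n))) \<le> \<bar>u\<bar> * \<epsilon> (n' n)"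
        by simp
    qed
    ultimately show "(\<lambda>n. (\<Sum>k<L (n' n). cis (u * y (n' n) k)) /\<^sub>R real (L (n' n))) \<longlonglongrightarrow> ?g u"
      by (drule_tac tendsto_add) (assumption, simp)
  qed
  have "(\<lambda>n. (\<Sum>k<L (n' n). \<bar>y (n' n) k\<bar> powr p) / real (L (n' n))) \<longlonglongrightarrow> ?I"
    by (rule empirical_abs_moment[OF L p s lim co'])
  from tendsto_mult[OF this filterlim_compose[OF t(2) n']]
  have "(\<lambda>n. (\<Sum>k<L (n' n). \<bar>y (n' n) k\<bar> powr p) / real (L (n' n)) * (real (L (n' n)) / B (n' n))) \<longlonglongrightarrow> ?I * t" .
  moreover have "(\<Sum>k<L (n' n). \<bar>y (n' n) k\<bar> powr p) / real (L (n' n)) * (real (L (n' n)) / B (n' n))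
     = (\<Sum>k<L (n' n). \<bar>y (n' n) k\<bar> powr p) / B (n' n)" for n using L[of n] by simp
  ultimately have "(\<lambda>n. (\<Sum>k<L (n' n). \<bar>y (n' n) k\<bar> powr p) / B (n' n)) \<longlonglongrightarrow> ?I * t"
    by (simp only:)
  then have "(\<lambda>n. (\<Sum>k<L (n + N). \<bar>y (n + N) k\<bar> powr p) / B (n + N)) \<longlonglongrightarrow> ?I * t"
    unfolding n'_def .
  then show ?thesis by (rule LIMSEQ_offset)
qed

section \<open>The normalised multilevel sums\<close>

definition badic_ncov :: "real \<Rightarrow> nat \<Rightarrow> nat \<Rightarrow> nat \<Rightarrow> nat \<Rightarrow> nat \<Rightarrow> real" where
  "badic_ncov H b m a n c = real b powr (real (m + n) * H) * badic_cov H b m a n c"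

definition level_cov :: "real \<Rightarrow> nat \<Rightarrow> real \<Rightarrow> nat \<Rightarrow> nat \<Rightarrow> nat \<Rightarrow> real" where
  "level_cov H b r N k l = (\<Sum>i<N. \<Sum>j<N. r ^ i * r ^ j *
     badic_ncov H b (N - i) (k mod b ^ (N - i)) (N - j) (l mod b ^ (N - j)))"

text \<open>With \<open>r = \<alpha> * b powr H\<close> this is \<open>b powr (N * H)\<close> times
  the multilevel increment, with \<open>W\<close> in place of the bridge. Since \<open>W 1\<close>
  need not vanish, it is not an increment of the Weierstrass series of \<open>W\<close>
  itself.\<close>

definition level_sum :: "real \<Rightarrow> nat \<Rightarrow> real \<Rightarrow> (real \<Rightarrow> 'a \<Rightarrow> real) \<Rightarrow> nat \<Rightarrow> nat \<Rightarrow> 'a \<Rightarrow> real" where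
  "level_sum H b r W N k \<omega> = (\<Sum>i<N. r ^ i * (real b powr (real (N - i) * H) *
     (W (real (k mod b ^ (N - i) + 1) / real b ^ (N - i)) \<omega> - W (real (k mod b ^ (N - i)) / real b ^ (N - i)) \<omega>)))"

lemma badic_incr_family:
  assumes fbm: "is_fbm M H W"
  shows "gaussian_family M
    (\<lambda>(m, a) \<omega>. real b powr (real m * H) * (W (real (a + 1) / real b ^ m) \<omega> - W (real a / real b ^ m) \<omega>))
    (\<lambda>(m, a) (n, c). badic_ncov H b m a n c)"
proof -
  \<comment> \<open>The unit component supplies the pair index that
    \<open>gaussian_family_lincomb\<close> expects, here with one-term combinations.\<close>
  let ?s = "\<lambda>((m, a), _::unit). real a / real b ^ m" and ?t = "\<lambda>((m, a), _::unit). real (a + 1) / real b ^ m"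
  have f: "gaussian_family M (\<lambda>i \<omega>. W (?t i) \<omega> - W (?s i) \<omega>) (\<lambda>i j. fbm_incr_cov H (?s i) (?t i) (?s j) (?t j))"
    by (rule fbm_incr_family[OF fbm]) auto
  have "gaussian_family M (\<lambda>k \<omega>. \<Sum>m\<in>{()}. real b powr (real (fst k) * H) * (W (?t (k, m)) \<omega> - W (?s (k, m)) \<omega>))
     (\<lambda>k l. \<Sum>m\<in>{()}. \<Sum>n\<in>{()}. real b powr (real (fst k) * H) * real b powr (real (fst l) * H) *
        fbm_incr_cov H (?s (k, m)) (?t (k, m)) (?s (l, n)) (?t (l, n)))"
    using gaussian_family_lincomb[OF f, of "{()}" "\<lambda>k _. real b powr (real (fst k) * H)"] by simp
  then show ?thesis
    by (simp add: badic_ncov_def badic_cov_def powr_add distrib_right case_prod_unfold)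
qed

lemma badic_ncov_diag:
  assumes "b \<ge> 2"
  shows "badic_ncov H b m a m a = 1"
proof -
  have "badic_cov H b m a m a = (1 / real b ^ m) powr (2*H)"
    using assms unfolding badic_cov_def fbm_incr_cov_def
    by (simp flip: diff_divide_distrib add: abs_minus_commute)
  then show ?thesis using assms
    by (simp add: badic_ncov_def powr_divide powr_powr flip: powr_realpow powr_diff)
qed

lemma abs_badic_ncov_le_1:
  assumes fbm: "is_fbm M H W" and b: "b \<ge> 2"
  shows "\<bar>badic_ncov H b m a n c\<bar> \<le> 1"
  using gaussian_family_cov_le[OF badic_incr_family[OF fbm, of b], of "(m, a)" "(n, c)"]
  by (simp add: badic_ncov_diag[OF b])

lemma level_sum_family:
  assumes fbm: "is_fbm M H W"
  shows "gaussian_family M (level_sum H b r W N) (level_cov H b r N)"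
proof -
  let ?s = "\<lambda>(k, i). real (k mod b ^ (N - i)) / real b ^ (N - i)"
    and ?t = "\<lambda>(k, i). real (k mod b ^ (N - i) + 1) / real b ^ (N - i)"
  have f: "gaussian_family M (\<lambda>i \<omega>. W (?t i) \<omega> - W (?s i) \<omega>) (\<lambda>i j. fbm_incr_cov H (?s i) (?t i) (?s j) (?t j))"
    by (rule fbm_incr_family[OF fbm]) auto
  have "gaussian_family M (\<lambda>k \<omega>. \<Sum>i\<in>{..<N}. (r ^ i * real b powr (real (N - i) * H)) * (W (?t (k, i)) \<omega> - W (?s (k, i)) \<omega>))
     (\<lambda>k l. \<Sum>i\<in>{..<N}. \<Sum>j\<in>{..<N}. (r ^ i * real b powr (real (N - i) * H)) * (r ^ j * real b powr (real (N - j) * H)) *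
        fbm_incr_cov H (?s (k, i)) (?t (k, i)) (?s (l, j)) (?t (l, j)))"
    using gaussian_family_lincomb[OF f, of "{..<N}" "\<lambda>k i. r ^ i * real b powr (real (N - i) * H)"] by simp
  moreover have "level_sum H b r W N = (\<lambda>k \<omega>. \<Sum>i\<in>{..<N}. (r ^ i * real b powr (real (N - i) * H)) * (W (?t (k, i)) \<omega> - W (?s (k, i)) \<omega>))"
    by (simp add: level_sum_def fun_eq_iff mult.assoc)
  moreover have "level_cov H b r N = (\<lambda>k l. \<Sum>i\<in>{..<N}. \<Sum>j\<in>{..<N}. (r ^ i * real b powr (real (N - i) * H)) * (r ^ j * real b powr (real (N - j) * H)) *
        fbm_incr_cov H (?s (k, i)) (?t (k, i)) (?s (l, j)) (?t (l, j)))"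
    unfolding level_cov_def badic_ncov_def badic_cov_def of_nat_add[of "N - _"] distrib_right powr_add
    by (simp add: fun_eq_iff mult_ac)
  ultimately show ?thesis by simp
qed

lemma sum_mod_power:
  fixes g :: "nat \<Rightarrow> real"
  assumes "m \<le> N" "b > 0"
  shows "(\<Sum>k<b^N. g (k mod b^m)) = real b ^ (N - m) * (\<Sum>a<b^m. g a)"
proof -
  have "b ^ N = b ^ (N - m) * b ^ m" using assms by (simp flip: power_add)
  then have "(\<Sum>k<b^N. g (k mod b^m)) = (\<Sum>c<b^(N-m). \<Sum>a<b^m. g ((c * b^m + a) mod b^m))"
    by (simp only: sum_lessThan_mult)
  also have "\<dots> = (\<Sum>c<b^(N-m). \<Sum>a<b^m. g a)" by (intro sum.cong refl) simp
  finally show ?thesis by simp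
qed

text \<open>For a fixed pair of levels, the residues of \<open>(k, l)\<close> run equally often
  through all pairs of intervals, which reduces the average to the normalised bound for two levels.
  That bound is a product in \<open>i\<close> and \<open>j\<close>, whence the square.\<close>

lemma sum_abs_level_cov_le:
  assumes H: "0 < H" "H < 1" and b: "b \<ge> 2" and r: "0 \<le> r"
  shows "(\<Sum>k<b^N. \<Sum>l<b^N. \<bar>level_cov H b r N k l\<bar>) / (real b ^ N)\<^sup>2
     \<le> 2 * (\<Sum>i<N. r ^ i * (real b powr (- min H (1 - H))) ^ (N - i))\<^sup>2"
proof -
  let ?d = "min H (1 - H)"
  let ?g = "\<lambda>i j k l. \<bar>badic_ncov H b (N - i) (k mod b ^ (N - i)) (N - j) (l mod b ^ (N - j))\<bar>"
  have b1: "real b > 1" using b by simp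
  have neg: "- real (x + y) * d = - d * real x + - d * real y" for x y d by (simp add: algebra_simps)
  have pw: "real b ^ (N - m) = real b powr (real N - real m)" if "m \<le> N" for m
    using b1 that powr_realpow[of "real b" "N - m"] by (simp add: of_nat_diff)
  have pm: "(real b powr x) ^ m = real b powr (x * real m)" for x m
    using b1 powr_realpow[of "real b powr x" m] by (simp add: powr_powr)
  have fac: "real b ^ (N - m) * real b ^ (N - n) * real b powr (real (m + n) * H) / (real b ^ N)\<^sup>2
      = real b powr (- real (m + n) * (1 - H))" if "m \<le> N" "n \<le> N" for m n
  proof -
    have "(real b ^ N)\<^sup>2 = real b powr (real N + real N)"
      unfolding powr_add using b1 by (simp add: power2_eq_square powr_realpow)
    then show ?thesis
      unfolding pw[OF that(1)] pw[OF that(2)] by (simp only: powr_add[symmetric] powr_diff[symmetric])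
        (rule arg_cong[where f = "(powr) (real b)"], simp add: algebra_simps)
  qed
  have inner: "(\<Sum>k<b^N. \<Sum>l<b^N. ?g i j k l) / (real b ^ N)\<^sup>2 \<le> 2 * (real b powr (- ?d)) ^ (N - i) * (real b powr (- ?d)) ^ (N - j)" (is "?A \<le> _") for i j
  proof -
    let ?m = "N - i" and ?n = "N - j"
    have "(\<Sum>k<b^N. \<Sum>l<b^N. ?g i j k l) = (\<Sum>k<b^N. real b ^ (N - ?n) * (\<Sum>c<b^?n. \<bar>badic_ncov H b ?m (k mod b^?m) ?n c\<bar>))"
      using b by (intro sum.cong refl sum_mod_power) auto
    also have "\<dots> = real b ^ (N - ?m) * (\<Sum>a<b^?m. real b ^ (N - ?n) * (\<Sum>c<b^?n. \<bar>badic_ncov H b ?m a ?n c\<bar>))"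
      using b by (intro sum_mod_power) auto
    also have "\<dots> = real b ^ (N - ?m) * real b ^ (N - ?n) * real b powr (real (?m + ?n) * H) * (\<Sum>a<b^?m. \<Sum>c<b^?n. \<bar>badic_cov H b ?m a ?n c\<bar>)"
      by (simp add: badic_ncov_def abs_mult sum_distrib_left mult_ac)
    finally have "?A = (real b ^ (N - ?m) * real b ^ (N - ?n) * real b powr (real (?m + ?n) * H) / (real b ^ N)\<^sup>2) * (\<Sum>a<b^?m. \<Sum>c<b^?n. \<bar>badic_cov H b ?m a ?n c\<bar>)"
      by simp
    also have "real b ^ (N - ?m) * real b ^ (N - ?n) * real b powr (real (?m + ?n) * H) / (real b ^ N)\<^sup>2 = real b powr (- real (?m + ?n) * (1 - H))"
      by (rule fac) auto
    also have "\<dots> * (\<Sum>a<b^?m. \<Sum>c<b^?n. \<bar>badic_cov H b ?m a ?n c\<bar>) \<le> 2 * real b powr (- real (?m + ?n) * ?d)"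
      by (rule sum_abs_badic_cov_normalized_le[OF H b])
    also have "\<dots> = 2 * (real b powr (- ?d)) ^ ?m * (real b powr (- ?d)) ^ ?n"
    proof -
      have "- real (?m + ?n) * ?d = - ?d * real ?m + - ?d * real ?n" by (rule neg)
      then show ?thesis unfolding pm mult.assoc powr_add[symmetric] by (simp only:)
    qed
    finally show ?thesis .
  qed
  have "(\<Sum>k<b^N. \<Sum>l<b^N. \<bar>level_cov H b r N k l\<bar>) \<le> (\<Sum>k<b^N. \<Sum>l<b^N. \<Sum>i<N. \<Sum>j<N. r ^ i * r ^ j * ?g i j k l)"
    unfolding level_cov_def using r
    by (intro sum_mono order_trans[OF sum_abs]) (auto simp: abs_mult)
  also have "\<dots> = (\<Sum>i<N. \<Sum>j<N. \<Sum>k<b^N. \<Sum>l<b^N. r ^ i * r ^ j * ?g i j k l)"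
  proof -
    have "(\<Sum>k<b^N. \<Sum>l<b^N. \<Sum>i<N. \<Sum>j<N. F i j k l) = (\<Sum>i<N. \<Sum>j<N. \<Sum>k<b^N. \<Sum>l<b^N. F i j k l)" for F :: "nat \<Rightarrow> nat \<Rightarrow> nat \<Rightarrow> nat \<Rightarrow> real"
    proof -
      have "(\<Sum>k<b^N. \<Sum>l<b^N. \<Sum>i<N. \<Sum>j<N. F i j k l) = (\<Sum>k<b^N. \<Sum>i<N. \<Sum>l<b^N. \<Sum>j<N. F i j k l)"
        by (intro sum.cong refl sum.swap)
      also have "\<dots> = (\<Sum>i<N. \<Sum>k<b^N. \<Sum>l<b^N. \<Sum>j<N. F i j k l)" by (rule sum.swap)
      also have "\<dots> = (\<Sum>i<N. \<Sum>k<b^N. \<Sum>j<N. \<Sum>l<b^N. F i j k l)" by (intro sum.cong refl sum.swap)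
      also have "\<dots> = (\<Sum>i<N. \<Sum>j<N. \<Sum>k<b^N. \<Sum>l<b^N. F i j k l)" by (intro sum.cong refl sum.swap)
      finally show ?thesis .
    qed
    then show ?thesis .
  qed
  finally have "(\<Sum>k<b^N. \<Sum>l<b^N. \<bar>level_cov H b r N k l\<bar>) / (real b ^ N)\<^sup>2
     \<le> (\<Sum>i<N. \<Sum>j<N. \<Sum>k<b^N. \<Sum>l<b^N. r ^ i * r ^ j * ?g i j k l) / (real b ^ N)\<^sup>2"
    by (rule divide_right_mono) simp
  also have "\<dots> = (\<Sum>i<N. \<Sum>j<N. r ^ i * r ^ j * ((\<Sum>k<b^N. \<Sum>l<b^N. ?g i j k l) / (real b ^ N)\<^sup>2))"
    by (simp add: sum_divide_distrib sum_distrib_left)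
  also have "\<dots> \<le> (\<Sum>i<N. \<Sum>j<N. r ^ i * r ^ j * (2 * (real b powr (- ?d)) ^ (N - i) * (real b powr (- ?d)) ^ (N - j)))"
    using r by (intro sum_mono mult_left_mono inner) auto
  also have "\<dots> = 2 * (\<Sum>i<N. r ^ i * (real b powr (- ?d)) ^ (N - i))\<^sup>2"
    by (simp add: power2_eq_square sum_product sum_distrib_left mult_ac)
  finally show ?thesis .
qed

lemma convolution_geometric_bound:
  fixes r s :: real
  assumes "0 \<le> r" "r < 1" "0 \<le> s" "s < 1"
  shows "\<exists>C q. 0 \<le> C \<and> 0 < q \<and> q < 1 \<and> (\<forall>N. (\<Sum>i<N. r ^ i * s ^ (N - i)) \<le> C * q ^ N)"
proof -
  \<comment> \<open>The value \<open>1/4\<close> keeps \<open>q\<close> positive when both ratios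
    are 0. The sum is at most \<open>N * q ^ N\<close>, and passing to \<open>sqrt q\<close> absorbs
    the factor \<open>N\<close>.\<close>
  define q where "q = max (1/4) (max r s)"
  have q: "0 < q" "q < 1" "r \<le> q" "s \<le> q" using assms by (auto simp: q_def)
  have "(\<lambda>n. of_nat n * sqrt q ^ n) \<longlonglongrightarrow> 0"
    using q by (intro powser_times_n_limit_0) auto
  then have "Bseq (\<lambda>n. real n * sqrt q ^ n)" by (intro convergent_imp_Bseq convergentI)
  then obtain C where C: "\<And>n. \<bar>real n * sqrt q ^ n\<bar> \<le> C"
    unfolding Bseq_def real_norm_def by blast
  have "(\<Sum>i<N. r ^ i * s ^ (N - i)) \<le> C * sqrt q ^ N" for N
  proof -
    have "(\<Sum>i<N. r ^ i * s ^ (N - i)) \<le> (\<Sum>i<N. q ^ i * q ^ (N - i))"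
      using assms q by (intro sum_mono mult_mono power_mono) auto
    also have "\<dots> = real N * q ^ N" by (simp flip: power_add)
    also have "q ^ N = sqrt q ^ N * sqrt q ^ N" using q by (simp flip: power_mult_distrib)
    also have "real N * (sqrt q ^ N * sqrt q ^ N) = (real N * sqrt q ^ N) * sqrt q ^ N" by simp
    also have "\<dots> \<le> C * sqrt q ^ N" using C[of N] q by (intro mult_right_mono) auto
    finally show ?thesis .
  qed
  moreover have "0 \<le> C" using C[of 0] by simp
  ultimately show ?thesis using q by (intro exI[of _ C] exI[of _ "sqrt q"]) auto
qed

lemma level_cov_summable:
  assumes H: "0 < H" "H < 1" and b: "b \<ge> 2" and r: "0 \<le> r" "r < 1"
  shows "\<exists>a. summable a \<and> (\<forall>N. (\<Sum>k<b^N. \<Sum>l<b^N. \<bar>level_cov H b r N k l\<bar>) / (real b ^ N)\<^sup>2 \<le> a N)"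
proof -
  let ?s = "real b powr (- min H (1 - H))"
  have "?s < real b powr 0" using b H by (intro powr_less_mono) auto
  then have s: "0 \<le> ?s" "?s < 1" using b by auto
  obtain C q where C: "0 \<le> C" "0 < q" "q < 1" "\<And>N. (\<Sum>i<N. r ^ i * ?s ^ (N - i)) \<le> C * q ^ N"
    using convolution_geometric_bound[OF r s] by blast
  have "summable (\<lambda>N. 2 * C\<^sup>2 * (q\<^sup>2) ^ N)"
    using C by (intro summable_mult summable_geometric) (auto simp: power_less_one_iff abs_square_less_1)
  moreover have "(\<Sum>k<b^N. \<Sum>l<b^N. \<bar>level_cov H b r N k l\<bar>) / (real b ^ N)\<^sup>2 \<le> 2 * C\<^sup>2 * (q\<^sup>2) ^ N" for N
  proof -
    have e: "2 * C\<^sup>2 * (q\<^sup>2) ^ N = 2 * (C * q ^ N)\<^sup>2"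
      by (simp add: power_mult_distrib power_mult[symmetric] mult.commute)
    have "(\<Sum>i<N. r ^ i * ?s ^ (N - i))\<^sup>2 \<le> (C * q ^ N)\<^sup>2"
      using C(4)[of N] r by (intro power_mono sum_nonneg) auto
    then show ?thesis
      using sum_abs_level_cov_le[OF H b r(1), of N] unfolding e by linarith
  qed
  ultimately show ?thesis by blast
qed

lemma weighted_sum_tendsto_zero:
  fixes g :: "nat \<Rightarrow> nat \<Rightarrow> real"
  assumes r: "0 \<le> r" "r < 1" and g: "\<And>N i. i < N \<Longrightarrow> \<bar>g N i\<bar> \<le> C" "\<And>i. (\<lambda>N. g N i) \<longlonglongrightarrow> 0"
  shows "(\<lambda>N. \<Sum>i<N. r ^ i * g N i) \<longlonglongrightarrow> 0"
proof -
  let ?a = "\<lambda>i N. if i < N then r ^ i * g N i else 0"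
  have "eventually (\<lambda>N. summable (\<lambda>i. norm (?a i N))) sequentially \<and> summable (\<lambda>i. norm (0::real))
    \<and> ((\<lambda>N. \<Sum>i. ?a i N) \<longlongrightarrow> (\<Sum>i. 0)) sequentially"
  proof (rule tannerys_theorem[where M = "\<lambda>i. r ^ i * \<bar>C\<bar>"])
    show "(\<lambda>N. ?a i N) \<longlonglongrightarrow> 0" for i
    proof -
      have "(\<lambda>N. r ^ i * g N i) \<longlonglongrightarrow> 0" using tendsto_mult_right_zero[OF g(2)] .
      moreover have "eventually (\<lambda>N. r ^ i * g N i = ?a i N) sequentially"
        using eventually_gt_at_top[of i] by eventually_elim simp
      ultimately show ?thesis by (rule Lim_transform_eventually)
    qed
    show "summable (\<lambda>i. r ^ i * \<bar>C\<bar>)" using r by (intro summable_mult2 summable_geometric) auto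
    have "norm (?a i N) \<le> r ^ i * \<bar>C\<bar>" for i N
      using r g(1)[of i N] by (auto simp: abs_mult intro!: mult_left_mono)
    then show "\<forall>\<^sub>F (i, N) in at_top \<times>\<^sub>F sequentially. norm (?a i N) \<le> r ^ i * \<bar>C\<bar>"
      by (intro always_eventually) auto
  qed simp
  moreover have "(\<Sum>i. ?a i N) = (\<Sum>i<N. r ^ i * g N i)" for N
    by (subst suminf_finite[of "{..<N}"]) auto
  ultimately show ?thesis by simp
qed

text \<open>The diagonal \<open>i = j\<close> gives the geometric series of
  \<open>r\<^sup>2\<close>, and the correlations between different levels vanish on average.
  Averaging over \<open>k\<close> is essential: at \<open>k = 0\<close>, say, the intervals of all
  levels share their left end point, and the correlations depend on the difference of the levels
  alone.\<close>

lemma average_level_variance: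
  assumes H: "0 < H" "H < 1" and b: "b \<ge> 2" and r: "0 \<le> r" "r < 1" and fbm: "is_fbm M H W"
  shows "(\<lambda>N. (\<Sum>k<b^N. \<bar>level_cov H b r N k k - 1 / (1 - r\<^sup>2)\<bar>) / real b ^ N) \<longlonglongrightarrow> 0"
proof -
  let ?g = "\<lambda>N i j k. \<bar>badic_ncov H b (N - i) (k mod b ^ (N - i)) (N - j) (k mod b ^ (N - j))\<bar>"
  define \<theta> where "\<theta> N i j = (if i = j then 0 else (\<Sum>k<b^N. ?g N i j k) / real b ^ N)" for N i j
  have \<theta>1: "\<bar>\<theta> N i j\<bar> \<le> 1" for N i j
  proof -
    have "(\<Sum>k<b^N. ?g N i j k) \<le> (\<Sum>k<b^N. 1)" by (intro sum_mono abs_badic_ncov_le_1[OF fbm b])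
    then show ?thesis using b by (auto simp: \<theta>_def abs_of_nonneg sum_nonneg divide_le_eq)
  qed
  have sym: "\<theta> N i j = \<theta> N j i" for N i j
    by (simp add: \<theta>_def badic_ncov_def badic_cov_sym[of H b "N - i"] add.commute)
  have lt: "(\<lambda>N. \<theta> N i j) \<longlonglongrightarrow> 0" if ij: "i < j" for i j
  proof -
    let ?d = "j - i"
    let ?f = "\<lambda>m. (\<Sum>k<b^(m+?d). real b powr (real (m + ?d + m) * H) * \<bar>badic_cov H b (m + ?d) k m (k mod b^m)\<bar>) / real b ^ (m + ?d)"
    have "?f \<longlonglongrightarrow> 0" using ij by (intro offdiagonal_cov_vanishes[OF H b]) auto
    \<comment> \<open>After the shift by \<open>j\<close> the two levels are
      \<open>N + (j - i)\<close> and \<open>N\<close>, the form treated by the off-diagonal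
      estimate.\<close>
    moreover have "\<theta> (N + j) i j = ?f N" for N
    proof -
      have e: "N + j - i = N + ?d" "N + j - j = N" "N + ?d \<le> N + j" "N + j - (N + ?d) = i" using ij by auto
      have mm: "k mod b ^ (N + ?d) mod b ^ N = k mod b ^ N" for k
        by (simp add: mod_mod_cancel le_imp_power_dvd)
      let ?h = "\<lambda>a. \<bar>badic_ncov H b (N + ?d) a N (a mod b ^ N)\<bar>"
      have "(\<Sum>k<b^(N + j). ?g (N + j) i j k) = (\<Sum>k<b^(N + j). ?h (k mod b ^ (N + ?d)))"
        unfolding e(1,2) mm ..
      also have "\<dots> = real b ^ i * (\<Sum>a<b^(N + ?d). ?h a)"
        using sum_mod_power[OF e(3), of b ?h] b unfolding e(4) by simp
      finally have "\<theta> (N + j) i j = real b ^ i * (\<Sum>a<b^(N + ?d). ?h a) / real b ^ (N + j)"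
        using ij by (simp add: \<theta>_def)
      moreover have "real b ^ (N + j) = real b ^ i * real b ^ (N + ?d)" using ij by (simp flip: power_add)
      ultimately have "\<theta> (N + j) i j = (\<Sum>a<b^(N + ?d). ?h a) / real b ^ (N + ?d)" using b by simp
      then show ?thesis by (simp add: badic_ncov_def abs_mult)
    qed
    ultimately have "(\<lambda>N. \<theta> (N + j) i j) \<longlonglongrightarrow> 0" by simp
    then show ?thesis by (rule LIMSEQ_offset)
  qed
  have \<theta>0: "(\<lambda>N. \<theta> N i j) \<longlonglongrightarrow> 0" for i j
  proof (cases i j rule: linorder_cases)
    case greater
    then show ?thesis unfolding sym[of _ i j] by (rule lt)
  next
    case equal
    then show ?thesis by (simp add: \<theta>_def)
  qed (rule lt)
  have "(\<lambda>N. \<Sum>i<N. r ^ i * (\<Sum>j<N. r ^ j * \<theta> N i j)) \<longlonglongrightarrow> 0"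
  proof (rule weighted_sum_tendsto_zero[OF r])
    show "(\<lambda>N. \<Sum>j<N. r ^ j * \<theta> N i j) \<longlonglongrightarrow> 0" for i
      by (rule weighted_sum_tendsto_zero[OF r \<theta>1 \<theta>0])
    show "\<bar>\<Sum>j<N. r ^ j * \<theta> N i j\<bar> \<le> 1 / (1 - r)" for N i
    proof -
      have "\<bar>\<Sum>j<N. r ^ j * \<theta> N i j\<bar> \<le> (\<Sum>j<N. r ^ j)"
        using r \<theta>1 by (intro order_trans[OF sum_abs] sum_mono) (simp add: abs_mult mult_left_le)
      also have "\<dots> \<le> (\<Sum>j. r ^ j)" using r by (intro sum_le_suminf summable_geometric) auto
      finally show ?thesis using r by (simp add: suminf_geometric)
    qed
  qed
  moreover have "(\<lambda>N. \<bar>(\<Sum>i<N. (r\<^sup>2) ^ i) - 1 / (1 - r\<^sup>2)\<bar>) \<longlonglongrightarrow> 0"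
  proof -
    have "norm (r\<^sup>2) < 1" using r by (simp add: abs_square_less_1 power_less_one_iff)
    from geometric_sums[OF this] have "(\<lambda>N. \<Sum>i<N. (r\<^sup>2) ^ i) \<longlonglongrightarrow> 1 / (1 - r\<^sup>2)"
      by (simp add: sums_def)
    then show ?thesis by (simp add: LIM_zero_iff tendsto_rabs_zero_iff)
  qed
  ultimately have lim: "(\<lambda>N. \<bar>(\<Sum>i<N. (r\<^sup>2) ^ i) - 1 / (1 - r\<^sup>2)\<bar> + (\<Sum>i<N. r ^ i * (\<Sum>j<N. r ^ j * \<theta> N i j))) \<longlonglongrightarrow> 0"
    using tendsto_add by fastforce
  show ?thesis
  proof (rule Lim_null_comparison[OF _ lim], rule always_eventually, rule allI)
    fix N
    let ?D = "\<bar>(\<Sum>i<N. (r\<^sup>2) ^ i) - 1 / (1 - r\<^sup>2)\<bar>"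
    have "\<bar>level_cov H b r N k k - 1 / (1 - r\<^sup>2)\<bar> \<le> ?D + (\<Sum>i<N. \<Sum>j<N. r ^ i * r ^ j * (if i = j then 0 else ?g N i j k))" for k
    proof -
      have "level_cov H b r N k k = (\<Sum>i<N. \<Sum>j<N. (if i = j then (r\<^sup>2) ^ i else 0) + r ^ i * r ^ j *
         (if i = j then 0 else badic_ncov H b (N - i) (k mod b ^ (N - i)) (N - j) (k mod b ^ (N - j))))"
        unfolding level_cov_def
        by (intro sum.cong refl) (auto simp: badic_ncov_diag[OF b] power2_eq_square power_mult_distrib)
      also have "\<dots> = (\<Sum>i<N. (r\<^sup>2) ^ i) + (\<Sum>i<N. \<Sum>j<N. r ^ i * r ^ j *
         (if i = j then 0 else badic_ncov H b (N - i) (k mod b ^ (N - i)) (N - j) (k mod b ^ (N - j))))" (is "_ = _ + ?E")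
        by (simp add: sum.distrib)
      finally have "\<bar>level_cov H b r N k k - 1 / (1 - r\<^sup>2)\<bar> \<le> ?D + \<bar>?E\<bar>" by linarith
      moreover have "\<bar>?E\<bar> \<le> (\<Sum>i<N. \<Sum>j<N. r ^ i * r ^ j * (if i = j then 0 else ?g N i j k))"
        using r by (intro order_trans[OF sum_abs] sum_mono) (auto simp: abs_mult)
      ultimately show ?thesis by linarith
    qed
    then have "(\<Sum>k<b^N. \<bar>level_cov H b r N k k - 1 / (1 - r\<^sup>2)\<bar>)
      \<le> (\<Sum>k<b^N. ?D + (\<Sum>i<N. \<Sum>j<N. r ^ i * r ^ j * (if i = j then 0 else ?g N i j k)))" by (intro sum_mono)
    also have "\<dots> = real b ^ N * ?D + (\<Sum>k<b^N. \<Sum>i<N. \<Sum>j<N. r ^ i * r ^ j * (if i = j then 0 else ?g N i j k))"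
      by (simp add: sum.distrib)
    also have "(\<Sum>k<b^N. \<Sum>i<N. \<Sum>j<N. r ^ i * r ^ j * (if i = j then 0 else ?g N i j k))
       = (\<Sum>i<N. \<Sum>j<N. \<Sum>k<b^N. r ^ i * r ^ j * (if i = j then 0 else ?g N i j k))"
      by (subst sum.swap) (intro sum.cong refl sum.swap)
    also have "\<dots> = (\<Sum>i<N. \<Sum>j<N. r ^ i * r ^ j * (real b ^ N * \<theta> N i j))"
      using b by (intro sum.cong refl) (auto simp: \<theta>_def simp flip: sum_distrib_left)
    also have "\<dots> = real b ^ N * (\<Sum>i<N. r ^ i * (\<Sum>j<N. r ^ j * \<theta> N i j))"
      by (simp add: sum_distrib_left mult_ac)
    finally have "(\<Sum>k<b^N. \<bar>level_cov H b r N k k - 1 / (1 - r\<^sup>2)\<bar>) / real b ^ N \<le> ?D + (\<Sum>i<N. r ^ i * (\<Sum>j<N. r ^ j * \<theta> N i j))"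
      using b by (simp add: divide_le_eq distrib_left mult.commute)
    then show "norm ((\<Sum>k<b^N. \<bar>level_cov H b r N k k - 1 / (1 - r\<^sup>2)\<bar>) / real b ^ N) \<le> ?D + (\<Sum>i<N. r ^ i * (\<Sum>j<N. r ^ j * \<theta> N i j))"
      by (simp add: abs_of_nonneg sum_nonneg)
  qed
qed

lemma level_cov_diag_le:
  assumes fbm: "is_fbm M H W" and b: "b \<ge> 2" and r: "0 \<le> r" "r < 1"
  shows "level_cov H b r N k k \<le> (1 / (1 - r))\<^sup>2"
proof -
  have "level_cov H b r N k k \<le> (\<Sum>i<N. \<Sum>j<N. r ^ i * r ^ j * 1)"
    unfolding level_cov_def using r abs_badic_ncov_le_1[OF fbm b]
    by (intro sum_mono mult_left_mono) (auto simp: abs_le_iff)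
  also have "\<dots> = (\<Sum>i<N. r ^ i)\<^sup>2" by (simp add: power2_eq_square sum_product)
  also have "\<dots> \<le> (1 / (1 - r))\<^sup>2"
  proof (rule power_mono)
    have "(\<Sum>j<N. r ^ j) \<le> (\<Sum>j. r ^ j)" using r by (intro sum_le_suminf summable_geometric) auto
    then show "(\<Sum>j<N. r ^ j) \<le> 1 / (1 - r)" using r by (simp add: suminf_geometric)
  qed (use r in \<open>auto intro: sum_nonneg\<close>)
  finally show ?thesis .
qed

section \<open>Almost sure limits for the normalised multilevel sums\<close>

lemma floor_ratio_tendsto:
  assumes "b \<ge> (2::nat)" "0 \<le> t"
  shows "(\<lambda>N. real (nat \<lfloor>t * real b ^ N\<rfloor>) / real b ^ N) \<longlonglongrightarrow> t"
proof -
  have "(\<lambda>N. 1 / real b ^ N) \<longlonglongrightarrow> 0"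
    using assms by (intro LIMSEQ_divide_realpow_zero) auto
  then have l: "(\<lambda>N. t - 1 / real b ^ N) \<longlonglongrightarrow> t - 0" by (intro tendsto_intros)
  show ?thesis
  proof (rule tendsto_sandwich[OF _ _ _ tendsto_const])
    show "(\<lambda>N. t - 1 / real b ^ N) \<longlonglongrightarrow> t" using l by simp
    have f: "t * real b ^ N - 1 \<le> real (nat \<lfloor>t * real b ^ N\<rfloor>)" "real (nat \<lfloor>t * real b ^ N\<rfloor>) \<le> t * real b ^ N" for N
    proof -
      have "0 \<le> \<lfloor>t * real b ^ N\<rfloor>" using assms by simp
      then have "real (nat \<lfloor>t * real b ^ N\<rfloor>) = of_int \<lfloor>t * real b ^ N\<rfloor>" by simp
      then show "t * real b ^ N - 1 \<le> real (nat \<lfloor>t * real b ^ N\<rfloor>)" "real (nat \<lfloor>t * real b ^ N\<rfloor>) \<le> t * real b ^ N" by linarith+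
    qed
    have b0: "real b ^ N > 0" for N using assms by simp
    show "\<forall>\<^sub>F N in sequentially. t - 1 / real b ^ N \<le> real (nat \<lfloor>t * real b ^ N\<rfloor>) / real b ^ N"
    proof (intro always_eventually allI)
      fix N
      show "t - 1 / real b ^ N \<le> real (nat \<lfloor>t * real b ^ N\<rfloor>) / real b ^ N"
        using f(1)[of N] assms by (subst pos_le_divide_eq[OF b0]) (simp add: left_diff_distrib)
    qed
    show "\<forall>\<^sub>F N in sequentially. real (nat \<lfloor>t * real b ^ N\<rfloor>) / real b ^ N \<le> t"
      using f(2) b0 by (intro always_eventually allI) (simp add: divide_le_eq)
  qed
qed

lemma nat_floor_le_power:
  assumes "0 \<le> t" "t \<le> 1"
  shows "nat \<lfloor>t * real b ^ N\<rfloor> \<le> b ^ N"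
proof -
  have "t * real b ^ N \<le> 1 * real b ^ N" using assms by (intro mult_right_mono) auto
  then have "\<lfloor>t * real b ^ N\<rfloor> \<le> int (b ^ N)" by (simp add: floor_le_iff)
  then show ?thesis by (simp only: nat_le_iff)
qed

text \<open>The fluctuation around the mean has summable second moments. The mean converges because
  \<open>exp (- x)\<close> is Lipschitz on nonnegative arguments and the variances approach
  \<open>1 / (1 - r\<^sup>2)\<close> on average.\<close>

lemma level_sum_char_AE:
  assumes H: "0 < H" "H < 1" and b: "b \<ge> 2" and r: "0 \<le> r" "r < 1" and fbm: "is_fbm M H W"
    and t: "0 \<le> t" "t \<le> 1"
  shows "AE \<omega> in M. (\<lambda>N. (\<Sum>k<nat \<lfloor>t * real b ^ N\<rfloor>. cis (u * level_sum H b r W N k \<omega>)) /\<^sub>R real b ^ N)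
     \<longlonglongrightarrow> complex_of_real (t * exp (- (u\<^sup>2 * (1 / (1 - r\<^sup>2))) / 2))"
proof -
  define L where "L N = nat \<lfloor>t * real b ^ N\<rfloor>" for N
  define m where "m N k = exp (- (u\<^sup>2 * level_cov H b r N k k) / 2)" for N k
  note g = level_sum_family[OF fbm, of b r]
  have L: "L N \<le> b ^ N" for N unfolding L_def by (rule nat_floor_le_power[OF t])
  have b0: "real b ^ N > 0" for N using b by simp
  obtain a where a: "summable a" "\<And>N. (\<Sum>k<b^N. \<Sum>l<b^N. \<bar>level_cov H b r N k l\<bar>) / (real b ^ N)\<^sup>2 \<le> a N"
    using level_cov_summable[OF H b r] by blast
  let ?D = "\<lambda>N \<omega>. (\<Sum>k<L N. cis (u * level_sum H b r W N k \<omega>) - complex_of_real (m N k)) / complex_of_real (real b ^ N)"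
  have AE: "AE \<omega> in M. (\<lambda>N. (cmod (?D N \<omega>))\<^sup>2) \<longlonglongrightarrow> 0"
  proof (rule AE_tendsto_zero_of_summable_integrals)
    show "integrable M (\<lambda>\<omega>. (cmod (?D N \<omega>))\<^sup>2)" for N
      unfolding m_def by (rule gaussian_family_empirical_char(1)[OF g b0])
    show "summable (\<lambda>N. u\<^sup>2 * a N)" by (intro summable_mult a)
    show "(\<integral>\<omega>. (cmod (?D N \<omega>))\<^sup>2 \<partial>M) \<le> u\<^sup>2 * a N" for N
    proof -
      have "(\<integral>\<omega>. (cmod (?D N \<omega>))\<^sup>2 \<partial>M) \<le> u\<^sup>2 * (\<Sum>k<L N. \<Sum>l<L N. \<bar>level_cov H b r N k l\<bar>) / (real b ^ N)\<^sup>2"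
        unfolding m_def by (rule gaussian_family_empirical_char(2)[OF g b0])
      also have "\<dots> \<le> u\<^sup>2 * (\<Sum>k<b^N. \<Sum>l<b^N. \<bar>level_cov H b r N k l\<bar>) / (real b ^ N)\<^sup>2"
      proof -
        \<comment> \<open>Absolute covariances allow the partial range to be enlarged to all
          indices, so one summable bound serves every \<open>t\<close>.\<close>
        have "(\<Sum>k<L N. \<Sum>l<L N. \<bar>level_cov H b r N k l\<bar>) \<le> (\<Sum>k<L N. \<Sum>l<b^N. \<bar>level_cov H b r N k l\<bar>)"
          using L[of N] by (intro sum_mono sum_mono2) auto
        also have "\<dots> \<le> (\<Sum>k<b^N. \<Sum>l<b^N. \<bar>level_cov H b r N k l\<bar>)"
          using L[of N] by (intro sum_mono2) (auto intro: sum_nonneg)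
        finally show ?thesis by (intro divide_right_mono mult_left_mono) auto
      qed
      also have "\<dots> \<le> u\<^sup>2 * a N" using mult_left_mono[OF a(2)[of N], of "u\<^sup>2"] by simp
      finally show ?thesis .
    qed
  qed simp
  let ?e = "exp (- (u\<^sup>2 * (1 / (1 - r\<^sup>2))) / 2)"
  have mean: "(\<lambda>N. (\<Sum>k<L N. m N k) / real b ^ N) \<longlonglongrightarrow> t * ?e"
  proof -
    have "(\<lambda>N. (\<Sum>k<L N. m N k) / real b ^ N - real (L N) / real b ^ N * ?e) \<longlonglongrightarrow> 0"
    proof (rule Lim_null_comparison)
      show "(\<lambda>N. u\<^sup>2 / 2 * ((\<Sum>k<b^N. \<bar>level_cov H b r N k k - 1 / (1 - r\<^sup>2)\<bar>) / real b ^ N)) \<longlonglongrightarrow> 0"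
        by (rule tendsto_mult_right_zero[OF average_level_variance[OF H b r fbm]])
      have "norm ((\<Sum>k<L N. m N k) / real b ^ N - real (L N) / real b ^ N * ?e)
        \<le> u\<^sup>2 / 2 * ((\<Sum>k<b^N. \<bar>level_cov H b r N k k - 1 / (1 - r\<^sup>2)\<bar>) / real b ^ N)" for N
      proof -
        have "(\<Sum>k<L N. m N k) - real (L N) * ?e = (\<Sum>k<L N. m N k - ?e)" by (simp add: sum_subtractf)
        also have "\<bar>\<dots>\<bar> \<le> (\<Sum>k<L N. u\<^sup>2 / 2 * \<bar>level_cov H b r N k k - 1 / (1 - r\<^sup>2)\<bar>)"
        proof (intro order_trans[OF sum_abs] sum_mono)
          fix k
          have "r\<^sup>2 \<le> 1" using r by (simp add: power_le_one)
          then have "0 \<le> u\<^sup>2 * level_cov H b r N k k / 2" "0 \<le> u\<^sup>2 * (1 / (1 - r\<^sup>2)) / 2"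
            using gaussian_family_single(2)[OF g, of N k] by auto
          from abs_exp_neg_diff_le[OF this] have "\<bar>m N k - ?e\<bar> \<le> \<bar>u\<^sup>2 * level_cov H b r N k k / 2 - u\<^sup>2 * (1 / (1 - r\<^sup>2)) / 2\<bar>"
            by (simp add: m_def)
          also have "\<dots> = u\<^sup>2 / 2 * \<bar>level_cov H b r N k k - 1 / (1 - r\<^sup>2)\<bar>"
          proof -
            have "u\<^sup>2 * level_cov H b r N k k / 2 - u\<^sup>2 * (1 / (1 - r\<^sup>2)) / 2 = u\<^sup>2 / 2 * (level_cov H b r N k k - 1 / (1 - r\<^sup>2))"
              by (simp add: right_diff_distrib)
            then show ?thesis by (simp only: abs_mult) simp
          qed
          finally show "\<bar>m N k - ?e\<bar> \<le> u\<^sup>2 / 2 * \<bar>level_cov H b r N k k - 1 / (1 - r\<^sup>2)\<bar>" .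
        qed
        also have "\<dots> \<le> (\<Sum>k<b^N. u\<^sup>2 / 2 * \<bar>level_cov H b r N k k - 1 / (1 - r\<^sup>2)\<bar>)"
          using L[of N] by (intro sum_mono2) auto
        also have "\<dots> = u\<^sup>2 / 2 * (\<Sum>k<b^N. \<bar>level_cov H b r N k k - 1 / (1 - r\<^sup>2)\<bar>)" by (simp only: sum_distrib_left)
        finally have *: "\<bar>(\<Sum>k<L N. m N k) - real (L N) * ?e\<bar> / real b ^ N
           \<le> u\<^sup>2 / 2 * (\<Sum>k<b^N. \<bar>level_cov H b r N k k - 1 / (1 - r\<^sup>2)\<bar>) / real b ^ N"
          using b0[of N] by (intro divide_right_mono) auto
        have "norm ((\<Sum>k<L N. m N k) / real b ^ N - real (L N) / real b ^ N * ?e) = \<bar>(\<Sum>k<L N. m N k) - real (L N) * ?e\<bar> / real b ^ N"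
          by (simp add: diff_divide_distrib[symmetric])
        then show ?thesis using * by (simp only: times_divide_eq_right)
      qed
      then show "\<forall>\<^sub>F N in sequentially. norm ((\<Sum>k<L N. m N k) / real b ^ N - real (L N) / real b ^ N * ?e)
        \<le> u\<^sup>2 / 2 * ((\<Sum>k<b^N. \<bar>level_cov H b r N k k - 1 / (1 - r\<^sup>2)\<bar>) / real b ^ N)" by (intro always_eventually allI)
    qed
    moreover have "(\<lambda>N. real (L N) / real b ^ N * ?e) \<longlonglongrightarrow> t * ?e"
      unfolding L_def by (intro tendsto_intros floor_ratio_tendsto b t)
    ultimately show ?thesis by (drule_tac tendsto_add) (assumption, simp)
  qed
  from AE show ?thesis
  proof eventually_elim
    case (elim \<omega>)
    have "(\<lambda>N. cmod (?D N \<omega>)) \<longlonglongrightarrow> 0"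
      using tendsto_real_sqrt[OF elim] by simp
    then have "(\<lambda>N. ?D N \<omega>) \<longlonglongrightarrow> 0" by (rule tendsto_norm_zero_cancel)
    from tendsto_add[OF this tendsto_of_real[OF mean]]
    have "(\<lambda>N. ?D N \<omega> + complex_of_real ((\<Sum>k<L N. m N k) / real b ^ N)) \<longlonglongrightarrow> complex_of_real (t * ?e)" by simp
    moreover have "?D N \<omega> + complex_of_real ((\<Sum>k<L N. m N k) / real b ^ N) = (\<Sum>k<L N. cis (u * level_sum H b r W N k \<omega>)) /\<^sub>R real b ^ N" for N
      using b0[of N] by (simp add: sum_subtractf scaleR_conv_of_real field_simps flip: of_real_power)
    ultimately show ?case unfolding L_def by simp
  qed
qed

lemma level_sum_cosh_AE:
  assumes H: "0 < H" "H < 1" and b: "b \<ge> 2" and r: "0 \<le> r" "r < 1" and fbm: "is_fbm M H W"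
  shows "AE \<omega> in M. \<exists>K. \<forall>N. (\<Sum>k<b^N. cosh (level_sum H b r W N k \<omega>)) / real b ^ N \<le> K"
proof -
  define w where "w = (1 / (1 - r))\<^sup>2"
  note g = level_sum_family[OF fbm, of b r]
  have b0: "real b ^ N > 0" for N using b by simp
  have w: "level_cov H b r N k k \<le> w" for N k unfolding w_def by (rule level_cov_diag_le[OF fbm b r])
  obtain a where a: "summable a" "\<And>N. (\<Sum>k<b^N. \<Sum>l<b^N. \<bar>level_cov H b r N k l\<bar>) / (real b ^ N)\<^sup>2 \<le> a N"
    using level_cov_summable[OF H b r] by blast
  let ?D = "\<lambda>N \<omega>. (\<Sum>k<b^N. cosh (level_sum H b r W N k \<omega>) - exp (level_cov H b r N k k / 2)) / real b ^ N"
  have "AE \<omega> in M. (\<lambda>N. (?D N \<omega>)\<^sup>2) \<longlonglongrightarrow> 0"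
  proof (rule AE_tendsto_zero_of_summable_integrals)
    show "integrable M (\<lambda>\<omega>. (?D N \<omega>)\<^sup>2)" for N
      by (rule gaussian_family_empirical_cosh(1)[OF g b0 w])
    show "summable (\<lambda>N. exp (2 * w) * a N)" by (intro summable_mult a)
    show "(\<integral>\<omega>. (?D N \<omega>)\<^sup>2 \<partial>M) \<le> exp (2 * w) * a N" for N
      using gaussian_family_empirical_cosh(2)[OF g[of N] b0[of N] w[of N], where L = "b^N"]
        mult_left_mono[OF a(2)[of N], of "exp (2 * w)"]
      unfolding times_divide_eq_right by (rule order_trans) simp
  qed simp
  then show ?thesis
  proof eventually_elim
    case (elim \<omega>)
    have "Bseq (\<lambda>N. (?D N \<omega>)\<^sup>2)" using elim by (intro convergent_imp_Bseq convergentI)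
    then obtain K where K: "\<And>N. norm ((?D N \<omega>)\<^sup>2) \<le> K" unfolding Bseq_def by blast
    have "(\<Sum>k<b^N. cosh (level_sum H b r W N k \<omega>)) / real b ^ N \<le> 1 + K + exp (w / 2)" for N
    proof -
      \<comment> \<open>Expanding the square, \<open>2 * x \<le> 1 + x\<^sup>2\<close> passes from a
        bound on the square of the fluctuation to one on the fluctuation.\<close>
      have "0 \<le> (?D N \<omega> - 1)\<^sup>2" by simp
      then have "2 * ?D N \<omega> \<le> 1 + (?D N \<omega>)\<^sup>2" by (simp only: power2_diff) simp
      moreover have "(?D N \<omega>)\<^sup>2 \<le> K" "0 \<le> (?D N \<omega>)\<^sup>2" using K[of N] by simp_all
      ultimately have "?D N \<omega> \<le> 1 + K" by linarith
      moreover have "(\<Sum>k<b^N. exp (level_cov H b r N k k / 2)) \<le> (\<Sum>k<b^N. exp (w / 2))"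
        using w by (intro sum_mono) auto
      then have "(\<Sum>k<b^N. exp (level_cov H b r N k k / 2)) / real b ^ N \<le> exp (w / 2)"
        using b0[of N] by (simp add: divide_le_eq mult.commute)
      ultimately show ?thesis by (simp add: sum_subtractf diff_divide_distrib)
    qed
    then show ?case by blast
  qed
qed

text \<open>The perturbed array and its error bound are quantified inside the almost sure statement,
  because they will depend on the path through \<open>W 1\<close>. The exceptional set is a
  countable union over rational times and frequencies.\<close>

lemma level_sum_moment_AE:
  assumes H: "0 < H" "H < 1" and b: "b \<ge> 2" and r: "0 \<le> r" "r < 1" and fbm: "is_fbm M H W"
    and p: "p > 0"
  shows "AE \<omega> in M. \<forall>t\<in>\<rat> \<inter> {0<..1}. \<forall>y \<epsilon>. \<epsilon> \<longlonglongrightarrow> 0 \<longrightarrow> (\<forall>N k. k < b^N \<longrightarrow> \<bar>y N k - level_sum H b r W N k \<omega>\<bar> \<le> \<epsilon> N) \<longrightarrow>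
    (\<lambda>N. (\<Sum>k<nat \<lfloor>t * real b ^ N\<rfloor>. \<bar>y N k\<bar> powr p) / real b ^ N)
     \<longlonglongrightarrow> (1 / (1 - r\<^sup>2)) powr (p / 2) * (2 powr (p/2) * Gamma ((p + 1) / 2) / sqrt pi) * t"
proof -
  have "AE \<omega> in M. \<forall>t\<in>\<rat> \<inter> {0<..1}. \<forall>u\<in>\<rat>. (\<lambda>N. (\<Sum>k<nat \<lfloor>t * real b ^ N\<rfloor>. cis (u * level_sum H b r W N k \<omega>)) /\<^sub>R real b ^ N)
     \<longlonglongrightarrow> complex_of_real (t * exp (- (u\<^sup>2 * (1 / (1 - r\<^sup>2))) / 2))"
    by (intro AE_ball_countable' level_sum_char_AE[OF H b r fbm] countable_rat countable_Int1) auto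
  with level_sum_cosh_AE[OF H b r fbm] show ?thesis
  proof (eventually_elim, intro ballI allI impI)
    fix \<omega> t y \<epsilon>
    assume "\<exists>K. \<forall>N. (\<Sum>k<b^N. cosh (level_sum H b r W N k \<omega>)) / real b ^ N \<le> K"
    then obtain K where K: "\<And>N. (\<Sum>k<b^N. cosh (level_sum H b r W N k \<omega>)) / real b ^ N \<le> K" by blast
    assume ch: "\<forall>t\<in>\<rat> \<inter> {0<..1}. \<forall>u\<in>\<rat>. (\<lambda>N. (\<Sum>k<nat \<lfloor>t * real b ^ N\<rfloor>. cis (u * level_sum H b r W N k \<omega>)) /\<^sub>R real b ^ N)
     \<longlonglongrightarrow> complex_of_real (t * exp (- (u\<^sup>2 * (1 / (1 - r\<^sup>2))) / 2))"
      and t: "t \<in> \<rat> \<inter> {0<..1::real}" and e: "\<epsilon> \<longlonglongrightarrow> 0" "\<forall>N k. k < b^N \<longrightarrow> \<bar>y N k - level_sum H b r W N k \<omega>\<bar> \<le> \<epsilon> N"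
    let ?L = "\<lambda>N. nat \<lfloor>t * real b ^ N\<rfloor>"
    have L: "?L N \<le> b ^ N" for N using t by (intro nat_floor_le_power) auto
    have r2: "r\<^sup>2 < 1" using r by (simp add: power_less_one_iff abs_square_less_1)
    define s where "s = sqrt (1 / (1 - r\<^sup>2))"
    have s: "s \<ge> 0" "s\<^sup>2 = 1 / (1 - r\<^sup>2)" using r2 by (auto simp: s_def)
    have sp: "s powr p = (1 / (1 - r\<^sup>2)) powr (p / 2)"
    proof -
      have "s = (1 / (1 - r\<^sup>2)) powr (1/2)" unfolding s_def using r2 by (intro powr_half_sqrt[symmetric]) auto
      then show ?thesis by (simp add: powr_powr)
    qed
    show "(\<lambda>N. (\<Sum>k<?L N. \<bar>y N k\<bar> powr p) / real b ^ N)
     \<longlonglongrightarrow> (1 / (1 - r\<^sup>2)) powr (p / 2) * (2 powr (p/2) * Gamma ((p + 1) / 2) / sqrt pi) * t"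
      unfolding sp[symmetric]
    proof (rule empirical_abs_moment_perturbed[where x = "\<lambda>N k. level_sum H b r W N k \<omega>" and K = K and \<epsilon> = \<epsilon>])
      show "0 < real b ^ N" for N using b by simp
      show "0 < t" using t by simp
      show "(\<lambda>N. real (?L N) / real b ^ N) \<longlonglongrightarrow> t" using t by (intro floor_ratio_tendsto b) auto
      show "(\<lambda>N. (\<Sum>k<?L N. cis (u * level_sum H b r W N k \<omega>)) /\<^sub>R real b ^ N) \<longlonglongrightarrow> complex_of_real (t * exp (- (u\<^sup>2 * s\<^sup>2) / 2))"
        if "u \<in> \<rat>" for u unfolding s(2) using ch t that by blast
      show "(\<Sum>k<?L N. cosh (level_sum H b r W N k \<omega>)) / real b ^ N \<le> K" for N
      proof -
        have "(\<Sum>k<?L N. cosh (level_sum H b r W N k \<omega>)) \<le> (\<Sum>k<b^N. cosh (level_sum H b r W N k \<omega>))"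
          using L[of N] by (intro sum_mono2) (auto simp: less_imp_le[OF cosh_real_pos])
        then have "(\<Sum>k<?L N. cosh (level_sum H b r W N k \<omega>)) / real b ^ N \<le> (\<Sum>k<b^N. cosh (level_sum H b r W N k \<omega>)) / real b ^ N"
          by (rule divide_right_mono) simp
        then show ?thesis using K[of N] by simp
      qed
      show "\<bar>y N k - level_sum H b r W N k \<omega>\<bar> \<le> \<epsilon> N" if "k < ?L N" for N k
        using e(2) L[of N] that by auto
    qed (use p s e in auto)
  qed
qed

text \<open>A Holder bound on the b-adic grid from exponential moments: the sum of
  \<open>cosh\<close> over a level has mean of order \<open>b ^ m\<close>, so divided by
  \<open>b ^ (2 * m)\<close> it tends to zero almost surely, and each single increment obeys the
  resulting bound.\<close>

lemma badic_incr_bound_AE: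
  assumes H: "0 < H" and b: "b \<ge> 2" and fbm: "is_fbm M H W" and h: "h < H"
  shows "AE \<omega> in M. \<exists>D. \<forall>m j. j < b^m \<longrightarrow> \<bar>W (real (j + 1) / real b ^ m) \<omega> - W (real j / real b ^ m) \<omega>\<bar> \<le> D * (real b powr (- h)) ^ m"
proof -
  define \<xi> where "\<xi> m j \<omega> = real b powr (real m * H) * (W (real (j + 1) / real b ^ m) \<omega> - W (real j / real b ^ m) \<omega>)" for m j \<omega>
  have g: "gaussian_family M (\<lambda>(m, j). \<xi> m j) (\<lambda>(m, a) (n, c). badic_ncov H b m a n c)"
    using badic_incr_family[OF fbm, of b] unfolding \<xi>_def[abs_def] by simp
  interpret prob_space M by (rule gaussian_familyD(1)[OF g])
  have b1: "real b > 1" using b by simp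
  have c: "has_bochner_integral M (\<lambda>\<omega>. cosh (\<xi> m j \<omega>)) (exp (1 / 2))" for m j
    using centred_gaussian_cosh[OF gaussian_familyD(2)[OF g, of "(m, j)"] gaussian_family_single(1)[OF g, of _ "(m, j)"]]
    by (simp add: badic_ncov_diag[OF b])
  have "AE \<omega> in M. (\<lambda>m. (\<Sum>j<b^m. cosh (\<xi> m j \<omega>)) / real b ^ (2 * m)) \<longlonglongrightarrow> 0"
  proof (rule AE_tendsto_zero_of_summable_integrals)
    have I: "has_bochner_integral M (\<lambda>\<omega>. (\<Sum>j<b^m. cosh (\<xi> m j \<omega>)) / real b ^ (2 * m)) ((\<Sum>j<b^m. exp (1 / 2)) / real b ^ (2 * m))" for m
      by (intro has_bochner_integral_divide_zero has_bochner_integral_sum c)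
    show "integrable M (\<lambda>\<omega>. (\<Sum>j<b^m. cosh (\<xi> m j \<omega>)) / real b ^ (2 * m))" for m
      using I[of m] by (simp add: has_bochner_integral_iff)
    have "(\<Sum>j<b^m. exp (1 / 2)) / real b ^ (2 * m) = exp (1 / 2) * (1 / real b) ^ m" for m
      using b1 by (simp add: power_mult power2_eq_square power_divide field_simps mult_2 power_add)
    then show "(\<integral>\<omega>. (\<Sum>j<b^m. cosh (\<xi> m j \<omega>)) / real b ^ (2 * m) \<partial>M) \<le> exp (1 / 2) * (1 / real b) ^ m" for m
      using I[of m] by (simp add: has_bochner_integral_iff)
    show "summable (\<lambda>m. exp (1 / 2) * (1 / real b) ^ m)"
      using b1 by (intro summable_mult summable_geometric) auto
    show "0 \<le> (\<Sum>j<b^m. cosh (\<xi> m j \<omega>)) / real b ^ (2 * m)" for m \<omega>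
      by (intro divide_nonneg_nonneg sum_nonneg) (auto simp: less_imp_le[OF cosh_real_pos])
  qed
  then show ?thesis
  proof eventually_elim
    case (elim \<omega>)
    have "Bseq (\<lambda>m. (\<Sum>j<b^m. cosh (\<xi> m j \<omega>)) / real b ^ (2 * m))" using elim by (intro convergent_imp_Bseq convergentI)
    then obtain K where K: "K > 0" "\<And>m. norm ((\<Sum>j<b^m. cosh (\<xi> m j \<omega>)) / real b ^ (2 * m)) \<le> K" unfolding Bseq_def by blast
    \<comment> \<open>Chosen so that the \<open>1 / q\<close>-th power of \<open>b ^ (2 * m)\<close>
      is \<open>b powr (m * (H - h))\<close>, exactly the loss allowed by the exponent
      \<open>h\<close>.\<close>
    define q where "q = 2 / (H - h)"
    have q: "q > 0" using h by (simp add: q_def)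
    obtain C where C: "C > 0" "\<And>x::real. \<bar>x\<bar> powr q \<le> C * cosh x" using cosh_ge_abs_powr[OF q] by blast
    have "\<bar>W (real (j + 1) / real b ^ m) \<omega> - W (real j / real b ^ m) \<omega>\<bar> \<le> (C * K) powr (1 / q) * (real b powr (- h)) ^ m" if j: "j < b^m" for m j
    proof -
      have "cosh (\<xi> m j \<omega>) \<le> (\<Sum>j<b^m. cosh (\<xi> m j \<omega>))"
        using j by (intro member_le_sum) (auto simp: less_imp_le[OF cosh_real_pos])
      also have "\<dots> \<le> K * real b ^ (2 * m)"
      proof -
        have "(\<Sum>j<b^m. cosh (\<xi> m j \<omega>)) / real b ^ (2 * m) \<le> K" using K(2)[of m] by (simp only: real_norm_def abs_le_iff)
        then show ?thesis using b1 by (simp add: divide_le_eq)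
      qed
      finally have "\<bar>\<xi> m j \<omega>\<bar> powr q \<le> C * (K * real b ^ (2 * m))"
        using C(2)[of "\<xi> m j \<omega>"] C(1) by (meson mult_left_mono less_imp_le order_trans)
      then have "(\<bar>\<xi> m j \<omega>\<bar> powr q) powr (1 / q) \<le> (C * K * real b ^ (2 * m)) powr (1 / q)"
        using q by (intro powr_mono2) (auto simp: mult_ac)
      then have "\<bar>\<xi> m j \<omega>\<bar> \<le> (C * K) powr (1 / q) * (real b ^ (2 * m)) powr (1 / q)"
        using q C(1) K(1) b1 by (simp add: powr_powr powr_mult)
      also have "(real b ^ (2 * m)) powr (1 / q) = real b powr (real m * (H - h))"
      proof -
        have "real b ^ (2 * m) = real b powr (2 * real m)" using b1 powr_realpow[of "real b" "2 * m"] by simp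
        then have "(real b ^ (2 * m)) powr (1 / q) = real b powr (2 * real m * (1 / q))" by (simp only: powr_powr)
        also have "2 * real m * (1 / q) = real m * (H - h)" using h by (simp add: q_def)
        finally show ?thesis .
      qed
      finally have x: "\<bar>\<xi> m j \<omega>\<bar> \<le> (C * K) powr (1 / q) * real b powr (real m * (H - h))" .
      let ?w = "\<bar>W (real (j + 1) / real b ^ m) \<omega> - W (real j / real b ^ m) \<omega>\<bar>"
      have "?w = real b powr (- (real m * H)) * \<bar>\<xi> m j \<omega>\<bar>"
        using b1 by (simp add: \<xi>_def abs_mult powr_minus)
      also have "\<dots> \<le> real b powr (- (real m * H)) * ((C * K) powr (1 / q) * real b powr (real m * (H - h)))"
        by (intro mult_left_mono x) auto
      also have "\<dots> = (C * K) powr (1 / q) * real b powr (- (real m * H) + real m * (H - h))"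
        by (simp only: powr_add mult_ac)
      also have "- (real m * H) + real m * (H - h) = - h * real m" by (simp add: algebra_simps)
      also have "real b powr (- h * real m) = (real b powr (- h)) ^ m"
        using b1 powr_realpow[of "real b powr (- h)" m] by (simp add: powr_powr)
      finally show ?thesis .
    qed
    then show ?case by blast
  qed
qed

section \<open>Weierstrass-type series at b-adic points\<close>

definition badic_incr :: "(real \<Rightarrow> real) \<Rightarrow> nat \<Rightarrow> nat \<Rightarrow> nat \<Rightarrow> real" where
  "badic_incr f b m j = f (real (j + 1) / real b ^ m) - f (real j / real b ^ m)"

definition weierstrass :: "real \<Rightarrow> nat \<Rightarrow> (real \<Rightarrow> real) \<Rightarrow> real \<Rightarrow> real" where
  "weierstrass \<alpha> b f t = (\<Sum>n. \<alpha> ^ n * f (frac (real b ^ n * t)))"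

lemma frac_of_nat_divide:
  assumes "q > 0"
  shows "frac (real k / real q) = real (k mod q) / real q"
proof -
  have "real k = real (k div q) * real q + real (k mod q)"
    by (metis div_mult_mod_eq of_nat_add of_nat_mult)
  then have "real k / real q - real (k mod q) / real q = real (k div q)"
    using assms by (simp add: field_simps)
  then show ?thesis using assms by (subst frac_unique_iff) auto
qed

text \<open>From term \<open>N\<close> on the argument \<open>b ^ n * k / b ^ N\<close> is an
  integer, its fractional part is 0, and \<open>f 0 = 0\<close> kills the term.\<close>

lemma weierstrass_badic:
  assumes b: "b \<ge> 2" and f0: "f 0 = 0"
  shows "weierstrass \<alpha> b f (real k / real b ^ N)
     = (\<Sum>i<N. \<alpha> ^ i * f (real (k mod b ^ (N - i)) / real b ^ (N - i)))"
proof -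
  have "\<alpha> ^ i * f (frac (real b ^ i * (real k / real b ^ N))) = 0" if "i \<notin> {..<N}" for i
  proof -
    have "real b ^ i = real b ^ (i - N) * real b ^ N" using that by (simp flip: power_add)
    then have "real b ^ i * (real k / real b ^ N) = real (b ^ (i - N) * k)" using b by simp
    then have "frac (real b ^ i * (real k / real b ^ N)) = 0" by (simp only: frac_eq_0_iff Ints_of_nat)
    then show ?thesis by (simp only: f0 mult_zero_right)
  qed
  then have "weierstrass \<alpha> b f (real k / real b ^ N) = (\<Sum>i<N. \<alpha> ^ i * f (frac (real b ^ i * (real k / real b ^ N))))"
    unfolding weierstrass_def by (intro suminf_finite) auto
  also have "\<dots> = (\<Sum>i<N. \<alpha> ^ i * f (real (k mod b ^ (N - i)) / real b ^ (N - i)))"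
  proof (intro sum.cong refl)
    fix i assume "i \<in> {..<N}"
    then have "real b ^ N = real b ^ i * real b ^ (N - i)" by (simp flip: power_add)
    then have "real b ^ i * (real k / real b ^ N) = real k / real (b ^ (N - i))" using b by simp
    then have "frac (real b ^ i * (real k / real b ^ N)) = real (k mod b ^ (N - i)) / real b ^ (N - i)"
      using frac_of_nat_divide[of "b ^ (N - i)" k] b by simp
    then show "\<alpha> ^ i * f (frac (real b ^ i * (real k / real b ^ N))) = \<alpha> ^ i * f (real (k mod b ^ (N - i)) / real b ^ (N - i))"
      by simp
  qed
  finally show ?thesis .
qed

lemma weierstrass_increment:
  assumes b: "b \<ge> 2" and f: "f 0 = 0" "f 1 = 0"
  shows "weierstrass \<alpha> b f (real (k + 1) / real b ^ N) - weierstrass \<alpha> b f (real k / real b ^ N)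
     = (\<Sum>i<N. \<alpha> ^ i * badic_incr f b (N - i) (k mod b ^ (N - i)))"
proof -
  \<comment> \<open>At the last interval of a period the right end point wraps around to 0; there
    \<open>f 0 = f 1\<close> allows it to be read as 1.\<close>
  have "f (real ((k + 1) mod q) / real q) = f (real (k mod q + 1) / real q)" if "q > 0" for q
    using that f by (cases "k mod q + 1 = q") (auto simp: mod_Suc)
  from this[of "b ^ m" for m]
  have "f (real ((k + 1) mod b ^ m) / real b ^ m) = f (real (k mod b ^ m + 1) / real b ^ m)" for m
    using b by (simp only: of_nat_power) simp
  then show ?thesis
    unfolding weierstrass_badic[of b f, OF b f(1)] badic_incr_def
    by (simp only: sum_subtractf[symmetric] right_diff_distrib)
qed

lemma pvar_sum_weierstrass:
  assumes "b \<ge> 2" "f 0 = 0" "f 1 = 0"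
  shows "pvar_sum (weierstrass \<alpha> b f) b p t N = (\<Sum>k<nat \<lfloor>t * real b ^ N\<rfloor>.
    \<bar>\<Sum>i<N. \<alpha> ^ i * badic_incr f b (N - i) (k mod b ^ (N - i))\<bar> powr p)"
  unfolding pvar_sum_def weierstrass_increment[OF assms] ..

lemma weierstrass_increment_bound:
  assumes b: "b \<ge> 2" and \<alpha>: "0 \<le> \<alpha>" and D: "\<And>m j. j < b^m \<Longrightarrow> \<bar>badic_incr f b m j\<bar> \<le> D * s ^ m"
  shows "\<bar>\<Sum>i<N. \<alpha> ^ i * badic_incr f b (N - i) (k mod b ^ (N - i))\<bar> \<le> D * (\<Sum>i<N. \<alpha> ^ i * s ^ (N - i))"
proof -
  have "\<bar>\<Sum>i<N. \<alpha> ^ i * badic_incr f b (N - i) (k mod b ^ (N - i))\<bar> \<le> (\<Sum>i<N. \<alpha> ^ i * (D * s ^ (N - i)))"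
  proof (intro order_trans[OF sum_abs] sum_mono)
    fix i
    have "\<bar>badic_incr f b (N - i) (k mod b ^ (N - i))\<bar> \<le> D * s ^ (N - i)"
      using b by (intro D) auto
    then show "\<bar>\<alpha> ^ i * badic_incr f b (N - i) (k mod b ^ (N - i))\<bar> \<le> \<alpha> ^ i * (D * s ^ (N - i))"
      using \<alpha> by (simp add: abs_mult mult_left_mono)
  qed
  then show ?thesis by (simp add: sum_distrib_left mult_ac)
qed

text \<open>Raising the exponent by \<open>d\<close> costs at most the factor
  \<open>\<epsilon> N powr d\<close>, which tends to zero. Starting from \<open>p\<close> this gives
  the limit 0; starting from \<open>q < p\<close> it forces the sum with exponent \<open>q\<close>
  to be unbounded, since the one with exponent \<open>p\<close> stays away from 0.\<close>

lemma powr_sums_other_exponents: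
  fixes g :: "nat \<Rightarrow> nat \<Rightarrow> real" and n :: "nat \<Rightarrow> nat"
  assumes g: "\<And>N k. 0 \<le> g N k" "\<And>N k. k < n N \<Longrightarrow> g N k \<le> \<epsilon> N" and e: "\<And>N. 0 \<le> \<epsilon> N" "\<epsilon> \<longlonglongrightarrow> 0"
    and V: "V > 0" "(\<lambda>N. \<Sum>k<n N. g N k powr p) \<longlonglongrightarrow> V"
  shows "q < p \<Longrightarrow> filterlim (\<lambda>N. \<Sum>k<n N. g N k powr q) at_top sequentially"
    and "q > p \<Longrightarrow> (\<lambda>N. \<Sum>k<n N. g N k powr q) \<longlonglongrightarrow> 0"
proof -
  have le: "(\<Sum>k<n N. g N k powr (x + d)) \<le> \<epsilon> N powr d * (\<Sum>k<n N. g N k powr x)" if "d > 0" for x d N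
  proof -
    have "(\<Sum>k<n N. g N k powr (x + d)) \<le> (\<Sum>k<n N. \<epsilon> N powr d * g N k powr x)"
    proof (rule sum_mono)
      fix k assume "k \<in> {..<n N}"
      then have "g N k powr d \<le> \<epsilon> N powr d" using g that by (intro powr_mono2) auto
      then show "g N k powr (x + d) \<le> \<epsilon> N powr d * g N k powr x"
        unfolding powr_add mult.commute[of "g N k powr x"] by (intro mult_right_mono) auto
    qed
    then show ?thesis by (simp add: sum_distrib_left)
  qed
  have e0: "(\<lambda>N. \<epsilon> N powr d) \<longlonglongrightarrow> 0" if "d > 0" for d
    using e that by (intro tendsto_zero_powrI[of _ _ _ d]) auto
  show "(\<lambda>N. \<Sum>k<n N. g N k powr q) \<longlonglongrightarrow> 0" if "q > p"
  proof (rule Lim_null_comparison)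
    show "(\<lambda>N. \<epsilon> N powr (q - p) * (\<Sum>k<n N. g N k powr p)) \<longlonglongrightarrow> 0"
      using tendsto_mult[OF e0[of "q - p"] V(2)] that by simp
    show "\<forall>\<^sub>F N in sequentially. norm (\<Sum>k<n N. g N k powr q) \<le> \<epsilon> N powr (q - p) * (\<Sum>k<n N. g N k powr p)"
      using le[of "q - p" _ p] that by (intro always_eventually) (simp add: sum_nonneg abs_of_nonneg)
  qed
  show "filterlim (\<lambda>N. \<Sum>k<n N. g N k powr q) at_top sequentially" if qp: "q < p"
    unfolding filterlim_at_top_gt[where c = 0]
  proof (intro allI impI)
    fix Z :: real assume Z: "Z > 0"
    have "eventually (\<lambda>N. \<epsilon> N powr (p - q) < V / (2 * Z)) sequentially"
      using e0[of "p - q"] qp V Z by (intro order_tendstoD) auto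
    moreover have "eventually (\<lambda>N. V / 2 < (\<Sum>k<n N. g N k powr p)) sequentially"
      using V by (intro order_tendstoD) auto
    ultimately show "eventually (\<lambda>N. Z \<le> (\<Sum>k<n N. g N k powr q)) sequentially"
    proof eventually_elim
      case (elim N)
      have "V / 2 < \<epsilon> N powr (p - q) * (\<Sum>k<n N. g N k powr q)"
        using elim le[of "p - q" N q] qp by simp
      also have "\<dots> \<le> V / (2 * Z) * (\<Sum>k<n N. g N k powr q)"
        using elim by (intro mult_right_mono) (auto intro: sum_nonneg)
      finally show ?case using V Z by (simp add: field_simps)
    qed
  qed
qed

text \<open>Complete periods match the mean exactly. The incomplete one and its share of the mean
  both lie between 0 and \<open>P * B\<close>.\<close>

lemma periodic_partial_sum:
  fixes g :: "nat \<Rightarrow> real"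
  assumes P: "P > 0" and g: "\<And>k. 0 \<le> g k" "\<And>k. g k \<le> B" "\<And>k. g k = g (k mod P)"
  shows "\<bar>(\<Sum>k<L. g k) - real L * ((\<Sum>k<P. g k) / real P)\<bar> \<le> real P * B"
proof -
  define A where "A = (\<Sum>k<P. g k) / real P"
  have S: "(\<Sum>k<P. g k) = real P * A" using P by (simp add: A_def)
  have "(\<Sum>k<P. g k) \<le> (\<Sum>k<P. B)" by (intro sum_mono g)
  then have A: "0 \<le> A" "A \<le> B" using P g by (auto simp: A_def divide_le_eq mult.commute intro!: divide_nonneg_nonneg sum_nonneg)
  have U: "{..<L} = {..<(L div P) * P} \<union> {(L div P) * P..<L}" by (auto simp: div_times_less_eq_dividend) (meson div_times_less_eq_dividend less_le_trans)
  have "(\<Sum>k<L. g k) = (\<Sum>k<(L div P) * P. g k) + (\<Sum>k\<in>{(L div P) * P..<L}. g k)"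
    by (subst U, rule sum.union_disjoint) auto
  also have "(\<Sum>k<(L div P) * P. g k) = real ((L div P) * P) * A"
  proof -
    have "(\<Sum>k<(L div P) * P. g k) = (\<Sum>c<L div P. \<Sum>a<P. g (c * P + a))" by (rule sum_lessThan_mult)
    also have "\<dots> = (\<Sum>c<L div P. \<Sum>a<P. g a)"
    proof (intro sum.cong refl)
      fix c a assume "a \<in> {..<P}"
      then have "(c * P + a) mod P = a" by simp
      then show "g (c * P + a) = g a" using g(3)[of "c * P + a"] by (simp only:)
    qed
    finally show ?thesis by (simp add: S)
  qed
  finally have e: "(\<Sum>k<L. g k) - real L * A = (\<Sum>k\<in>{(L div P) * P..<L}. g k) - real (L mod P) * A"
  proof -
    assume *: "(\<Sum>k<L. g k) = real (L div P * P) * A + sum g {L div P * P..<L}"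
    have "real L = real (L div P * P) + real (L mod P)" by (metis div_mult_mod_eq of_nat_add)
    then show ?thesis unfolding * by (simp only: distrib_right)
  qed
  have "(\<Sum>k\<in>{(L div P) * P..<L}. g k) \<le> (\<Sum>k\<in>{(L div P) * P..<L}. B)" by (intro sum_mono g)
  also have "\<dots> = real (L mod P) * B" by (simp add: minus_div_mult_eq_mod)
  also have "\<dots> \<le> real P * B" using P A less_imp_le[OF mod_less_divisor[OF P, of L]] by (intro mult_right_mono) auto
  finally have 1: "(\<Sum>k\<in>{(L div P) * P..<L}. g k) \<le> real P * B" .
  have "real (L mod P) * A \<le> real P * B" using P A less_imp_le[OF mod_less_divisor[OF P, of L]] by (intro mult_mono) auto
  moreover have "0 \<le> (\<Sum>k\<in>{(L div P) * P..<L}. g k)" by (intro sum_nonneg g)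
  moreover have "0 \<le> real (L mod P) * A" using A by simp
  ultimately show ?thesis using 1 e unfolding A_def[symmetric] by linarith
qed

text \<open>For fixed \<open>M\<close> the periodic function \<open>g M\<close> has partial averages
  tending to \<open>A M * t\<close>. The uniform Cauchy condition allows \<open>g N\<close> to be
  replaced by \<open>g M\<close> and makes \<open>A\<close> a Cauchy sequence, whose limit is
  \<open>V\<close>.\<close>

lemma periodic_average_limit:
  fixes g :: "nat \<Rightarrow> nat \<Rightarrow> real"
  assumes b: "b \<ge> 2" and g: "\<And>M k. 0 \<le> g M k" "\<And>M k. g M k \<le> B" "\<And>M k. g M k = g M (k mod b^M)"
    and c: "\<And>e. e > 0 \<Longrightarrow> \<exists>M. \<forall>N\<ge>M. \<forall>k. \<bar>g N k - g M k\<bar> \<le> e"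
  shows "\<exists>V. \<forall>t\<in>{0..1}. (\<lambda>N. (\<Sum>k<nat \<lfloor>t * real b ^ N\<rfloor>. g N k) / real b ^ N) \<longlonglongrightarrow> V * t"
proof -
  define A where "A M = (\<Sum>k<b^M. g M k) / real b ^ M" for M
  have b0: "real b ^ N > 0" for N using b by simp
  have A: "0 \<le> A M" "A M \<le> B" for M
  proof -
    have "(\<Sum>k<b^M. g M k) \<le> (\<Sum>k<b^M. B)" by (intro sum_mono g)
    then show "A M \<le> B" using b0[of M] by (simp add: A_def divide_le_eq mult.commute)
    show "0 \<le> A M" unfolding A_def by (intro divide_nonneg_nonneg sum_nonneg g) simp
  qed
  have AA: "\<bar>A N - A M\<bar> \<le> e" if N: "N \<ge> M" and e: "\<And>k. \<bar>g N k - g M k\<bar> \<le> e" for N M e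
  proof -
    have "(\<Sum>k<b^N. g M k) = (\<Sum>k<b^N. g M (k mod b^M))" by (intro sum.cong refl g(3))
    also have "\<dots> = real b ^ (N - M) * (\<Sum>k<b^M. g M k)" using N b by (intro sum_mod_power) auto
    also have "\<dots> = real b ^ N * A M"
    proof -
      have "real b ^ N = real b ^ (N - M) * real b ^ M" using N by (simp flip: power_add)
      then show ?thesis using b by (simp add: A_def)
    qed
    finally have "A N - A M = (\<Sum>k<b^N. g N k - g M k) / real b ^ N"
      using b by (simp add: A_def[of N] sum_subtractf diff_divide_distrib)
    also have "\<bar>\<dots>\<bar> = \<bar>\<Sum>k<b^N. g N k - g M k\<bar> / real b ^ N" using b0[of N] by simp
    also have "\<dots> \<le> (\<Sum>k<b^N. e) / real b ^ N"
      using e by (intro divide_right_mono order_trans[OF sum_abs] sum_mono) auto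
    finally show ?thesis using b by simp
  qed
  have "Cauchy A"
  proof (rule metric_CauchyI)
    fix e :: real assume e: "e > 0"
    then obtain M where M: "\<And>N k. N \<ge> M \<Longrightarrow> \<bar>g N k - g M k\<bar> \<le> e / 3" using c[of "e/3"] by auto
    have "dist (A m) (A n) < e" if "m \<ge> M" "n \<ge> M" for m n
      using AA[OF that(1) M[OF that(1)]] AA[OF that(2) M[OF that(2)]] e unfolding dist_real_def by linarith
    then show "\<exists>M. \<forall>m\<ge>M. \<forall>n\<ge>M. dist (A m) (A n) < e" by blast
  qed
  then obtain V where V: "A \<longlonglongrightarrow> V" using Cauchy_convergent convergent_def by blast
  have "(\<lambda>N. (\<Sum>k<nat \<lfloor>t * real b ^ N\<rfloor>. g N k) / real b ^ N) \<longlonglongrightarrow> V * t" if t: "t \<in> {0..1}" for t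
  proof (rule LIMSEQ_I)
    fix e :: real assume e: "e > 0"
    define L where "L N = nat \<lfloor>t * real b ^ N\<rfloor>" for N
    have Lt: "(\<lambda>N. real (L N) / real b ^ N) \<longlonglongrightarrow> t" unfolding L_def using t b by (intro floor_ratio_tendsto) auto
    have Lb: "L N \<le> b ^ N" for N unfolding L_def using t by (intro nat_floor_le_power) auto
    obtain M where M: "\<And>N k. N \<ge> M \<Longrightarrow> \<bar>g N k - g M k\<bar> \<le> e / 4" using c[of "e/4"] e by auto
    have AV: "\<bar>A M - V\<bar> \<le> e / 4"
    proof (rule tendsto_upperbound)
      show "(\<lambda>N. \<bar>A M - A N\<bar>) \<longlonglongrightarrow> \<bar>A M - V\<bar>" by (intro tendsto_intros V)
      show "\<forall>\<^sub>F N in sequentially. \<bar>A M - A N\<bar> \<le> e / 4"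
        using eventually_ge_at_top[of M] 
      proof eventually_elim
        case (elim N)
        show ?case using AA[OF elim M[OF elim]] by (simp only: abs_minus_commute)
      qed
    qed simp
    have "(\<lambda>N. real b ^ M * B / real b ^ N + \<bar>real (L N) / real b ^ N - t\<bar> * B) \<longlonglongrightarrow> 0 + \<bar>t - t\<bar> * B"
      using b by (intro tendsto_intros LIMSEQ_divide_realpow_zero Lt) auto
    then have "eventually (\<lambda>N. real b ^ M * B / real b ^ N + \<bar>real (L N) / real b ^ N - t\<bar> * B < e / 4) sequentially"
      using e by (intro order_tendstoD) auto
    then have "eventually (\<lambda>N. \<bar>(\<Sum>k<L N. g N k) / real b ^ N - V * t\<bar> < e) sequentially"
      using eventually_ge_at_top[of M]
    proof eventually_elim
      case (elim N)
      have "\<bar>(\<Sum>k<L N. g N k) - (\<Sum>k<L N. g M k)\<bar> \<le> (\<Sum>k<L N. e / 4)"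
        unfolding sum_subtractf[symmetric] using M elim by (intro order_trans[OF sum_abs] sum_mono) auto
      also have "\<dots> \<le> real b ^ N * (e / 4)"
      proof -
        have "real (L N) \<le> real b ^ N" using Lb[of N] by (metis of_nat_le_iff of_nat_power)
        then show ?thesis using e by (simp add: mult_right_mono)
      qed
      finally have 1: "\<bar>(\<Sum>k<L N. g N k) - (\<Sum>k<L N. g M k)\<bar> \<le> real b ^ N * (e / 4)" .
      have 2: "\<bar>(\<Sum>k<L N. g M k) - real (L N) * A M\<bar> \<le> real b ^ M * B"
        using periodic_partial_sum[of "b^M" "g M" B "L N"] b g by (simp add: A_def)
      have "\<bar>(\<Sum>k<L N. g N k) - real (L N) * A M\<bar> \<le> real b ^ N * (e / 4) + real b ^ M * B"
        using 1 2 by linarith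
      then have "\<bar>(\<Sum>k<L N. g N k) - real (L N) * A M\<bar> / real b ^ N \<le> (real b ^ N * (e / 4) + real b ^ M * B) / real b ^ N"
        by (rule divide_right_mono) simp
      also have "\<dots> = e / 4 + real b ^ M * B / real b ^ N" using b by (simp add: add_divide_distrib)
      also have "\<bar>(\<Sum>k<L N. g N k) - real (L N) * A M\<bar> / real b ^ N = \<bar>(\<Sum>k<L N. g N k) / real b ^ N - real (L N) / real b ^ N * A M\<bar>"
        by (simp add: diff_divide_distrib[symmetric])
      finally have 3: "\<bar>(\<Sum>k<L N. g N k) / real b ^ N - real (L N) / real b ^ N * A M\<bar> \<le> e / 4 + real b ^ M * B / real b ^ N" .
      have 4: "\<bar>(real (L N) / real b ^ N - t) * A M\<bar> \<le> \<bar>real (L N) / real b ^ N - t\<bar> * B"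
        unfolding abs_mult using A[of M] by (intro mult_left_mono) auto
      have 5: "\<bar>t * (A M - V)\<bar> \<le> 1 * (e / 4)"
        unfolding abs_mult using AV t by (intro mult_mono) auto
      have "(\<Sum>k<L N. g N k) / real b ^ N - V * t = ((\<Sum>k<L N. g N k) / real b ^ N - real (L N) / real b ^ N * A M)
         + (real (L N) / real b ^ N - t) * A M + t * (A M - V)" by (simp add: algebra_simps)
      moreover have "\<bar>u\<bar> < e" if "u = x + y + z" "\<bar>x\<bar> \<le> e / 4 + P" "\<bar>y\<bar> \<le> Q" "\<bar>z\<bar> \<le> 1 * (e / 4)" "P + Q < e / 4"
        for u x y z P Q :: real using that by linarith
      ultimately show ?case using 3 4 5 elim(1) by blast
    qed
    then show "\<exists>no. \<forall>N\<ge>no. norm ((\<Sum>k<nat \<lfloor>t * real b ^ N\<rfloor>. g N k) / real b ^ N - V * t) < e"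
      by (simp add: eventually_sequentially L_def)
  qed
  then show ?thesis by blast
qed

text \<open>With \<open>m = N - i\<close> the increment is \<open>\<alpha> ^ N * Z N k\<close>, and
  \<open>\<alpha> powr p = 1 / b\<close> turns \<open>(\<alpha> ^ N) powr p\<close> into the
  averaging weight \<open>1 / b ^ N\<close>. The condition \<open>s < \<alpha>\<close> makes
  \<open>Z N\<close> uniformly Cauchy with ratio \<open>s / \<alpha>\<close>.\<close>

lemma weierstrass_pvar_rough:
  fixes f :: "real \<Rightarrow> real"
  assumes b: "b \<ge> 2" and \<alpha>: "0 < \<alpha>" and f: "f 0 = 0" "f 1 = 0" and p: "p > 0" "\<alpha> powr p = 1 / real b"
    and D: "\<And>m j. j < b^m \<Longrightarrow> \<bar>badic_incr f b m j\<bar> \<le> D * s ^ m" and s: "0 \<le> s" "s < \<alpha>"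
  shows "\<exists>V. (\<forall>t\<in>{0..1}. (\<lambda>N. pvar_sum (weierstrass \<alpha> b f) b p t N) \<longlonglongrightarrow> V * t) 
     \<and> (\<not> (\<lambda>N. \<Sum>m\<in>{1..N}. badic_incr f b m 0 / \<alpha> ^ m) \<longlonglongrightarrow> 0 \<longrightarrow> V > 0)"
proof -
  define Z where "Z N k = (\<Sum>m\<in>{1..N}. badic_incr f b m (k mod b^m) / \<alpha> ^ m)" for N k
  define q where "q = s / \<alpha>"
  have q: "0 \<le> q" "q < 1" using s \<alpha> by (auto simp: q_def)
  have b0: "real b ^ N > 0" for N using b by simp
  have D0: "D \<ge> 0" using order_trans[OF abs_ge_zero D[of 0 0]] b by simp
  have trm: "\<bar>badic_incr f b m (k mod b^m) / \<alpha> ^ m\<bar> \<le> D * q ^ m" for m k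
  proof -
    have "\<bar>badic_incr f b m (k mod b^m)\<bar> \<le> D * s ^ m" using b by (intro D) auto
    then show ?thesis using \<alpha> by (simp add: q_def power_divide divide_right_mono)
  qed
  define R where "R = D / (1 - q)"
  have tail: "\<bar>Z N k - Z M k\<bar> \<le> R * q ^ M" if "M \<le> N" for M N k
  proof -
    have "Z N k = Z M k + (\<Sum>m\<in>{Suc M..N}. badic_incr f b m (k mod b^m) / \<alpha> ^ m)"
      unfolding Z_def using that by (subst sum.union_disjoint[symmetric]) (auto intro!: sum.cong)
    then have "\<bar>Z N k - Z M k\<bar> = \<bar>\<Sum>m\<in>{Suc M..N}. badic_incr f b m (k mod b^m) / \<alpha> ^ m\<bar>" by simp
    also have "\<dots> \<le> (\<Sum>m\<in>{Suc M..N}. D * q ^ m)"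
      by (intro order_trans[OF sum_abs] sum_mono trm)
    also have "\<dots> \<le> (\<Sum>m\<in>{M..<Suc N}. D * q ^ m)"
      using D0 q by (intro sum_mono2) auto
    also have "\<dots> = (\<Sum>m<Suc N - M. D * q ^ (m + M))"
      by (rule sum.reindex_bij_witness[where i = "\<lambda>m. m + M" and j = "\<lambda>m. m - M"]) auto
    also have "\<dots> = D * q ^ M * (\<Sum>m<Suc N - M. q ^ m)"
      by (simp only: power_add sum_distrib_left mult_ac)
    also have "\<dots> \<le> D * q ^ M * (1 / (1 - q))"
    proof (rule mult_left_mono)
      have "(\<Sum>j<Suc N - M. q ^ j) \<le> (\<Sum>j. q ^ j)" using q by (intro sum_le_suminf summable_geometric) auto
      then show "(\<Sum>j<Suc N - M. q ^ j) \<le> 1 / (1 - q)" using q by (simp add: suminf_geometric)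
    qed (use D0 q in auto)
    finally show ?thesis by (simp add: R_def)
  qed
  have Zb: "\<bar>Z N k\<bar> \<le> R" for N k using tail[of 0 N k] by (simp add: Z_def)
  have R0: "R \<ge> 0" using D0 q by (simp add: R_def)
  have qz: "(\<lambda>M. R * q ^ M) \<longlonglongrightarrow> 0" using q by (intro tendsto_mult_right_zero LIMSEQ_power_zero) auto
  let ?g = "\<lambda>N k. \<bar>Z N k\<bar> powr p"
  have Zper: "Z N k = Z N (k mod b^N)" for N k
    unfolding Z_def by (intro sum.cong refl) (auto simp: mod_mod_cancel le_imp_power_dvd)
  have uc: "uniformly_continuous_on {-R..R} (\<lambda>x. \<bar>x\<bar> powr p)"
    using p by (intro compact_uniformly_continuous continuous_on_powr' continuous_intros) auto
  have "\<exists>V. \<forall>t\<in>{0..1}. (\<lambda>N. (\<Sum>k<nat \<lfloor>t * real b ^ N\<rfloor>. ?g N k) / real b ^ N) \<longlonglongrightarrow> V * t"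
  proof (rule periodic_average_limit[OF b])
    show "?g M k \<le> R powr p" for M k using Zb p by (intro powr_mono2) auto
    show "?g M k = ?g M (k mod b^M)" for M k using Zper[of M k] by simp
    fix e :: real assume "e > 0"
    then obtain d where d: "d > 0" "\<And>x y. x \<in> {-R..R} \<Longrightarrow> y \<in> {-R..R} \<Longrightarrow> dist y x < d \<Longrightarrow> dist (\<bar>y\<bar> powr p) (\<bar>x\<bar> powr p) < e"
      using uc unfolding uniformly_continuous_on_def by metis
    obtain M where M: "R * q ^ M < d"
      using order_tendstoD(2)[OF qz d(1)] by (auto dest: eventually_happens)
    have "\<bar>?g N k - ?g M k\<bar> \<le> e" if "N \<ge> M" for N k
      using d(2)[of "Z M k" "Z N k"] Zb[of N k] Zb[of M k] tail[OF that, of k] M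
      by (auto simp: dist_real_def abs_le_iff)
    then show "\<exists>M. \<forall>N\<ge>M. \<forall>k. \<bar>?g N k - ?g M k\<bar> \<le> e" by blast
  qed simp
  then obtain V where V: "\<And>t. t \<in> {0..1} \<Longrightarrow> (\<lambda>N. (\<Sum>k<nat \<lfloor>t * real b ^ N\<rfloor>. ?g N k) / real b ^ N) \<longlonglongrightarrow> V * t"
    by blast
  have pv: "pvar_sum (weierstrass \<alpha> b f) b p t N = (\<Sum>k<nat \<lfloor>t * real b ^ N\<rfloor>. ?g N k) / real b ^ N" for t N
  proof -
    have "(\<Sum>i<N. \<alpha> ^ i * badic_incr f b (N - i) (k mod b ^ (N - i))) = \<alpha> ^ N * Z N k" for k
    proof -
      have "\<alpha> ^ N * Z N k = (\<Sum>m\<in>{1..N}. \<alpha> ^ (N - m) * badic_incr f b m (k mod b^m))"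
        unfolding Z_def sum_distrib_left using \<alpha>
        by (intro sum.cong refl) (auto simp: power_diff)
      also have "\<dots> = (\<Sum>i<N. \<alpha> ^ i * badic_incr f b (N - i) (k mod b ^ (N - i)))"
        by (rule sum.reindex_bij_witness[where i = "\<lambda>i. N - i" and j = "\<lambda>m. N - m"]) auto
      finally show ?thesis by simp
    qed
    moreover have "(\<alpha> ^ N) powr p = 1 / real b ^ N"
    proof -
      have "(\<alpha> ^ N) powr p = \<alpha> powr (real N * p)" using \<alpha> by (simp add: powr_powr flip: powr_realpow)
      also have "\<dots> = (\<alpha> powr p) powr real N" by (simp add: powr_powr mult.commute)
      also have "\<dots> = 1 / real b ^ N" using b by (simp add: p powr_divide powr_realpow)
      finally show ?thesis .
    qed
    ultimately show ?thesis
      using \<alpha> unfolding pvar_sum_weierstrass[of b f, OF b f]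
      by (simp add: abs_mult powr_mult sum_divide_distrib)
  qed
  have "V > 0" if nz: "\<not> (\<lambda>N. \<Sum>m\<in>{1..N}. badic_incr f b m 0 / \<alpha> ^ m) \<longlonglongrightarrow> 0"
  proof -
    have "Cauchy (\<lambda>N. Z N 0)"
    proof (rule metric_CauchyI)
      fix e :: real assume "e > 0"
      then obtain M where M: "R * q ^ M < e / 2"
        using order_tendstoD(2)[OF qz, of "e/2"] by (auto dest: eventually_happens)
      have "dist (Z m 0) (Z n 0) < e" if "m \<ge> M" "n \<ge> M" for m n
        using tail[OF that(1), of 0] tail[OF that(2), of 0] M unfolding dist_real_def by linarith
      then show "\<exists>M. \<forall>m\<ge>M. \<forall>n\<ge>M. dist (Z m 0) (Z n 0) < e" by blast
    qed
    then obtain G where Z0: "(\<lambda>N. Z N 0) \<longlonglongrightarrow> G" using Cauchy_convergent convergent_def by blast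
    have G0: "G \<noteq> 0" using Z0 nz unfolding Z_def by auto
    have "(\<lambda>M. R * q ^ M) \<longlonglongrightarrow> 0" by (rule qz)
    then have "eventually (\<lambda>M. R * q ^ M < \<bar>G\<bar> / 4) sequentially" using G0 by (intro order_tendstoD) auto
    then obtain M where M: "R * q ^ M < \<bar>G\<bar> / 4" by (auto dest: eventually_happens)
    have GM: "\<bar>G - Z M 0\<bar> \<le> R * q ^ M"
    proof (rule tendsto_upperbound)
      show "(\<lambda>N. \<bar>Z N 0 - Z M 0\<bar>) \<longlonglongrightarrow> \<bar>G - Z M 0\<bar>" by (intro tendsto_intros Z0)
      show "\<forall>\<^sub>F N in sequentially. \<bar>Z N 0 - Z M 0\<bar> \<le> R * q ^ M"
        using eventually_ge_at_top[of M] by eventually_elim (rule tail)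
    qed simp
    \<comment> \<open>Multiples of \<open>b ^ M\<close> agree with the index 0 on all levels up to
      \<open>M\<close>, so \<open>Z N\<close> stays near \<open>G\<close> there. They have density
      \<open>1 / b ^ M\<close>, which yields the lower bound \<open>\<delta>\<close>.\<close>
    have low: "\<bar>Z N (c * b^M)\<bar> \<ge> \<bar>G\<bar> / 2" if "N \<ge> M" for N c
    proof -
      have "Z M (c * b^M) = Z M 0" using Zper[of M "c * b^M"] by simp
      then show ?thesis using tail[OF that, of "c * b^M"] GM M by linarith
    qed
    define \<delta> where "\<delta> = (\<bar>G\<bar> / 2) powr p / real b ^ M"
    have \<delta>: "\<delta> > 0" using G0 b0[of M] by (simp add: \<delta>_def)
    have "\<delta> \<le> V * 1"
    proof (rule tendsto_lowerbound[OF V])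
      show "\<forall>\<^sub>F N in sequentially. \<delta> \<le> (\<Sum>k<nat \<lfloor>1 * real b ^ N\<rfloor>. ?g N k) / real b ^ N"
        using eventually_ge_at_top[of M]
      proof eventually_elim
        case (elim N)
        have e: "b ^ N = b ^ (N - M) * b ^ M" using elim by (simp flip: power_add)
        have fl: "nat \<lfloor>1 * real b ^ N\<rfloor> = b ^ N"
          by (simp flip: of_nat_power)
        have "real b ^ (N - M) * (\<bar>G\<bar> / 2) powr p = (\<Sum>c<b^(N - M). (\<bar>G\<bar> / 2) powr p)" by simp
        also have "\<dots> \<le> (\<Sum>c<b^(N - M). \<Sum>a<b^M. ?g N (c * b^M + a))"
        proof (rule sum_mono)
          fix c
          have "(\<bar>G\<bar> / 2) powr p \<le> ?g N (c * b^M + 0)"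
            using low[OF elim, of c] p by (intro powr_mono2) auto
          also have "\<dots> \<le> (\<Sum>a<b^M. ?g N (c * b^M + a))"
            using b by (intro member_le_sum[where i = 0]) auto
          finally show "(\<bar>G\<bar> / 2) powr p \<le> (\<Sum>a<b^M. ?g N (c * b^M + a))" .
        qed
        also have "\<dots> = (\<Sum>k<b^N. ?g N k)" unfolding e by (rule sum_lessThan_mult[symmetric])
        finally have "real b ^ (N - M) * (\<bar>G\<bar> / 2) powr p / real b ^ N \<le> (\<Sum>k<b^N. ?g N k) / real b ^ N"
          by (rule divide_right_mono) simp
        moreover have "real b ^ (N - M) * (\<bar>G\<bar> / 2) powr p / real b ^ N = \<delta>"
        proof -
          have "real b ^ N = real b ^ (N - M) * real b ^ M" using elim by (simp flip: power_add)
          then show ?thesis using b by (simp add: \<delta>_def)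
        qed
        ultimately show ?case unfolding fl by simp
      qed
    qed auto
    then show ?thesis using \<delta> by simp
  qed
  then show ?thesis using V unfolding pv by blast
qed

text \<open>The sums increase with \<open>t\<close> and the limit is continuous in \<open>t\<close>,
  so rational times on both sides squeeze the others.\<close>

lemma counting_sum_all_times:
  fixes g :: "nat \<Rightarrow> nat \<Rightarrow> real"
  assumes b: "b \<ge> (2::nat)" and g: "\<And>N k. 0 \<le> g N k"
    and q: "\<And>t. t \<in> \<rat> \<inter> {0<..1} \<Longrightarrow> (\<lambda>N. \<Sum>k<nat \<lfloor>t * real b ^ N\<rfloor>. g N k) \<longlonglongrightarrow> c * t"
    and t: "t \<in> {0..1}"
  shows "(\<lambda>N. \<Sum>k<nat \<lfloor>t * real b ^ N\<rfloor>. g N k) \<longlonglongrightarrow> c * t"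
proof -
  let ?S = "\<lambda>t N. \<Sum>k<nat \<lfloor>t * real b ^ N\<rfloor>. g N k"
  have mono: "?S x N \<le> ?S y N" if "x \<le> y" for x y N
  proof -
    have "nat \<lfloor>x * real b ^ N\<rfloor> \<le> nat \<lfloor>y * real b ^ N\<rfloor>"
      using that by (intro nat_mono floor_mono mult_right_mono) auto
    then show ?thesis using g by (intro sum_mono2) auto
  qed
  consider "t = 0" | "t = 1" | "0 < t" "t < 1" using t by force
  then show ?thesis
  proof cases
    case 1 then show ?thesis by simp
  next
    case 2 then show ?thesis using q[of 1] by simp
  next
    case 3
    have c0: "0 \<le> c" using tendsto_lowerbound[OF q[of 1], of 0] g by (simp add: sum_nonneg)
    show ?thesis
    proof (rule LIMSEQ_I)
      fix e :: real assume e: "e > 0"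
      define d where "d = e / (2 * (c + 1))"
      have "c * d \<le> (c + 1) * d" using e c0 by (intro mult_right_mono) (auto simp: d_def)
      moreover have "(c + 1) * d = e / 2" using c0 by (simp add: d_def field_simps)
      ultimately have d: "d > 0" "c * d < e" using e c0 by (auto simp: d_def)
      obtain x where x: "x \<in> \<rat>" "max 0 (t - d) < x" "x < t" using Rats_dense_in_real[of "max 0 (t - d)" t] 3 d by auto
      obtain y where y: "y \<in> \<rat>" "t < y" "y < min 1 (t + d)" using Rats_dense_in_real[of t "min 1 (t + d)"] 3 d by auto
      have "c * (t - x) \<le> c * d" "c * (y - t) \<le> c * d" using x y c0 by (auto intro!: mult_left_mono)
      then have cx: "c * t - e < c * x" and cy: "c * y < c * t + e" using d(2) by (simp_all add: algebra_simps)
      have "eventually (\<lambda>N. c * t - e < ?S x N) sequentially"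
        using cx x 3 by (intro order_tendstoD(1)[OF q]) auto
      moreover have "eventually (\<lambda>N. ?S y N < c * t + e) sequentially"
        using cy y 3 by (intro order_tendstoD(2)[OF q]) auto
      ultimately have "eventually (\<lambda>N. \<bar>?S t N - c * t\<bar> < e) sequentially"
      proof eventually_elim
        case (elim N)
        then show ?case using mono[of x t N] mono[of t y N] x y by linarith
      qed
      then show "\<exists>no. \<forall>N\<ge>no. norm (?S t N - c * t) < e" by (simp add: eventually_sequentially)
    qed
  qed
qed

section \<open>Nondegeneracy of the leading functional\<close>

lemma second_difference_powr_le:
  fixes a A B :: real
  assumes A: "0 < A"
  shows "\<exists>C\<ge>0. \<forall>y\<in>{A..B}. \<forall>h. 0 < h \<and> h \<le> A / 2 \<longrightarrow> \<bar>(y + h) powr a + (y - h) powr a - 2 * y powr a\<bar> \<le> C * h\<^sup>2"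
proof -
  \<comment> \<open>The intermediate point stays between \<open>A / 2\<close> and
    \<open>B + A / 2\<close>; adding the values at both ends covers an increasing as well as a
    decreasing power.\<close>
  let ?m = "(A / 2) powr (a - 2) + (B + A / 2) powr (a - 2)"
  have "\<bar>(y + h) powr a + (y - h) powr a - 2 * y powr a\<bar> \<le> (2 * \<bar>a * (a - 1)\<bar> * ?m) * h\<^sup>2"
    if y: "y \<in> {A..B}" and h: "0 < h" "h \<le> A / 2" for y h
  proof -
    obtain z where z: "y - h < z" "z < y + h" and
      le: "\<bar>(y + h) powr a + (y - h) powr a - 2 * y powr a\<bar> \<le> 2 * h\<^sup>2 * \<bar>a * (a - 1)\<bar> * z powr (a - 2)"
      using second_difference_powr[of h y a] y h A by auto
    have z': "A / 2 \<le> z" "z \<le> B + A / 2" using z y h by auto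
    have "z powr (a - 2) \<le> ?m"
    proof (cases "a \<ge> 2")
      case True
      then have "z powr (a - 2) \<le> (B + A / 2) powr (a - 2)" using z' A by (intro powr_mono2) auto
      then show ?thesis by (smt (verit) powr_ge_zero)
    next
      case False
      then have "z powr (a - 2) \<le> (A / 2) powr (a - 2)" using z' A by (intro powr_mono2') auto
      then show ?thesis by (smt (verit) powr_ge_zero)
    qed
    then have "2 * h\<^sup>2 * \<bar>a * (a - 1)\<bar> * z powr (a - 2) \<le> 2 * h\<^sup>2 * \<bar>a * (a - 1)\<bar> * ?m"
      by (intro mult_left_mono) auto
    with le show ?thesis by (simp add: mult_ac)
  qed
  moreover have "0 \<le> 2 * \<bar>a * (a - 1)\<bar> * ?m" by (intro mult_nonneg_nonneg add_nonneg_nonneg) auto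
  ultimately show ?thesis by blast
qed

text \<open>The derivative in \<open>y\<close> of the second difference is \<open>a\<close> times
  the second difference of the power \<open>a - 1\<close>, again of order \<open>h\<^sup>2\<close>
  away from 0.\<close>

lemma second_difference_powr_Lipschitz:
  fixes a A B :: real
  assumes A: "0 < A"
  shows "\<exists>C\<ge>0. \<forall>y\<in>{A..B}. \<forall>z\<in>{A..B}. \<forall>h. 0 < h \<and> h \<le> A / 2 \<and> z < y \<longrightarrow>
     \<bar>((y + h) powr a + (y - h) powr a - 2 * y powr a) - ((z + h) powr a + (z - h) powr a - 2 * z powr a)\<bar> \<le> C * h\<^sup>2 * (y - z)"
proof -
  obtain C where C: "C \<ge> 0" "\<And>y h. y \<in> {A..B} \<Longrightarrow> 0 < h \<Longrightarrow> h \<le> A / 2 \<Longrightarrow>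
      \<bar>(y + h) powr (a - 1) + (y - h) powr (a - 1) - 2 * y powr (a - 1)\<bar> \<le> C * h\<^sup>2"
    using second_difference_powr_le[OF A, of B "a - 1"] by blast
  have "\<bar>((y + h) powr a + (y - h) powr a - 2 * y powr a) - ((z + h) powr a + (z - h) powr a - 2 * z powr a)\<bar> \<le> \<bar>a\<bar> * C * h\<^sup>2 * (y - z)"
    if yz: "y \<in> {A..B}" "z \<in> {A..B}" "z < y" and h: "0 < h" "h \<le> A / 2" for y z h
  proof -
    let ?f = "\<lambda>w. (w + h) powr a + (w - h) powr a - 2 * w powr a"
    let ?f' = "\<lambda>w. a * ((w + h) powr (a - 1) + (w - h) powr (a - 1) - 2 * w powr (a - 1))"
    have "\<exists>w>z. w < y \<and> ?f y - ?f z = (y - z) * ?f' w"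
      using yz h A by (intro MVT2) (auto intro!: derivative_eq_intros simp: algebra_simps)
    then obtain w where w: "z < w" "w < y" "?f y - ?f z = (y - z) * ?f' w" by blast
    have "\<bar>?f' w\<bar> \<le> \<bar>a\<bar> * (C * h\<^sup>2)"
      unfolding abs_mult using C(2)[of w h] w yz h by (intro mult_left_mono) auto
    then have "\<bar>?f y - ?f z\<bar> \<le> (y - z) * (\<bar>a\<bar> * (C * h\<^sup>2))"
      unfolding w(3) abs_mult using yz by (simp add: mult_left_mono)
    then show ?thesis by (simp add: mult_ac)
  qed
  moreover have "0 \<le> \<bar>a\<bar> * C" using C by simp
  ultimately show ?thesis by blast
qed

definition cusp_cov :: "real \<Rightarrow> real \<Rightarrow> real \<Rightarrow> real \<Rightarrow> real" where
  "cusp_cov H y h x = fbm_incr_cov H 0 x y (y + h) - fbm_incr_cov H 0 x (y - h) y"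

text \<open>Covariance of \<open>W x\<close> with the second difference of \<open>W\<close> at \<open>1 / b\<close> with step \<open>h\<close>: only \<open>x = 1 / b\<close>
  sees the cusp of \<open>\<bar>_\<bar> powr (2 * H)\<close> at the origin, of order \<open>h powr (2 * H)\<close>; all other contributions are
  of order \<open>h\<^sup>2\<close>.\<close>
lemma cusp_cov_bounds:
  assumes H: "0 < H" and b: "b \<ge> (2::nat)"
  shows "\<exists>C h0. 0 \<le> C \<and> 0 < h0 \<and> h0 < 1 / real b \<and> (\<forall>h. 0 < h \<and> h \<le> h0 \<longrightarrow>
      \<bar>cusp_cov H (1 / real b) h 1\<bar> \<le> C * h\<^sup>2 \<and>
      \<bar>cusp_cov H (1 / real b) h (1 / real b) + h powr (2 * H)\<bar> \<le> C * h\<^sup>2 \<and>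
      (\<forall>m\<ge>2. \<bar>cusp_cov H (1 / real b) h (1 / real b ^ m)\<bar> \<le> C * h\<^sup>2 / real b ^ m))"
proof -
  define y where "y = 1 / real b"
  \<comment> \<open>Distance from \<open>1 / b\<close> to the nearest later point
    \<open>1 / b\<^sup>2\<close>. It is also at most \<open>y\<close> and \<open>1 - y\<close>, so
    all distances that avoid the cusp lie in \<open>{A..1}\<close>.\<close>
  define A where "A = y - y\<^sup>2"
  have y: "0 < y" "y \<le> 1 / 2" using b by (auto simp: y_def field_simps)
  have y2: "y\<^sup>2 \<le> y / 2" using y by (simp add: power2_eq_square)
  have "A \<le> y" "0 < A" using y y2 by (auto simp: A_def)
  then have A: "0 < A" "A \<le> y" "A \<le> 1 - y" "y \<le> 1" using y by auto
  let ?\<phi> = "\<lambda>w. \<bar>w\<bar> powr (2*H)"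
  let ?D = "\<lambda>h w. (w + h) powr (2*H) + (w - h) powr (2*H) - 2 * w powr (2*H)"
  obtain C1 where C1: "C1 \<ge> 0" "\<And>w h. w \<in> {A..1} \<Longrightarrow> 0 < h \<Longrightarrow> h \<le> A / 2 \<Longrightarrow> \<bar>?D h w\<bar> \<le> C1 * h\<^sup>2"
    using second_difference_powr_le[OF A(1), of 1 "2*H"] by blast
  obtain C2 where C2: "C2 \<ge> 0" "\<And>v w h. v \<in> {A..1} \<Longrightarrow> w \<in> {A..1} \<Longrightarrow> 0 < h \<Longrightarrow> h \<le> A / 2 \<Longrightarrow> w < v \<Longrightarrow>
      \<bar>?D h v - ?D h w\<bar> \<le> C2 * h\<^sup>2 * (v - w)"
    using second_difference_powr_Lipschitz[OF A(1), of 1 "2*H"] by blast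
  \<comment> \<open>Half the difference of the second differences of the even power at
    \<open>y\<close> and at \<open>x - y\<close>; for \<open>x = y\<close> the latter is centred at
    the cusp and equals \<open>2 * h powr (2 * H)\<close>.\<close>
  have cov: "cusp_cov H y h x = (?\<phi> (y + h) + ?\<phi> (y - h) - 2 * ?\<phi> y - (?\<phi> (x - y + h) + ?\<phi> (x - y - h) - 2 * ?\<phi> (x - y))) / 2" for h x
  proof -
    have "\<bar>0 - (y + h)\<bar> = \<bar>y + h\<bar>" "\<bar>0 - (y - h)\<bar> = \<bar>y - h\<bar>" "\<bar>0 - y\<bar> = \<bar>y\<bar>" "x - (y + h) = x - y - h" "x - (y - h) = x - y + h" by auto
    then show ?thesis unfolding cusp_cov_def fbm_incr_cov_def by (simp only:) (simp add: field_simps)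
  qed
  have "\<bar>cusp_cov H y h 1\<bar> \<le> (C1 + C2) * h\<^sup>2 \<and> \<bar>cusp_cov H y h y + h powr (2 * H)\<bar> \<le> (C1 + C2) * h\<^sup>2
      \<and> (\<forall>m\<ge>2. \<bar>cusp_cov H y h (y ^ m)\<bar> \<le> (C1 + C2) * h\<^sup>2 * y ^ m)" if h: "0 < h" "h \<le> A / 2" for h
  proof (intro conjI allI impI)
    have gen: "\<bar>(u - w) / 2\<bar> \<le> P + Q" if "\<bar>u\<bar> \<le> P" "\<bar>w\<bar> \<le> P" "0 \<le> Q" for u w P Q :: real
    proof -
      have "\<bar>u - w\<bar> \<le> P + P" using abs_triangle_ineq4[of u w] that(1,2) by simp
      then show ?thesis using that(3) by simp
    qed
    have hy: "h < y" "h < 1 - y" using h A by auto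
    have Dy: "?\<phi> (y + h) + ?\<phi> (y - h) - 2 * ?\<phi> y = ?D h y" using hy h y by simp
    have D1: "\<bar>?D h y\<bar> \<le> C1 * h\<^sup>2" using A h by (intro C1) auto
    have D2: "\<bar>?D h (1 - y)\<bar> \<le> C1 * h\<^sup>2" using A h y by (intro C1) auto
    have h2: "0 \<le> C2 * h\<^sup>2" "0 \<le> C1 * h\<^sup>2" using C1 C2 by auto
    have "?\<phi> (1 - y + h) + ?\<phi> (1 - y - h) - 2 * ?\<phi> (1 - y) = ?D h (1 - y)" using hy h by simp
    then have "cusp_cov H y h 1 = (?D h y - ?D h (1 - y)) / 2" unfolding cov Dy by simp
    then show "\<bar>cusp_cov H y h 1\<bar> \<le> (C1 + C2) * h\<^sup>2" unfolding distrib_right using gen[OF D1 D2 h2(1)] by (simp only:)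
    have "cusp_cov H y h y + h powr (2*H) = ?D h y / 2" unfolding cov Dy using h by (simp add: field_simps)
    then show "\<bar>cusp_cov H y h y + h powr (2*H)\<bar> \<le> (C1 + C2) * h\<^sup>2" unfolding distrib_right using gen[OF D1 _ h2(1), of 0] h2(2) by (simp only: diff_0_right abs_zero)
    fix m :: nat assume m: "m \<ge> 2"
    \<comment> \<open>By evenness the second difference at \<open>y ^ m - y\<close> is the one at
      \<open>?w\<close>. Its distance \<open>y ^ m\<close> from \<open>y\<close> produces the factor
      \<open>1 / b ^ m\<close>, needed for summation against
      \<open>1 / \<alpha> ^ m\<close>.\<close>
    let ?w = "y - y ^ m"
    have ym: "y ^ m \<le> y\<^sup>2" "0 < y ^ m" using m y by (auto intro: power_decreasing)
    have w: "?w \<in> {A..1}" "?w < y" unfolding A_def atLeastAtMost_iff using ym y by linarith+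
    have "y ^ m - y + h = - (?w - h)" "y ^ m - y - h = - (?w + h)" "y ^ m - y = - ?w" by simp_all
    then have "?\<phi> (y ^ m - y + h) = ?\<phi> (?w - h)" "?\<phi> (y ^ m - y - h) = ?\<phi> (?w + h)" "?\<phi> (y ^ m - y) = ?\<phi> ?w"
      by (simp_all only: abs_minus_cancel)
    moreover have "?\<phi> (?w + h) + ?\<phi> (?w - h) - 2 * ?\<phi> ?w = ?D h ?w" using w h A by auto
    ultimately have "cusp_cov H y h (y ^ m) = (?D h y - ?D h ?w) / 2" unfolding cov Dy by simp
    moreover have "\<bar>?D h y - ?D h ?w\<bar> \<le> C2 * h\<^sup>2 * (y - ?w)" by (rule C2(2)[OF _ w(1) h w(2)]) (use A in auto)
    then have "\<bar>?D h y - ?D h ?w\<bar> \<le> C2 * h\<^sup>2 * y ^ m" by simp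
    moreover have "0 \<le> C1 * h\<^sup>2 * y ^ m" "0 \<le> C2 * h\<^sup>2 * y ^ m" using h2 ym by auto
    ultimately show "\<bar>cusp_cov H y h (y ^ m)\<bar> \<le> (C1 + C2) * h\<^sup>2 * y ^ m"
      using gen[of "?D h y - ?D h ?w" "C2 * h\<^sup>2 * y ^ m" 0 "C1 * h\<^sup>2 * y ^ m"] unfolding distrib_right
      by (simp only: diff_0_right abs_zero add.commute)
  qed
  then show ?thesis
    using A C1 C2 y by (intro exI[of _ "C1 + C2"] exI[of _ "A / 2"]) (auto simp: y_def power_divide)
qed

lemma (in prob_space) AE_not_tendsto_zero:
  fixes X :: "nat \<Rightarrow> 'a \<Rightarrow> real"
  assumes X[measurable]: "\<And>n. X n \<in> borel_measurable M"
    and sb: "\<And>n e. n \<ge> 1 \<Longrightarrow> e > 0 \<Longrightarrow> prob {\<omega>\<in>space M. \<bar>X n \<omega>\<bar> \<le> e} \<le> K * e"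
  shows "AE \<omega> in M. \<not> (\<lambda>n. X n \<omega>) \<longlonglongrightarrow> 0"
proof -
  define F where "F e n = {\<omega>\<in>space M. \<forall>m\<ge>Suc n. \<bar>X m \<omega>\<bar> \<le> e}" for e n
  have Fm[measurable]: "F e n \<in> sets M" for e n unfolding F_def by measurable
  have U: "prob (\<Union>n. F e n) \<le> K * e" if e: "e > 0" for e
  proof -
    have "incseq (F e)" by (auto simp: incseq_def F_def)
    then have "(\<lambda>n. prob (F e n)) \<longlonglongrightarrow> prob (\<Union>n. F e n)"
      by (intro finite_Lim_measure_incseq) (auto simp: Fm)
    moreover have "prob (F e n) \<le> K * e" for n
    proof -
      have "prob (F e n) \<le> prob {\<omega>\<in>space M. \<bar>X (Suc n) \<omega>\<bar> \<le> e}"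
        by (intro finite_measure_mono) (auto simp: F_def)
      also have "\<dots> \<le> K * e" using e by (intro sb) auto
      finally show ?thesis .
    qed
    ultimately show ?thesis by (intro LIMSEQ_le_const2[of "\<lambda>n. prob (F e n)"]) auto
  qed
  define S where "S = (\<Inter>k::nat. \<Union>n. F (1 / real (Suc k)) n)"
  have S: "S \<in> sets M" unfolding S_def by measurable
  have "prob S \<le> K * (1 / real (Suc k))" for k
  proof -
    have "prob S \<le> prob (\<Union>n. F (1 / real (Suc k)) n)" unfolding S_def by (intro finite_measure_mono) auto
    also have "\<dots> \<le> K * (1 / real (Suc k))" by (intro U) simp
    finally show ?thesis .
  qed
  moreover have "(\<lambda>k. K * (1 / real (Suc k))) \<longlonglongrightarrow> 0"
    using tendsto_mult_right_zero[OF LIMSEQ_inverse_real_of_nat, of K] by (simp add: inverse_eq_divide)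
  ultimately have "prob S \<le> 0" by (intro LIMSEQ_le_const) auto
  then have "prob S = 0" by (simp add: measure_le_0_iff)
  then have null: "S \<in> null_sets M" using S by (simp add: null_setsI emeasure_eq_measure)
  show ?thesis
  proof (rule AE_I'[OF null], rule subsetI)
    fix \<omega> assume "\<omega> \<in> {\<omega>\<in>space M. \<not> \<not> (\<lambda>n. X n \<omega>) \<longlonglongrightarrow> 0}"
    then have w: "\<omega> \<in> space M" "(\<lambda>n. X n \<omega>) \<longlonglongrightarrow> 0" by auto
    show "\<omega> \<in> S" unfolding S_def
    proof (intro INT_I)
      fix k :: nat
      have "eventually (\<lambda>n. \<bar>X n \<omega>\<bar> < 1 / real (Suc k)) sequentially"
        using tendstoD[OF w(2), of "1 / real (Suc k)"] by (simp add: dist_real_def)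
      then obtain n where n: "\<And>m. m \<ge> n \<Longrightarrow> \<bar>X m \<omega>\<bar> < 1 / real (Suc k)" by (auto simp: eventually_sequentially)
      have "\<omega> \<in> F (1 / real (Suc k)) n"
        unfolding F_def using w(1) by (auto intro!: less_imp_le[OF n] simp del: of_nat_Suc)
      then show "\<omega> \<in> (\<Union>n. F (1 / real (Suc k)) n)" by blast
    qed
  qed
qed

text \<open>The second difference at \<open>1 / b\<close> has covariance
  \<open>- h powr (2*H) / \<alpha>\<close> with the functional, up to an error at most half as large
  for suitable \<open>h\<close>; positivity of the quadratic form turns this into a lower bound on
  the variance that does not depend on \<open>N\<close>. The coefficients \<open>c N\<close> will
  carry \<open>\<kappa>\<close>, and \<open>1 < \<alpha> * b\<close> makes the errors from the
  levels \<open>m \<ge> 2\<close> summable.\<close>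

lemma leading_functional_nondegenerate:
  assumes H: "0 < H" "H < 1" and b: "b \<ge> 2" and fbm: "is_fbm M H W" and \<alpha>: "0 < \<alpha>" "1 < \<alpha> * real b"
    and c: "\<And>N. \<bar>c N\<bar> \<le> c'"
  shows "AE \<omega> in M. \<not> (\<lambda>N. (\<Sum>m\<in>{1..N}. (W (1 / real b ^ m) \<omega> - W 0 \<omega>) / \<alpha> ^ m) - c N * (W 1 \<omega> - W 0 \<omega>)) \<longlonglongrightarrow> 0"
proof -
  interpret prob_space M using fbm by (simp add: is_fbm_def)
  obtain C h0 where C: "0 \<le> C" "0 < h0" "h0 < 1 / real b" and cusp: "\<And>h. 0 < h \<Longrightarrow> h \<le> h0 \<Longrightarrow>
      \<bar>cusp_cov H (1 / real b) h 1\<bar> \<le> C * h\<^sup>2 \<and>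
      \<bar>cusp_cov H (1 / real b) h (1 / real b) + h powr (2 * H)\<bar> \<le> C * h\<^sup>2 \<and>
      (\<forall>m\<ge>2. \<bar>cusp_cov H (1 / real b) h (1 / real b ^ m)\<bar> \<le> C * h\<^sup>2 / real b ^ m)"
    using cusp_cov_bounds[OF H(1) b] by blast
  let ?q = "1 / (\<alpha> * real b)"
  have q: "0 \<le> ?q" "?q < 1" using \<alpha> by (auto simp: divide_less_eq)
  \<comment> \<open>The three summands bound the errors from the multiple of \<open>W 1\<close>,
    from \<open>m = 1\<close>, and from the geometric tail \<open>m \<ge> 2\<close>.\<close>
  define C' where "C' = C * (c' + 1 / \<alpha> + 1 / (1 - ?q))"
  have c'0: "0 \<le> c'" using order_trans[OF abs_ge_zero c[of 0]] .
  have C'0: "0 \<le> C'" using C c'0 \<alpha> q unfolding C'_def by (intro mult_nonneg_nonneg add_nonneg_nonneg) auto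
  \<comment> \<open>Chosen so that
    \<open>h powr (2 - 2*H) \<le> 1 / (2 * \<alpha> * (C' + 1))\<close>: the error
    \<open>C' * h\<^sup>2\<close> is then at most half of
    \<open>h powr (2*H) / \<alpha>\<close>.\<close>
  define h where "h = min h0 ((1 / (2 * \<alpha> * (C' + 1))) powr (1 / (2 - 2*H)))"
  have h: "0 < h" "h \<le> h0" using C \<alpha> C'0 by (auto simp: h_def)
  have "h powr (2 - 2*H) \<le> ((1 / (2 * \<alpha> * (C' + 1))) powr (1 / (2 - 2*H))) powr (2 - 2*H)"
    using h H by (intro powr_mono2) (auto simp: h_def)
  also have "\<dots> = 1 / (2 * \<alpha> * (C' + 1))" using H \<alpha> C'0 by (simp add: powr_powr)
  finally have "C' * h powr (2 - 2*H) \<le> C' * (1 / (2 * \<alpha> * (C' + 1)))" using C'0 by (intro mult_left_mono)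
  also have "\<dots> = (C' / (C' + 1)) / (2 * \<alpha>)" by (simp add: mult_ac)
  also have "\<dots> \<le> 1 / (2 * \<alpha>)" using C'0 \<alpha> by (intro divide_right_mono) auto
  finally have "C' * h powr (2 - 2*H) * h powr (2*H) \<le> 1 / (2 * \<alpha>) * h powr (2*H)" by (intro mult_right_mono) auto
  moreover have "h powr (2 - 2*H) * h powr (2*H) = h\<^sup>2" using h by (simp flip: powr_add)
  ultimately have C'h: "C' * h\<^sup>2 \<le> h powr (2*H) / (2 * \<alpha>)" by (simp add: mult.assoc)
  define \<delta> where "\<delta> = h powr (2*H) / (2 * \<alpha>)"
  have \<delta>: "\<delta> > 0" using h \<alpha> by (simp add: \<delta>_def)
  \<comment> \<open>The label \<open>True\<close> marks the functional, with \<open>m = 0\<close>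
    giving \<open>W 1 - W 0\<close> since \<open>1 / b ^ 0 = 1\<close>; \<open>False\<close> marks
    the two adjacent increments whose difference is the test variable.\<close>
  define s where "s = (\<lambda>(k::bool, m::nat). if k then 0 else if m = 0 then 1 / real b else 1 / real b - h)"
  define t where "t = (\<lambda>(k::bool, m::nat). if k then 1 / real b ^ m else if m = 0 then 1 / real b + h else 1 / real b)"
  have st: "0 \<le> s i" "0 \<le> t i" for i using h C(3) by (auto simp: s_def t_def split: prod.split)
  note fam = fbm_incr_family[OF fbm, of s t, OF st]
  define a where "a = (\<lambda>N k m. if k then (if m = 0 then - c N else 1 / \<alpha> ^ m) else if m = 0 then 1 else if m = 1 then - 1 else (0::real))"
  define U where "U N k \<omega> = (\<Sum>m\<in>{..N}. a N k m * (W (t (k, m)) \<omega> - W (s (k, m)) \<omega>))" for N :: nat and k \<omega>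
  define \<Gamma> where "\<Gamma> N k l = (\<Sum>m\<in>{..N}. \<Sum>n\<in>{..N}. a N k m * a N l n * fbm_incr_cov H (s (k, m)) (t (k, m)) (s (l, n)) (t (l, n)))" for N k l
  have g: "gaussian_family M (U N) (\<Gamma> N)" for N
    unfolding U_def[abs_def] \<Gamma>_def[abs_def] by (rule gaussian_family_lincomb[OF fam]) simp
  have two: "(\<Sum>n\<in>{..N}. a N False n * F n) = F 0 - F 1" if "N \<ge> 1" for N :: nat and F :: "nat \<Rightarrow> real"
  proof -
    have "(\<Sum>n\<in>{..N}. a N False n * F n) = (\<Sum>n\<in>{0, 1}. a N False n * F n)"
      using that by (intro sum.mono_neutral_right) (auto simp: a_def)
    then show ?thesis by (simp add: a_def)
  qed
  \<comment> \<open>Variance of the second difference, raised to at least 1 so that division by it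
    is safe.\<close>
  define v where "v = max 1 (fbm_incr_cov H (s (False, 0)) (t (False, 0)) (s (False, 0)) (t (False, 0))
      - fbm_incr_cov H (s (False, 0)) (t (False, 0)) (s (False, 1)) (t (False, 1))
      - (fbm_incr_cov H (s (False, 1)) (t (False, 1)) (s (False, 0)) (t (False, 0))
      - fbm_incr_cov H (s (False, 1)) (t (False, 1)) (s (False, 1)) (t (False, 1))))"
  have FF: "\<Gamma> N False False \<le> v" if "N \<ge> 1" for N
  proof -
    have "\<Gamma> N False False = (\<Sum>m\<in>{..N}. a N False m * (\<Sum>n\<in>{..N}. a N False n * fbm_incr_cov H (s (False, m)) (t (False, m)) (s (False, n)) (t (False, n))))"
      by (simp add: \<Gamma>_def sum_distrib_left mult.assoc)
    then show ?thesis unfolding two[OF that] v_def by simp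
  qed
  have TF: "\<Gamma> N True False \<le> - \<delta>" if N: "N \<ge> 1" for N
  proof -
    let ?k = "\<lambda>m. cusp_cov H (1 / real b) h (1 / real b ^ m)"
    have "\<Gamma> N True False = (\<Sum>m\<in>{..N}. a N True m * (\<Sum>n\<in>{..N}. a N False n * fbm_incr_cov H (s (True, m)) (t (True, m)) (s (False, n)) (t (False, n))))"
      by (simp add: \<Gamma>_def sum_distrib_left mult.assoc)
    also have "\<dots> = (\<Sum>m\<in>{..N}. a N True m * ?k m)"
      unfolding two[OF N] by (simp add: cusp_cov_def s_def t_def)
    also have "{..N} = insert 0 (insert 1 {2..N})" using N by auto
    also have "(\<Sum>m\<in>insert 0 (insert 1 {2..N}). a N True m * ?k m) = - c N * ?k 0 + (?k 1 / \<alpha> + (\<Sum>m\<in>{2..N}. a N True m * ?k m))"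
      by (simp add: a_def)
    finally have e: "\<Gamma> N True False = - c N * ?k 0 + (?k 1 / \<alpha> + (\<Sum>m\<in>{2..N}. a N True m * ?k m))" .
    have k0: "\<bar>- c N * ?k 0\<bar> \<le> c' * (C * h\<^sup>2)"
      unfolding abs_mult using cusp[OF h] c[of N] c'0 by (intro mult_mono) auto
    have k1: "\<bar>?k 1 / \<alpha> + h powr (2*H) / \<alpha>\<bar> \<le> C * h\<^sup>2 / \<alpha>"
    proof -
      have "\<bar>?k 1 + h powr (2*H)\<bar> / \<alpha> \<le> C * h\<^sup>2 / \<alpha>" using cusp[OF h] \<alpha> by (intro divide_right_mono) auto
      then show ?thesis using \<alpha> by (simp flip: add_divide_distrib)
    qed
    have k2: "\<bar>\<Sum>m\<in>{2..N}. a N True m * ?k m\<bar> \<le> C * h\<^sup>2 * (1 / (1 - ?q))"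
    proof -
      have "\<bar>\<Sum>m\<in>{2..N}. a N True m * ?k m\<bar> \<le> (\<Sum>m\<in>{2..N}. C * h\<^sup>2 * ?q ^ m)"
      proof (intro order_trans[OF sum_abs] sum_mono)
        fix m assume m: "m \<in> {2..N}"
        then have "\<bar>?k m\<bar> \<le> C * h\<^sup>2 / real b ^ m" using cusp[OF h] by auto
        then have "\<bar>?k m\<bar> / \<alpha> ^ m \<le> C * h\<^sup>2 / real b ^ m / \<alpha> ^ m" using \<alpha> by (intro divide_right_mono) auto
        moreover have "\<bar>a N True m * ?k m\<bar> = \<bar>?k m\<bar> / \<alpha> ^ m" using m \<alpha> by (simp add: a_def abs_mult)
        moreover have "C * h\<^sup>2 / real b ^ m / \<alpha> ^ m = C * h\<^sup>2 * ?q ^ m" by (simp add: power_divide power_mult_distrib mult.commute)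
        ultimately show "\<bar>a N True m * ?k m\<bar> \<le> C * h\<^sup>2 * ?q ^ m" by simp
      qed
      also have "\<dots> = C * h\<^sup>2 * (\<Sum>m\<in>{2..N}. ?q ^ m)" by (simp only: sum_distrib_left)
      also have "\<dots> \<le> C * h\<^sup>2 * (1 / (1 - ?q))"
      proof (rule mult_left_mono)
        have "(\<Sum>m\<in>{2..N}. ?q ^ m) \<le> (\<Sum>m. ?q ^ m)" using q by (intro sum_le_suminf summable_geometric) auto
        also have "\<dots> = 1 / (1 - ?q)" using q by (intro suminf_geometric) auto
        finally show "(\<Sum>m\<in>{2..N}. ?q ^ m) \<le> 1 / (1 - ?q)" .
      qed (use C in auto)
      finally show ?thesis .
    qed
    have "c' * (C * h\<^sup>2) + C * h\<^sup>2 / \<alpha> + C * h\<^sup>2 * (1 / (1 - ?q)) = C' * h\<^sup>2"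
      unfolding C'_def by (simp add: distrib_left distrib_right mult_ac)
    then have "c' * (C * h\<^sup>2) + C * h\<^sup>2 / \<alpha> + C * h\<^sup>2 * (1 / (1 - ?q)) \<le> \<delta>" using C'h by (simp add: \<delta>_def)
    moreover have "h powr (2*H) / \<alpha> = 2 * \<delta>" using \<alpha> by (simp add: \<delta>_def)
    moreover have "x + (y + z) \<le> - \<delta>" if "\<bar>x\<bar> \<le> x'" "\<bar>y + w\<bar> \<le> y'" "\<bar>z\<bar> \<le> z'" "x' + y' + z' \<le> \<delta>" "w = 2 * \<delta>"
      for x y z w x' y' z' :: real using that by linarith
    ultimately show ?thesis unfolding e using k0 k1 k2 by blast
  qed
  have v1: "v \<ge> 1" by (simp add: v_def)
  have TT: "\<Gamma> N True True \<ge> \<delta>\<^sup>2 / v" if N: "N \<ge> 1" for N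
  proof -
    \<comment> \<open>The minimiser of \<open>- 2 * x * \<delta> + x\<^sup>2 * v\<close>, the
      quadratic bound obtained from the combination of both variables.\<close>
    define x where "x = \<delta> / v"
    have x: "x > 0" using \<delta> v1 by (simp add: x_def)
    have "0 \<le> \<Gamma> N True True + 2 * x * \<Gamma> N True False + x\<^sup>2 * \<Gamma> N False False"
      using gaussian_family_pair(2)[OF g, of 1 N True x False] by simp
    also have "\<dots> \<le> \<Gamma> N True True + 2 * x * (- \<delta>) + x\<^sup>2 * v"
      using TF[OF N] FF[OF N] x by (intro add_mono mult_left_mono) auto
    finally have "0 \<le> \<Gamma> N True True + 2 * x * (- \<delta>) + x\<^sup>2 * v" .
    moreover have "2 * x * (- \<delta>) + x\<^sup>2 * v = - (\<delta>\<^sup>2 / v)" using v1 by (simp add: x_def power2_eq_square field_simps)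
    ultimately show ?thesis by linarith
  qed
  have "AE \<omega> in M. \<not> (\<lambda>N. U N True \<omega>) \<longlonglongrightarrow> 0"
  proof (rule AE_not_tendsto_zero)
    show "U N True \<in> borel_measurable M" for N by (rule gaussian_familyD(2)[OF g])
    fix N :: nat and e :: real assume N: "N \<ge> 1" and e: "e > 0"
    have \<delta>v: "0 < \<delta>\<^sup>2 / v" using \<delta> v1 by simp
    have "prob {\<omega> \<in> space M. \<bar>U N True \<omega>\<bar> \<le> e} \<le> 2 * e / sqrt (\<Gamma> N True True)"
      using TT[OF N] \<delta>v e
      by (intro centred_gaussian_small_ball gaussian_familyD(2)[OF g] gaussian_family_single(1)[OF g]) auto
    also have "\<dots> \<le> 2 * e / sqrt (\<delta>\<^sup>2 / v)"
      using TT[OF N] \<delta>v e by (intro divide_left_mono mult_pos_pos real_sqrt_le_mono) auto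
    finally show "prob {\<omega> \<in> space M. \<bar>U N True \<omega>\<bar> \<le> e} \<le> 2 / sqrt (\<delta>\<^sup>2 / v) * e" by simp
  qed
  moreover have "U N True \<omega> = (\<Sum>m\<in>{1..N}. (W (1 / real b ^ m) \<omega> - W 0 \<omega>) / \<alpha> ^ m) - c N * (W 1 \<omega> - W 0 \<omega>)" for N \<omega>
  proof -
    have "{..N} = insert 0 {1..N}" by auto
    then have "U N True \<omega> = a N True 0 * (W (t (True, 0)) \<omega> - W (s (True, 0)) \<omega>)
        + (\<Sum>m\<in>{1..N}. a N True m * (W (t (True, m)) \<omega> - W (s (True, m)) \<omega>))"
      unfolding U_def by (simp only:) (subst sum.insert, auto)
    also have "(\<Sum>m\<in>{1..N}. a N True m * (W (t (True, m)) \<omega> - W (s (True, m)) \<omega>)) = (\<Sum>m\<in>{1..N}. (W (1 / real b ^ m) \<omega> - W 0 \<omega>) / \<alpha> ^ m)"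
      by (intro sum.cong refl) (auto simp: a_def s_def t_def)
    finally show ?thesis by (simp add: a_def s_def t_def)
  qed
  ultimately show ?thesis by simp
qed

section \<open>Variation of the Wiener--Weierstrass bridge\<close>

lemma fwwb_eq_weierstrass: "(\<lambda>t. fwwb \<alpha> b \<kappa> W t \<omega>) = weierstrass \<alpha> b (\<lambda>x. fbb \<kappa> W x \<omega>)"
  by (simp add: fwwb_def weierstrass_def fun_eq_iff)

text \<open>The variance at time 0 is 0, so \<open>cosh (W 0) - 1\<close> is nonnegative with
  integral 0. The definition yields a vanishing start only almost surely.\<close>

lemma fbm_zero_AE:
  assumes fbm: "is_fbm M H W"
  shows "AE \<omega> in M. W 0 \<omega> = 0"
proof -
  interpret prob_space M using fbm by (simp add: is_fbm_def)
  have [measurable]: "W 0 \<in> borel_measurable M" using fbm by (simp add: is_fbm_def)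
  have "(\<integral>\<omega>. cis (u * W 0 \<omega>) \<partial>M) = complex_of_real (exp (- (u\<^sup>2 * 0) / 2))" for u
    using fbm_finite_char[OF fbm, of "{()}" "\<lambda>_. 0" "\<lambda>_. u"] by (simp add: fbm_cov_def)
  from centred_gaussian_cosh[OF _ this] have "has_bochner_integral M (\<lambda>\<omega>. cosh (W 0 \<omega>)) 1" by simp
  then have i: "integrable M (\<lambda>\<omega>. cosh (W 0 \<omega>) - 1)" "(\<integral>\<omega>. cosh (W 0 \<omega>) - 1 \<partial>M) = 0"
    by (auto simp: has_bochner_integral_iff prob_space)
  have "AE \<omega> in M. cosh (W 0 \<omega>) - 1 = 0"
    using i by (subst integral_nonneg_eq_0_iff_AE[symmetric]) (auto simp: cosh_real_ge_1)
  then show ?thesis by eventually_elim (simp add: cosh_real_one_iff)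
qed

lemma badic_incr_fbb:
  "badic_incr (\<lambda>x. fbb \<kappa> W x \<omega>) b m j = badic_incr (\<lambda>x. W x \<omega>) b m j - badic_incr \<kappa> b m j * W 1 \<omega>"
  by (simp add: badic_incr_def fbb_def algebra_simps)

lemma badic_incr_holder:
  fixes \<kappa> :: "real \<Rightarrow> real"
  assumes holder: "\<forall>s\<in>{0..1}. \<forall>t\<in>{0..1}. \<bar>\<kappa> s - \<kappa> t\<bar> \<le> C * \<bar>s - t\<bar> powr \<tau>" and b: "b \<ge> 2" and j: "j < b ^ m"
  shows "\<bar>badic_incr \<kappa> b m j\<bar> \<le> C * (real b powr (- \<tau>)) ^ m"
proof -
  have b0: "real b ^ m > 0" using b by simp
  have "real x / real b ^ m \<in> {0..1}" if "x \<le> b ^ m" for x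
  proof -
    have "real x \<le> real b ^ m" using that by (metis of_nat_le_iff of_nat_power)
    then show ?thesis using b0 by simp
  qed
  from this[of "j + 1"] this[of j] j have "real (j + 1) / real b ^ m \<in> {0..1}" "real j / real b ^ m \<in> {0..1}" by auto
  then have "\<bar>badic_incr \<kappa> b m j\<bar> \<le> C * \<bar>real (j + 1) / real b ^ m - real j / real b ^ m\<bar> powr \<tau>"
    unfolding badic_incr_def using holder by blast
  also have "real (j + 1) / real b ^ m - real j / real b ^ m = 1 / real b ^ m" by (simp add: diff_divide_distrib[symmetric])
  also have "\<bar>1 / real b ^ m\<bar> powr \<tau> = (real b powr (- \<tau>)) ^ m"
  proof -
    have "(real b powr (- \<tau>)) ^ m = real b powr (- \<tau> * real m)"
      using b powr_realpow[of "real b powr (- \<tau>)" m] by (simp add: powr_powr)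
    moreover have "1 / real b ^ m = real b powr (- real m)" using b by (simp add: powr_minus_divide powr_realpow)
    ultimately show ?thesis by (simp add: powr_powr mult.commute)
  qed
  finally show ?thesis .
qed

lemma fbb_incr_bound_AE:
  assumes H: "0 < H" and fbm: "is_fbm M H W" and b: "b \<ge> 2" and \<tau>: "H < \<tau>"
    and holder: "\<forall>s\<in>{0..1}. \<forall>t\<in>{0..1}. \<bar>\<kappa> s - \<kappa> t\<bar> \<le> C * \<bar>s - t\<bar> powr \<tau>" and h: "h < H"
  shows "AE \<omega> in M. \<exists>D. \<forall>m j. j < b^m \<longrightarrow> \<bar>badic_incr (\<lambda>x. fbb \<kappa> W x \<omega>) b m j\<bar> \<le> D * (real b powr (- h)) ^ m"
  using badic_incr_bound_AE[OF H b fbm h]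
proof eventually_elim
  case (elim \<omega>)
  then obtain D where D: "\<And>m j. j < b^m \<Longrightarrow> \<bar>badic_incr (\<lambda>x. W x \<omega>) b m j\<bar> \<le> D * (real b powr (- h)) ^ m"
    unfolding badic_incr_def by blast
  have "\<bar>badic_incr (\<lambda>x. fbb \<kappa> W x \<omega>) b m j\<bar> \<le> (D + \<bar>C\<bar> * \<bar>W 1 \<omega>\<bar>) * (real b powr (- h)) ^ m" if j: "j < b^m" for m j
  proof -
    have "C * (real b powr (- \<tau>)) ^ m \<le> \<bar>C\<bar> * (real b powr (- h)) ^ m"
      using b h \<tau> by (intro mult_mono power_mono powr_mono) auto
    then have "\<bar>badic_incr \<kappa> b m j\<bar> \<le> \<bar>C\<bar> * (real b powr (- h)) ^ m"
      using badic_incr_holder[OF holder b j] by linarith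
    then have "\<bar>badic_incr \<kappa> b m j * W 1 \<omega>\<bar> \<le> \<bar>C\<bar> * (real b powr (- h)) ^ m * \<bar>W 1 \<omega>\<bar>"
      unfolding abs_mult by (intro mult_right_mono) auto
    then have "\<bar>badic_incr (\<lambda>x. W x \<omega>) b m j - badic_incr \<kappa> b m j * W 1 \<omega>\<bar> \<le> D * (real b powr (- h)) ^ m + \<bar>C\<bar> * (real b powr (- h)) ^ m * \<bar>W 1 \<omega>\<bar>"
      using D[OF j] by linarith
    then show ?thesis unfolding badic_incr_fbb by (simp add: algebra_simps)
  qed
  then show ?case by blast
qed

text \<open>\<open>V\<close> and \<open>p\<close> are quantified inside the almost sure statement,
  because in the rough regime the limit is random. The bound on the largest increment is a
  convolution of two geometric sequences and serves both regimes.\<close>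

lemma fwwb_other_exponents_AE:
  assumes H: "0 < H" and fbm: "is_fbm M H W" and \<alpha>: "0 < \<alpha>" "\<alpha> < 1" and b: "b \<ge> 2" and \<kappa>: "\<kappa> 0 = 0" "\<kappa> 1 = 1" and \<tau>: "H < \<tau>"
    and holder: "\<forall>s\<in>{0..1}. \<forall>t\<in>{0..1}. \<bar>\<kappa> s - \<kappa> t\<bar> \<le> C * \<bar>s - t\<bar> powr \<tau>"
  shows "AE \<omega> in M. \<forall>V p. V > 0 \<and> (\<lambda>N. pvar_sum (\<lambda>t. fwwb \<alpha> b \<kappa> W t \<omega>) b p 1 N) \<longlonglongrightarrow> V \<longrightarrow>
     (\<forall>q. q < p \<longrightarrow> has_pvar (\<lambda>t. fwwb \<alpha> b \<kappa> W t \<omega>) b q 1 \<infinity>) \<and> (\<forall>q. q > p \<longrightarrow> has_pvar (\<lambda>t. fwwb \<alpha> b \<kappa> W t \<omega>) b q 1 0)"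
proof -
  \<comment> \<open>A positive Holder exponent below \<open>H\<close>; its positivity gives
    \<open>?s < 1\<close>.\<close>
  have "H / 2 < H" using H by simp
  from fbb_incr_bound_AE[OF H fbm b \<tau> holder this] fbm_zero_AE[OF fbm] show ?thesis
  proof eventually_elim
    case (elim \<omega>)
    let ?f = "\<lambda>x. fbb \<kappa> W x \<omega>" and ?s = "real b powr (- (H / 2))"
    from elim obtain D where D: "\<And>m j. j < b^m \<Longrightarrow> \<bar>badic_incr ?f b m j\<bar> \<le> D * ?s ^ m" by blast
    have f: "?f 0 = 0" "?f 1 = 0" using elim \<kappa> by (auto simp: fbb_def)
    have "?s < real b powr 0" using b H by (intro powr_less_mono) auto
    then have s: "0 \<le> ?s" "?s < 1" using b by auto
    obtain c q where c: "0 \<le> c" "0 < q" "q < 1" "\<And>N. (\<Sum>i<N. \<alpha> ^ i * ?s ^ (N - i)) \<le> c * q ^ N"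
      using convolution_geometric_bound[of \<alpha> ?s] \<alpha> s by auto
    have D0: "D \<ge> 0" using order_trans[OF abs_ge_zero D[of 0 0]] b by simp
    let ?g = "\<lambda>N k. \<bar>\<Sum>i<N. \<alpha> ^ i * badic_incr ?f b (N - i) (k mod b ^ (N - i))\<bar>"
    have g: "?g N k \<le> D * (c * q ^ N)" for N k
      using weierstrass_increment_bound[OF b less_imp_le[OF \<alpha>(1)] D, of N k] mult_left_mono[OF c(4)[of N] D0] by linarith
    have e: "(\<lambda>N. D * (c * q ^ N)) \<longlonglongrightarrow> 0"
      using c by (intro tendsto_mult_right_zero LIMSEQ_power_zero) auto
    have pv: "pvar_sum (\<lambda>t. fwwb \<alpha> b \<kappa> W t \<omega>) b x 1 N = (\<Sum>k<b^N. ?g N k powr x)" for x N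
      unfolding fwwb_eq_weierstrass pvar_sum_weierstrass[of b ?f, OF b f]
      by (simp flip: of_nat_power)
    show ?case
    proof (intro allI impI)
      fix V p assume "V > 0 \<and> (\<lambda>N. pvar_sum (\<lambda>t. fwwb \<alpha> b \<kappa> W t \<omega>) b p 1 N) \<longlonglongrightarrow> V"
      then have V: "V > 0" "(\<lambda>N. \<Sum>k<b^N. ?g N k powr p) \<longlonglongrightarrow> V" unfolding pv by auto
      have e0: "0 \<le> D * (c * q ^ N)" for N using D0 c by simp
      note oe = powr_sums_other_exponents[of ?g "\<lambda>N. b^N" "\<lambda>N. D * (c * q ^ N)", OF abs_ge_zero g e0 e V]
      show "(\<forall>q. q < p \<longrightarrow> has_pvar (\<lambda>t. fwwb \<alpha> b \<kappa> W t \<omega>) b q 1 \<infinity>) \<and> (\<forall>q. q > p \<longrightarrow> has_pvar (\<lambda>t. fwwb \<alpha> b \<kappa> W t \<omega>) b q 1 0)"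
        unfolding has_pvar_def pv using oe tendsto_ereal[of _ 0]
        by (auto simp: tendsto_PInfty_eq_at_top zero_ereal_def)
    qed
  qed
qed

lemma fwwb_pvar_rough_AE:
  assumes H: "0 < H" "H < 1" and fbm: "is_fbm M H W" and \<alpha>: "0 < \<alpha>" "\<alpha> < 1" and b: "b \<ge> 2" and \<kappa>: "\<kappa> 0 = 0" "\<kappa> 1 = 1" and \<tau>: "H < \<tau>"
    and holder: "\<forall>s\<in>{0..1}. \<forall>t\<in>{0..1}. \<bar>\<kappa> s - \<kappa> t\<bar> \<le> C * \<bar>s - t\<bar> powr \<tau>"
    and K: "K = - log (real b) \<alpha>" "K < H"
  shows "\<exists>V. V \<in> borel_measurable M \<and> (AE \<omega> in M. 0 < V \<omega>) \<and>
    (AE \<omega> in M. \<forall>t\<in>{0..1}. (\<lambda>N. pvar_sum (\<lambda>s. fwwb \<alpha> b \<kappa> W s \<omega>) b (1 / K) t N) \<longlonglongrightarrow> V \<omega> * t)"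
proof -
  have b1: "real b > 1" using b by simp
  have K0: "K > 0" using \<alpha> b1 by (simp add: K(1))
  have \<alpha>K: "\<alpha> = real b powr (- K)" using \<alpha> b1 by (simp add: K(1))
  have "\<alpha> powr (1 / K) = real b powr (- 1)" using K0 by (simp add: \<alpha>K powr_powr)
  then have p: "1 / K > 0" "\<alpha> powr (1 / K) = 1 / real b" using K0 b1 by (simp_all add: powr_minus_divide)
  \<comment> \<open>Below \<open>H\<close>, so that the grid bound holds almost surely, and above
    \<open>K\<close>, so that its ratio \<open>b powr (- h)\<close> is smaller than
    \<open>\<alpha>\<close>.\<close>
  define h where "h = (H + K) / 2"
  have h: "h < H" "K < h" using K(2) by (auto simp: h_def)
  have s: "0 \<le> real b powr (- h)" "real b powr (- h) < \<alpha>" using h b1 by (auto simp: \<alpha>K)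
  have ab: "1 < \<alpha> * real b"
  proof -
    have "real b powr 0 < real b powr (- K + 1)" using b1 K(2) H by (intro powr_less_mono) auto
    then show ?thesis using b1 unfolding powr_add by (simp add: \<alpha>K)
  qed
  \<comment> \<open>The coefficient with which \<open>W 1\<close> enters the leading functional of
    the bridge. It is bounded because \<open>\<tau> > H > K\<close> makes
    \<open>\<kappa> (1 / b ^ m) / \<alpha> ^ m\<close> decay geometrically.\<close>
  define c where "c N = (\<Sum>m\<in>{1..N}. \<kappa> (1 / real b ^ m) / \<alpha> ^ m)" for N :: nat
  define q where "q = real b powr (- \<tau>) / \<alpha>"
  have q: "0 \<le> q" "q < 1" using \<tau> K(2) b1 by (auto simp: q_def \<alpha>K divide_less_eq)
  have c: "\<bar>c N\<bar> \<le> \<bar>C\<bar> * (1 / (1 - q))" for N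
  proof -
    have "\<bar>c N\<bar> \<le> (\<Sum>m\<in>{1..N}. \<bar>C\<bar> * q ^ m)"
      unfolding c_def
    proof (intro order_trans[OF sum_abs] sum_mono)
      fix m
      have "\<bar>\<kappa> (1 / real b ^ m)\<bar> \<le> C * (real b powr (- \<tau>)) ^ m"
        using badic_incr_holder[OF holder b, of 0 m] b \<kappa> by (simp add: badic_incr_def)
      also have "\<dots> \<le> \<bar>C\<bar> * (real b powr (- \<tau>)) ^ m" by (intro mult_right_mono) auto
      finally have "\<bar>\<kappa> (1 / real b ^ m)\<bar> / \<alpha> ^ m \<le> \<bar>C\<bar> * (real b powr (- \<tau>)) ^ m / \<alpha> ^ m" using \<alpha> by (intro divide_right_mono) auto
      then show "\<bar>\<kappa> (1 / real b ^ m) / \<alpha> ^ m\<bar> \<le> \<bar>C\<bar> * q ^ m" using \<alpha> by (simp add: q_def power_divide)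
    qed
    also have "\<dots> = \<bar>C\<bar> * (\<Sum>m\<in>{1..N}. q ^ m)" by (simp only: sum_distrib_left)
    also have "\<dots> \<le> \<bar>C\<bar> * (1 / (1 - q))"
    proof (rule mult_left_mono)
      have "(\<Sum>m\<in>{1..N}. q ^ m) \<le> (\<Sum>m. q ^ m)" using q by (intro sum_le_suminf summable_geometric) auto
      also have "\<dots> = 1 / (1 - q)" using q by (intro suminf_geometric) auto
      finally show "(\<Sum>m\<in>{1..N}. q ^ m) \<le> 1 / (1 - q)" .
    qed simp
    finally show ?thesis .
  qed
  let ?X = "\<lambda>\<omega> t. fwwb \<alpha> b \<kappa> W t \<omega>"
  \<comment> \<open>A limit of measurable sums at time 1 is measurable whether or not it exists on
    every path; almost surely it equals the constant obtained path by path.\<close>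
  define V where "V \<omega> = lim (\<lambda>N. pvar_sum (?X \<omega>) b (1 / K) 1 N)" for \<omega>
  have "AE \<omega> in M. 0 < V \<omega> \<and> (\<forall>t\<in>{0..1}. (\<lambda>N. pvar_sum (?X \<omega>) b (1 / K) t N) \<longlonglongrightarrow> V \<omega> * t)"
    using fbb_incr_bound_AE[OF H(1) fbm b \<tau> holder h(1)] fbm_zero_AE[OF fbm]
      leading_functional_nondegenerate[OF H b fbm \<alpha>(1) ab, of c, OF c]
  proof eventually_elim
    case (elim \<omega>)
    let ?f = "\<lambda>x. fbb \<kappa> W x \<omega>"
    from elim(1) obtain D where D: "\<And>m j. j < b^m \<Longrightarrow> \<bar>badic_incr ?f b m j\<bar> \<le> D * (real b powr (- h)) ^ m" by blast
    have f: "?f 0 = 0" "?f 1 = 0" using elim \<kappa> by (auto simp: fbb_def)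
    have "(\<Sum>m\<in>{1..N}. badic_incr ?f b m 0 / \<alpha> ^ m) = (\<Sum>m\<in>{1..N}. (W (1 / real b ^ m) \<omega> - W 0 \<omega>) / \<alpha> ^ m) - c N * (W 1 \<omega> - W 0 \<omega>)" for N
      using elim(2) \<kappa> unfolding c_def sum_distrib_right sum_subtractf[symmetric]
      by (intro sum.cong refl) (simp add: badic_incr_def fbb_def diff_divide_distrib)
    then have nz: "\<not> (\<lambda>N. \<Sum>m\<in>{1..N}. badic_incr ?f b m 0 / \<alpha> ^ m) \<longlonglongrightarrow> 0" using elim(3) by simp
    obtain v where v: "\<And>t. t \<in> {0..1} \<Longrightarrow> (\<lambda>N. pvar_sum (weierstrass \<alpha> b ?f) b (1 / K) t N) \<longlonglongrightarrow> v * t" "v > 0"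
      using weierstrass_pvar_rough[of b \<alpha> ?f, OF b \<alpha>(1) f p D s] nz by blast
    have "V \<omega> = v" using v(1)[of 1] unfolding V_def fwwb_eq_weierstrass by (intro limI) simp
    then show ?case using v unfolding fwwb_eq_weierstrass by simp
  qed
  moreover have "V \<in> borel_measurable M"
  proof -
    have W[measurable]: "W t \<in> borel_measurable M" if "t \<ge> 0" for t using fbm that by (simp add: is_fbm_def)
    have [measurable]: "(\<lambda>\<omega>. fbb \<kappa> W (frac x) \<omega>) \<in> borel_measurable M" for x
      unfolding fbb_def using W[of "frac x"] W[of 1] by (intro borel_measurable_diff borel_measurable_times) (auto simp: frac_ge_0)
    have [measurable]: "(\<lambda>\<omega>. fwwb \<alpha> b \<kappa> W t \<omega>) \<in> borel_measurable M" for t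
      unfolding fwwb_def by measurable
    have "(\<lambda>\<omega>. pvar_sum (?X \<omega>) b (1 / K) 1 N) \<in> borel_measurable M" for N
      unfolding pvar_sum_def by measurable
    then show ?thesis unfolding V_def[abs_def] by (intro borel_measurable_lim_metric)
  qed
  ultimately show ?thesis by (intro exI[of _ V]) (auto elim: AE_mp)
qed

text \<open>The exponent \<open>1 / H\<close> turns the normalisation \<open>b powr (N * H)\<close>
  into the divisor \<open>b ^ N\<close>, so the variation is an empirical moment. Replacing the
  bridge by \<open>W\<close> changes the normalised increments by a convolution of
  \<open>r ^ i\<close> with the relative size of the increments of \<open>\<kappa>\<close>.\<close>

lemma fwwb_pvar_smooth_AE:
  assumes H: "0 < H" "H < 1" and fbm: "is_fbm M H W" and \<alpha>: "0 < \<alpha>" and b: "b \<ge> 2" and \<kappa>: "\<kappa> 0 = 0" "\<kappa> 1 = 1" and \<tau>: "H < \<tau>"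
    and holder: "\<forall>s\<in>{0..1}. \<forall>t\<in>{0..1}. \<bar>\<kappa> s - \<kappa> t\<bar> \<le> C * \<bar>s - t\<bar> powr \<tau>"
    and r: "\<alpha> * real b powr H < 1"
  shows "AE \<omega> in M. \<forall>t\<in>{0..1}. (\<lambda>N. pvar_sum (\<lambda>s. fwwb \<alpha> b \<kappa> W s \<omega>) b (1 / H) t N) \<longlonglongrightarrow>
     2 powr (1 / (2 * H)) * Gamma ((H + 1) / (2 * H)) / (sqrt pi * (1 - \<alpha>\<^sup>2 * real b powr (2 * H)) powr (1 / (2 * H))) * t"
proof -
  have b1: "real b > 1" using b by simp
  define r where "r = \<alpha> * real b powr H"
  have r: "0 \<le> r" "r < 1" using \<alpha> r by (auto simp: r_def)
  have p: "1 / H > 0" using H by simp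
  let ?c = "(1 / (1 - r\<^sup>2)) powr (1 / H / 2) * (2 powr (1 / H / 2) * Gamma ((1 / H + 1) / 2) / sqrt pi)"
  have r2: "r\<^sup>2 = \<alpha>\<^sup>2 * real b powr (2 * H)" "r\<^sup>2 < 1"
  proof -
    show "r\<^sup>2 = \<alpha>\<^sup>2 * real b powr (2 * H)"
      unfolding r_def power_mult_distrib by (simp add: power2_eq_square flip: powr_add)
    show "r\<^sup>2 < 1" using r by (simp add: power_less_one_iff abs_square_less_1)
  qed
  have const: "?c = 2 powr (1 / (2 * H)) * Gamma ((H + 1) / (2 * H)) / (sqrt pi * (1 - \<alpha>\<^sup>2 * real b powr (2 * H)) powr (1 / (2 * H)))"
  proof -
    have e: "1 / H / 2 = 1 / (2 * H)" "(1 / H + 1) / 2 = (H + 1) / (2 * H)" using H by (auto simp: field_simps)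
    have pd: "(1 / (1 - r\<^sup>2)) powr x = 1 / (1 - r\<^sup>2) powr x" for x using r2(2) by (simp add: powr_divide)
    have gen: "1 / A * (B * G / S) = B * G / (S * A)" for A B G S :: real by simp
    show ?thesis unfolding r2(1)[symmetric] e pd gen ..
  qed
  \<comment> \<open>Ratio per level of the increments of \<open>\<kappa>\<close> to those of
    \<open>W\<close>, smaller than 1 because \<open>\<tau> > H\<close>.\<close>
  define s where "s = real b powr (H - \<tau>)"
  have "s < real b powr 0" unfolding s_def using b1 \<tau> by (intro powr_less_mono) auto
  then have s: "0 \<le> s" "s < 1" using b1 by (auto simp: s_def)
  obtain c q where c: "0 \<le> c" "0 < q" "q < 1" "\<And>N. (\<Sum>i<N. r ^ i * s ^ (N - i)) \<le> c * q ^ N"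
    using convolution_geometric_bound[OF r s] by auto
  from level_sum_moment_AE[OF H b r fbm p] fbm_zero_AE[OF fbm] have "AE \<omega> in M. \<forall>t\<in>{0..1}. (\<lambda>N. pvar_sum (\<lambda>s. fwwb \<alpha> b \<kappa> W s \<omega>) b (1 / H) t N) \<longlonglongrightarrow> ?c * t"
  proof (eventually_elim, intro ballI)
    fix \<omega> t assume mom: "\<forall>t\<in>\<rat> \<inter> {0<..1}. \<forall>y \<epsilon>. \<epsilon> \<longlonglongrightarrow> 0 \<longrightarrow> (\<forall>N k. k < b^N \<longrightarrow> \<bar>y N k - level_sum H b r W N k \<omega>\<bar> \<le> \<epsilon> N) \<longrightarrow>
      (\<lambda>N. (\<Sum>k<nat \<lfloor>t * real b ^ N\<rfloor>. \<bar>y N k\<bar> powr (1 / H)) / real b ^ N) \<longlonglongrightarrow> ?c * t"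
      and W0: "W 0 \<omega> = 0" and t: "t \<in> {0..1::real}"
    let ?f = "\<lambda>x. fbb \<kappa> W x \<omega>"
    have f: "?f 0 = 0" "?f 1 = 0" using W0 \<kappa> by (auto simp: fbb_def)
    define g where "g N k = (\<Sum>i<N. \<alpha> ^ i * badic_incr ?f b (N - i) (k mod b ^ (N - i)))" for N k
    define y where "y N k = real b powr (real N * H) * g N k" for N k
    define \<epsilon> where "\<epsilon> N = \<bar>C\<bar> * \<bar>W 1 \<omega>\<bar> * (c * q ^ N)" for N
    have wt: "real b powr (real N * H) * \<alpha> ^ i = r ^ i * real b powr (real (N - i) * H)" if "i < N" for i N
    proof -
      have "real N * H = H * real i + real (N - i) * H" using that by (simp add: of_nat_diff algebra_simps)
      moreover have "real b powr (H * real i) = (real b powr H) ^ i"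
        using b1 powr_realpow[of "real b powr H" i] by (simp add: powr_powr)
      ultimately show ?thesis by (simp only: powr_add r_def power_mult_distrib mult_ac)
    qed
    have e0: "\<epsilon> \<longlonglongrightarrow> 0" unfolding \<epsilon>_def
      using c by (intro tendsto_mult_right_zero LIMSEQ_power_zero) auto
    have e: "\<bar>y N k - level_sum H b r W N k \<omega>\<bar> \<le> \<epsilon> N" for N k
    proof -
      have "y N k - level_sum H b r W N k \<omega> = (\<Sum>i<N. - (r ^ i * real b powr (real (N - i) * H) * (badic_incr \<kappa> b (N - i) (k mod b ^ (N - i)) * W 1 \<omega>)))"
        unfolding y_def g_def level_sum_def sum_distrib_left sum_subtractf[symmetric]
      proof (intro sum.cong refl)
        fix i assume "i \<in> {..<N}"
        then have i: "i < N" by simp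
        show "real b powr (real N * H) * (\<alpha> ^ i * badic_incr ?f b (N - i) (k mod b ^ (N - i)))
          - r ^ i * (real b powr (real (N - i) * H) * (W (real (k mod b ^ (N - i) + 1) / real b ^ (N - i)) \<omega> - W (real (k mod b ^ (N - i)) / real b ^ (N - i)) \<omega>))
          = - (r ^ i * real b powr (real (N - i) * H) * (badic_incr \<kappa> b (N - i) (k mod b ^ (N - i)) * W 1 \<omega>))"
          unfolding mult.assoc[symmetric] wt[OF i] badic_incr_fbb badic_incr_def by (simp only: algebra_simps)
      qed
      also have "\<bar>\<dots>\<bar> \<le> (\<Sum>i<N. \<bar>C\<bar> * \<bar>W 1 \<omega>\<bar> * (r ^ i * s ^ (N - i)))"
      proof (intro order_trans[OF sum_abs] sum_mono)
        fix i
        have "\<bar>badic_incr \<kappa> b (N - i) (k mod b ^ (N - i))\<bar> \<le> C * (real b powr (- \<tau>)) ^ (N - i)"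
          using b by (intro badic_incr_holder[OF holder b]) auto
        also have "\<dots> \<le> \<bar>C\<bar> * (real b powr (- \<tau>)) ^ (N - i)" by (intro mult_right_mono) auto
        finally have k: "\<bar>badic_incr \<kappa> b (N - i) (k mod b ^ (N - i))\<bar> \<le> \<bar>C\<bar> * (real b powr (- \<tau>)) ^ (N - i)" .
        have "real b powr (real m * H) * (real b powr (- \<tau>)) ^ m = s ^ m" for m
        proof -
          have "(real b powr x) ^ m = real b powr (x * real m)" for x
            using b1 powr_realpow[of "real b powr x" m] by (simp add: powr_powr)
          then show ?thesis by (simp add: s_def algebra_simps flip: powr_add)
        qed
        note sm = this[of "N - i"]
        have "\<bar>- (r ^ i * real b powr (real (N - i) * H) * (badic_incr \<kappa> b (N - i) (k mod b ^ (N - i)) * W 1 \<omega>))\<bar>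
          = r ^ i * real b powr (real (N - i) * H) * (\<bar>badic_incr \<kappa> b (N - i) (k mod b ^ (N - i))\<bar> * \<bar>W 1 \<omega>\<bar>)"
          using r by (simp add: abs_mult)
        also have "\<dots> \<le> r ^ i * real b powr (real (N - i) * H) * (\<bar>C\<bar> * (real b powr (- \<tau>)) ^ (N - i) * \<bar>W 1 \<omega>\<bar>)"
          using r k by (intro mult_left_mono mult_right_mono) auto
        also have "\<dots> = \<bar>C\<bar> * \<bar>W 1 \<omega>\<bar> * (r ^ i * (real b powr (real (N - i) * H) * (real b powr (- \<tau>)) ^ (N - i)))"
          by (simp only: mult_ac)
        finally show "\<bar>- (r ^ i * real b powr (real (N - i) * H) * (badic_incr \<kappa> b (N - i) (k mod b ^ (N - i)) * W 1 \<omega>))\<bar>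
          \<le> \<bar>C\<bar> * \<bar>W 1 \<omega>\<bar> * (r ^ i * s ^ (N - i))" unfolding sm .
      qed
      also have "\<dots> \<le> \<epsilon> N"
        unfolding \<epsilon>_def sum_distrib_left[symmetric] using c(4)[of N] by (intro mult_left_mono) auto
      finally show ?thesis .
    qed
    have pv: "pvar_sum (\<lambda>s. fwwb \<alpha> b \<kappa> W s \<omega>) b (1 / H) t N = (\<Sum>k<nat \<lfloor>t * real b ^ N\<rfloor>. \<bar>y N k\<bar> powr (1 / H) / real b ^ N)" for t N
      unfolding fwwb_eq_weierstrass pvar_sum_weierstrass[of b ?f, OF b f] g_def[symmetric]
    proof (intro sum.cong refl)
      fix k
      have "(real b powr (real N * H)) powr (1 / H) = real b ^ N" using H b1 by (simp add: powr_powr powr_realpow)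
      then show "\<bar>g N k\<bar> powr (1 / H) = \<bar>y N k\<bar> powr (1 / H) / real b ^ N"
        using b1 by (simp add: y_def abs_mult powr_mult)
    qed
    show "(\<lambda>N. pvar_sum (\<lambda>s. fwwb \<alpha> b \<kappa> W s \<omega>) b (1 / H) t N) \<longlonglongrightarrow> ?c * t"
      unfolding pv
    proof (rule counting_sum_all_times[OF b _ _ t])
      fix t :: real assume "t \<in> \<rat> \<inter> {0<..1}"
      with mom e0 e show "(\<lambda>N. \<Sum>k<nat \<lfloor>t * real b ^ N\<rfloor>. \<bar>y N k\<bar> powr (1 / H) / real b ^ N) \<longlonglongrightarrow> ?c * t"
        unfolding sum_divide_distrib[symmetric] by blast
    qed simp
  qed
  then show ?thesis unfolding const .
qed

theorem theorem2p3:
  fixes M :: "'a measure" and W :: "real \<Rightarrow> 'a \<Rightarrow> real" and \<kappa> :: "real \<Rightarrow> real"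
    and H \<alpha> \<tau> C :: real and b :: nat
  assumes H: "0 < H" "H < 1"
    and fbm: "is_fbm M H W"
    and \<alpha>: "0 < \<alpha>" "\<alpha> < 1"
    and b: "b \<ge> 2"
    and \<kappa>0: "\<kappa> 0 = 0" and \<kappa>1: "\<kappa> 1 = 1"
    and \<kappa>range: "\<forall>t\<in>{0..1}. \<kappa> t \<in> {0..1}"
    and \<tau>: "H < \<tau>" "\<tau> \<le> 1"
    and holder: "\<forall>s\<in>{0..1}. \<forall>t\<in>{0..1}. \<bar>\<kappa> s - \<kappa> t\<bar> \<le> C * \<bar>s - t\<bar> powr \<tau>"
    and HK: "H \<noteq> min 1 (- log (real b) \<alpha>)"
  shows "(AE \<omega> in M.
            (\<forall>q. 0 < q \<and> q < 1 / min H (min 1 (- log (real b) \<alpha>)) \<longrightarrow>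
                 has_pvar (\<lambda>t. fwwb \<alpha> b \<kappa> W t \<omega>) b q 1 \<infinity>) \<and>
            (\<forall>q. q > 1 / min H (min 1 (- log (real b) \<alpha>)) \<longrightarrow>
                 has_pvar (\<lambda>t. fwwb \<alpha> b \<kappa> W t \<omega>) b q 1 0))
       \<and> (H > min 1 (- log (real b) \<alpha>) \<longrightarrow>
            (\<exists>V. V \<in> borel_measurable M \<and> (AE \<omega> in M. 0 < V \<omega>) \<and>
                 (AE \<omega> in M. \<forall>t\<in>{0..1}.
                    has_pvar (\<lambda>s. fwwb \<alpha> b \<kappa> W s \<omega>) b (1 / min 1 (- log (real b) \<alpha>)) t
                      (ereal (V \<omega> * t)))))
       \<and> (H < min 1 (- log (real b) \<alpha>) \<longrightarrow>
            (AE \<omega> in M. \<forall>t\<in>{0..1}.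
               has_pvar (\<lambda>s. fwwb \<alpha> b \<kappa> W s \<omega>) b (1 / H) t
                 (ereal (2 powr (1 / (2 * H)) * Gamma ((H + 1) / (2 * H))
                          / (sqrt pi * (1 - \<alpha>\<^sup>2 * real b powr (2 * H)) powr (1 / (2 * H))) * t))))"
proof -
  define K where "K = min 1 (- log (real b) \<alpha>)"
  have b1: "real b > 1" using b by simp
  note other = fwwb_other_exponents_AE[OF H(1) fbm \<alpha> b \<kappa>0 \<kappa>1 \<tau>(1) holder]
  let ?X = "\<lambda>\<omega> t. fwwb \<alpha> b \<kappa> W t \<omega>"
  consider "K < H" | "H < K" using HK by (fold K_def) linarith
  then show ?thesis
  proof cases
    case 1
    \<comment> \<open>As \<open>H < 1\<close>, the value 1 in the minimum cannot lie below
      \<open>H\<close>.\<close>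
    then have K: "K = - log (real b) \<alpha>" using H by (auto simp: K_def min_def split: if_splits)
    obtain V where V: "V \<in> borel_measurable M" "AE \<omega> in M. 0 < V \<omega>"
      "AE \<omega> in M. \<forall>t\<in>{0..1}. (\<lambda>N. pvar_sum (?X \<omega>) b (1 / K) t N) \<longlonglongrightarrow> V \<omega> * t"
      using fwwb_pvar_rough_AE[OF H fbm \<alpha> b \<kappa>0 \<kappa>1 \<tau>(1) holder K 1] by blast
    have "AE \<omega> in M. (\<forall>q. 0 < q \<and> q < 1 / K \<longrightarrow> has_pvar (?X \<omega>) b q 1 \<infinity>) \<and> (\<forall>q. q > 1 / K \<longrightarrow> has_pvar (?X \<omega>) b q 1 0)"
      using other V(2,3)
    proof eventually_elim
      case (elim \<omega>)
      have "(\<lambda>N. pvar_sum (?X \<omega>) b (1 / K) 1 N) \<longlonglongrightarrow> V \<omega>" using elim(3)[rule_format, of 1] by simp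
      then show ?case using elim(1,2) by blast
    qed
    moreover have "AE \<omega> in M. \<forall>t\<in>{0..1}. has_pvar (?X \<omega>) b (1 / K) t (ereal (V \<omega> * t))"
      using V(3) by eventually_elim (auto simp: has_pvar_def intro: tendsto_ereal)
    ultimately show ?thesis using V(1,2) 1 unfolding K_def[symmetric] by (auto simp: min_def)
  next
    case 2
    let ?c = "2 powr (1 / (2 * H)) * Gamma ((H + 1) / (2 * H)) / (sqrt pi * (1 - \<alpha>\<^sup>2 * real b powr (2 * H)) powr (1 / (2 * H)))"
    have r: "\<alpha> * real b powr H < 1"
    proof -
      have "H < - log (real b) \<alpha>" using 2 by (simp add: K_def)
      then have "real b powr (log (real b) \<alpha> + H) < real b powr 0" using b1 by (intro powr_less_mono) auto
      then show ?thesis using b1 \<alpha> by (simp add: powr_add)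
    qed
    have lim: "AE \<omega> in M. \<forall>t\<in>{0..1}. (\<lambda>N. pvar_sum (?X \<omega>) b (1 / H) t N) \<longlonglongrightarrow> ?c * t"
      by (rule fwwb_pvar_smooth_AE[OF H fbm \<alpha>(1) b \<kappa>0 \<kappa>1 \<tau>(1) holder r])
    \<comment> \<open>Positivity is what allows the deterministic limit to decide the exponents
      below \<open>1 / H\<close>.\<close>
    have c0: "?c > 0"
    proof -
      have "(\<alpha> * real b powr H)\<^sup>2 < 1" using r \<alpha> by (simp add: power_less_one_iff abs_square_less_1)
      then have "\<alpha>\<^sup>2 * real b powr (2 * H) < 1"
        unfolding power_mult_distrib by (simp add: power2_eq_square flip: powr_add)
      then show ?thesis using H by (intro divide_pos_pos mult_pos_pos Gamma_real_pos) auto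
    qed
    have "AE \<omega> in M. (\<forall>q. 0 < q \<and> q < 1 / H \<longrightarrow> has_pvar (?X \<omega>) b q 1 \<infinity>) \<and> (\<forall>q. q > 1 / H \<longrightarrow> has_pvar (?X \<omega>) b q 1 0)"
      using other lim
    proof eventually_elim
      case (elim \<omega>)
      have "(\<lambda>N. pvar_sum (?X \<omega>) b (1 / H) 1 N) \<longlonglongrightarrow> ?c" using elim(2)[rule_format, of 1] by simp
      then show ?case using elim(1) c0 by blast
    qed
    moreover have "AE \<omega> in M. \<forall>t\<in>{0..1}. has_pvar (?X \<omega>) b (1 / H) t (ereal (?c * t))"
      using lim by eventually_elim (auto simp: has_pvar_def intro: tendsto_ereal)
    ultimately show ?thesis using 2 unfolding K_def[symmetric] by (auto simp: min_def)
  qed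
qed

end
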